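(* Let $X$ be an operator space and let $\boldsymbol{K}=\mathrm{CBall}(X')=(K_{r,s})$ be the corresponding compact rectangular matrix convex set, i.e. $K_{r,s}$ is the set of completely contractive linear maps $X\to M_{r,s}(\mathbb{C})$. If $n,m\in\mathbb{N}$ and $x\in M_{n,m}(X)$, then $\|x\|$ is the supremum of $\|\varphi^{(n,m)}(x)\|$, where $\varphi$ ranges over all rectangular matrix extreme points of $\boldsymbol{K}$ lying in $K_{r,s}$ for some $r\le n$ and $s\le m$.
   Context: $\mathbb{N}=\{1,2,\dots\}$; operator spaces are complex. For $\varphi:X\to M_{r,s}(\mathbb{C})$ linear and $x=[x_{ij}]\in M_{n,m}(X)$, $\varphi^{(n,m)}(x)=[\varphi(x_{ij})]\in M_{nr,ms}(\mathbb{C})$, with the operator norm. An element $v\in K_{r,s}$ is a rectangular matrix extreme point of $\boldsymbol{K}$ if whenever $v=\sum_{i=1}^\ell\alpha_i^*v_i\beta_i$ with $v_i\in K_{r_i,s_i}$ ($r_i,s_i\in\mathbb{N}$), $\alpha_i\in M_{r_i,r}(\mathbb{C})$ and $\beta_i\in M_{s_i,s}(\mathbb{C})$ right invertible, $\sum_i\alpha_i^*\alpha_i=1$ and $\sum_i\beta_i^*\beta_i=1$, then for every $i$ one has $r_i=r$, $s_i=s$ and $v_i=u_i^*vw_i$ for some unitaries $u_i\in M_r(\mathbb{C})$ and $w_i\in M_s(\mathbb{C})$. *)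

theory Defs
  imports
    Complex_Main
    "HOL-Library.Lub_Glb"
    "HOL-Analysis.L2_Norm"
    "Jordan_Normal_Form.Matrix"
    "Jordan_Normal_Form.Schur_Decomposition"
begin

text \<open>
  All matrix sizes that carry mathematical content are at least 1; the degenerate sizes
  available in the matrix type are excluded by explicit hypotheses.
\<close>

definition l2norm :: "complex vec \<Rightarrow> real" where
  "l2norm v = L2_set (\<lambda>i. cmod (v $ i)) {..<dim_vec v}"

definition op_norm :: "complex mat \<Rightarrow> real" where
  "op_norm A = (SUP v\<in>{v \<in> carrier_vec (dim_col A). l2norm v \<le> 1}. l2norm (A *\<^sub>v v))"

definition unitary_mat :: "nat \<Rightarrow> complex mat \<Rightarrow> bool" where
  "unitary_mat r u \<longleftrightarrow> u \<in> carrier_mat r r \<and>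
     u * mat_adjoint u = 1\<^sub>m r \<and> mat_adjoint u * u = 1\<^sub>m r"

definition right_invertible_mat :: "complex mat \<Rightarrow> bool" where
  "right_invertible_mat A \<longleftrightarrow> (\<exists>B\<in>carrier_mat (dim_col A) (dim_row A). inverts_mat A B)"

text \<open>The type of matrices has no zero independent of the size, so finite sums are taken
  entrywise with the size given explicitly.\<close>

definition msum :: "nat \<Rightarrow> nat \<Rightarrow> nat \<Rightarrow> (nat \<Rightarrow> complex mat) \<Rightarrow> complex mat" where
  "msum r s l A = mat r s (\<lambda>(p, q). \<Sum>i<l. A i $$ (p, q))"

definition lmult ::
  "(complex \<Rightarrow> 'a::ab_group_add \<Rightarrow> 'a) \<Rightarrow> complex mat \<Rightarrow> 'a mat \<Rightarrow> 'a mat" where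
  "lmult scale \<alpha> x = mat (dim_row \<alpha>) (dim_col x)
     (\<lambda>(i, j). \<Sum>k<dim_row x. scale (\<alpha> $$ (i, k)) (x $$ (k, j)))"

definition rmult ::
  "(complex \<Rightarrow> 'a::ab_group_add \<Rightarrow> 'a) \<Rightarrow> 'a mat \<Rightarrow> complex mat \<Rightarrow> 'a mat" where
  "rmult scale x \<beta> = mat (dim_row x) (dim_col \<beta>)
     (\<lambda>(i, j). \<Sum>k<dim_col x. scale (\<beta> $$ (k, j)) (x $$ (i, k)))"

definition dsum :: "'a::zero mat \<Rightarrow> 'a mat \<Rightarrow> 'a mat" where
  "dsum x y = four_block_mat x (0\<^sub>m (dim_row x) (dim_col y)) (0\<^sub>m (dim_row y) (dim_col x)) y"

text \<open>
  Abstract complex operator spaces (Ruan's axioms), with underlying vector space the whole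
  type \<open>'a\<close>. The single function \<open>nrm\<close> carries the norms of all the spaces
  $M_{n,m}(X)$, since a matrix knows its size. Completeness is not assumed.
\<close>

locale operator_space = vector_space scale
  for scale :: "complex \<Rightarrow> 'a::ab_group_add \<Rightarrow> 'a" +
  fixes nrm :: "'a mat \<Rightarrow> real"
  assumes nrm_eq_0_iff:
      "\<lbrakk>1 \<le> n; 1 \<le> m; x \<in> carrier_mat n m\<rbrakk> \<Longrightarrow> nrm x = 0 \<longleftrightarrow> x = 0\<^sub>m n m"
    and nrm_triangle:
      "\<lbrakk>1 \<le> n; 1 \<le> m; x \<in> carrier_mat n m; y \<in> carrier_mat n m\<rbrakk>
        \<Longrightarrow> nrm (x + y) \<le> nrm x + nrm y"
    and nrm_scale:
      "\<lbrakk>1 \<le> n; 1 \<le> m; x \<in> carrier_mat n m\<rbrakk>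
        \<Longrightarrow> nrm (map_mat (scale c) x) = cmod c * nrm x"
    and nrm_dsum:
      "\<lbrakk>1 \<le> n; 1 \<le> m; 1 \<le> k; 1 \<le> l; x \<in> carrier_mat n m; y \<in> carrier_mat k l\<rbrakk>
        \<Longrightarrow> nrm (dsum x y) = max (nrm x) (nrm y)"
    and nrm_mult:
      "\<lbrakk>1 \<le> n; 1 \<le> m; 1 \<le> k; 1 \<le> l; x \<in> carrier_mat n m;
        \<alpha> \<in> carrier_mat k n; \<beta> \<in> carrier_mat m l\<rbrakk>
        \<Longrightarrow> nrm (rmult scale (lmult scale \<alpha> x) \<beta>) \<le> op_norm \<alpha> * nrm x * op_norm \<beta>"

definition linear_to_mat ::
  "(complex \<Rightarrow> 'a::ab_group_add \<Rightarrow> 'a) \<Rightarrow> nat \<Rightarrow> nat \<Rightarrow> ('a \<Rightarrow> complex mat) \<Rightarrow> bool" where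
  "linear_to_mat scale r s \<phi> \<longleftrightarrow>
     (\<forall>x. \<phi> x \<in> carrier_mat r s) \<and>
     (\<forall>x y. \<phi> (x + y) = \<phi> x + \<phi> y) \<and>
     (\<forall>c x. \<phi> (scale c x) = c \<cdot>\<^sub>m \<phi> x)"

text \<open>The block matrix $[\varphi(x_{ij})]$ with blocks of size $r \times s$.\<close>

definition amplify :: "nat \<Rightarrow> nat \<Rightarrow> ('a \<Rightarrow> complex mat) \<Rightarrow> 'a mat \<Rightarrow> complex mat" where
  "amplify r s \<phi> x = mat (dim_row x * r) (dim_col x * s)
     (\<lambda>(p, q). \<phi> (x $$ (p div r, q div s)) $$ (p mod r, q mod s))"

definition completely_contractive ::
  "('a mat \<Rightarrow> real) \<Rightarrow> nat \<Rightarrow> nat \<Rightarrow> ('a \<Rightarrow> complex mat) \<Rightarrow> bool" where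
  "completely_contractive nrm r s \<phi> \<longleftrightarrow>
     (\<forall>n\<ge>1. \<forall>m\<ge>1. \<forall>x\<in>carrier_mat n m. op_norm (amplify r s \<phi> x) \<le> nrm x)"

definition CBall ::
  "(complex \<Rightarrow> 'a::ab_group_add \<Rightarrow> 'a) \<Rightarrow> ('a mat \<Rightarrow> real) \<Rightarrow> nat \<Rightarrow> nat \<Rightarrow> ('a \<Rightarrow> complex mat) set"
where
  "CBall scale nrm r s =
     {\<phi>. linear_to_mat scale r s \<phi> \<and> completely_contractive nrm r s \<phi>}"

text \<open>
  Elements of $M_{r,s}(X')$ are identified with matrix-valued maps on $X$, so
  $\alpha^* v \beta$ is the map $x \mapsto \alpha^* v(x) \beta$.
\<close>

definition rect_matrix_extreme ::
  "(nat \<Rightarrow> nat \<Rightarrow> ('a \<Rightarrow> complex mat) set) \<Rightarrow> nat \<Rightarrow> nat \<Rightarrow> ('a \<Rightarrow> complex mat) \<Rightarrow> bool"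
where
  "rect_matrix_extreme K r s v \<longleftrightarrow>
     v \<in> K r s \<and>
     (\<forall>(l::nat) (\<rho>::nat \<Rightarrow> nat) (\<sigma>::nat \<Rightarrow> nat) vs \<alpha> \<beta>.
        (\<forall>i<l. 1 \<le> \<rho> i \<and> 1 \<le> \<sigma> i \<and> vs i \<in> K (\<rho> i) (\<sigma> i) \<and>
               \<alpha> i \<in> carrier_mat (\<rho> i) r \<and> right_invertible_mat (\<alpha> i) \<and>
               \<beta> i \<in> carrier_mat (\<sigma> i) s \<and> right_invertible_mat (\<beta> i)) \<and>
        msum r r l (\<lambda>i. mat_adjoint (\<alpha> i) * \<alpha> i) = 1\<^sub>m r \<and>
        msum s s l (\<lambda>i. mat_adjoint (\<beta> i) * \<beta> i) = 1\<^sub>m s \<and>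
        v = (\<lambda>x. msum r s l (\<lambda>i. mat_adjoint (\<alpha> i) * vs i x * \<beta> i))
        \<longrightarrow>
        (\<forall>i<l. \<rho> i = r \<and> \<sigma> i = s \<and>
           (\<exists>u w. unitary_mat r u \<and> unitary_mat s w \<and>
              vs i = (\<lambda>x. mat_adjoint u * v x * w))))"

end

theory Submission
  imports Defs "HOL-Library.Function_Algebras" "HOL-Library.Product_Plus"
begin

text \<open>
  Consider triples $(a, z, b)$ with $a \in M_n$, $z \in M_{n,m}(X)$, $b \in M_m$, and the cone
  of those with $a \ge \alpha^* \alpha$, $z = \alpha^* y \beta$, $b \ge \beta^* \beta$ for some $y$
  of norm at most $1$. Ruan's axioms make $(1, 0, 1)$ an order unit for which
  $t (1, 0, 1) - (0, x, 0)$ lies in the cone only if $t \ge \|x\|$. Hence some pure state $f$ of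
  the cone takes a value at least $\|x\|$ at $(0, x, 0)$. Every state has the form
  \[ f(a, z, b) = \mathrm{Re} \sum (A^* A)_{ij} a_{ij} + \mathrm{Re} \sum (B^* B)_{ij} b_{ij}
     + 2\, \mathrm{Re} \sum (A^* \varphi(z_{ij}) B)_{ij} \]
  with $\varphi \in K_{r,s}$ and $A$, $B$ right invertible with $r \le n$ and $s \le m$ rows, which
  gives $f(0, x, 0) \le \|\varphi^{(n,m)}(x)\|$ by Cauchy-Schwarz. If
  $\varphi = \sum_i \alpha_i^* \varphi_i \beta_i$, then $f$ is the sum of the positive functionals
  built from $(\alpha_i A, \varphi_i, \beta_i B)$. Purity makes each of them a multiple $t_i f$, so
  $\alpha_i^* \alpha_i = t_i 1$, $\beta_i^* \beta_i = t_i 1$ and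
  $\alpha_i^* \varphi_i \beta_i = t_i \varphi$: up to scaling, $\alpha_i$ and $\beta_i$ are unitary,
  and $\varphi$ is extreme. If $x = 0$, then $A$ or $B$ may have no rows, and a pure state for another
  element of $M_{n,m}(X)$ is used.
\<close>

section \<open>Pure states of cones with an order unit\<close>

text \<open>The cone describes positive block matrices by factorizations and not by the equivalent
  bound on a^(-1/2) z b^(-1/2): sums of triples then become direct sums of the middle factors, and
  no square roots of matrices occur. The operator space is never realized concretely; each positive
  functional produces its own completely contractive map. The size bounds arise there: the diagonal
  parts of a positive functional are positive semidefinite forms on C^n and C^m, and r and s are
  their ranks. Extremality speaks of matrix coefficients, purity only of scalar functionals. The
  bridge is that the vectors \<open>A\<close> and \<open>B\<close> absorb the coefficients, and
  their right invertibility allows an identity between compressed maps to be cancelled to one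
  between the maps. The estimate loses no constant: the corner enters a functional with the factor
  2, the squared norms of \<open>A\<close> and \<open>B\<close> add up to 1, and 2 a b \<le> a^2 +
  b^2.\<close>

definition functional :: "(real \<Rightarrow> 'v::ab_group_add \<Rightarrow> 'v) \<Rightarrow> ('v \<Rightarrow> real) \<Rightarrow> bool" where
  "functional sc f \<longleftrightarrow> (\<forall>u v. f (u + v) = f u + f v) \<and> (\<forall>c v. f (sc c v) = c * f v)"

definition sublinear :: "(real \<Rightarrow> 'v::ab_group_add \<Rightarrow> 'v) \<Rightarrow> ('v \<Rightarrow> real) \<Rightarrow> bool" where
  "sublinear sc Q \<longleftrightarrow> (\<forall>u v. Q (u + v) \<le> Q u + Q v) \<and> (\<forall>c v. 0 \<le> c \<longrightarrow> Q (sc c v) = c * Q v)"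

text \<open>The linear functionals below \<open>Q\<close> form a face of the convex set of those below \<open>P\<close>. A minimal
  such \<open>Q\<close> is itself linear, hence an extreme point: this replaces Hahn-Banach and Krein-Milman.\<close>

definition sublinear_face ::
  "(real \<Rightarrow> 'v::ab_group_add \<Rightarrow> 'v) \<Rightarrow> ('v \<Rightarrow> real) \<Rightarrow> ('v \<Rightarrow> real) \<Rightarrow> bool" where
  "sublinear_face sc P Q \<longleftrightarrow> sublinear sc Q \<and> Q \<le> P \<and>
     (\<forall>g h t. functional sc g \<and> functional sc h \<and> g \<le> P \<and> h \<le> P \<and> 0 < t \<and> t < 1 \<and>
        (\<forall>v. t * g v + (1 - t) * h v \<le> Q v) \<longrightarrow> g \<le> Q \<and> h \<le> Q)"

text \<open>A linear functional \<open>g\<close> is below \<open>peak sc Q v\<close> iff it is below \<open>Q\<close> and \<open>g v = Q v\<close>.\<close>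

definition peak :: "(real \<Rightarrow> 'v::ab_group_add \<Rightarrow> 'v) \<Rightarrow> ('v \<Rightarrow> real) \<Rightarrow> 'v \<Rightarrow> 'v \<Rightarrow> real" where
  "peak sc Q v w = (INF t\<in>{0..}. Q (w + sc t v) - t * Q v)"

context
  fixes sc :: "real \<Rightarrow> 'v::ab_group_add \<Rightarrow> 'v"
  assumes vs: "vector_space sc"
begin

interpretation vector_space sc by (rule vs)

lemma functional_minus: "functional sc f \<Longrightarrow> f (- v) = - f v"
  unfolding functional_def by (metis mult_minus1 scale_minus_left scale_one)

lemma functional_divide: "functional sc f \<Longrightarrow> functional sc (\<lambda>v. f v / c)"
  by (simp add: functional_def add_divide_distrib)

lemma functional_diff: "functional sc f \<Longrightarrow> f (u - v) = f u - f v"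
  using functional_minus[of f v] unfolding functional_def
  by (metis add_uminus_conv_diff)

lemma sublinear_zero: "sublinear sc Q \<Longrightarrow> Q 0 = 0"
  unfolding sublinear_def by (metis mult_zero_left order_refl scale_zero_left)

lemma sublinear_neg: "sublinear sc Q \<Longrightarrow> - Q (- w) \<le> Q w"
  using sublinear_zero[of Q] unfolding sublinear_def
      by (metis add.right_inverse add.commute neg_le_iff_le
      minus_add_cancel add_le_cancel_left add.right_neutral)

section \<open>Peaks of sublinear functionals and the faces that they cut out\<close>

lemma peak_bdd:
  assumes "sublinear sc Q"
  shows "bdd_below ((\<lambda>t. Q (w + sc t v) - t * Q v) ` {0..})"
proof (rule bdd_belowI2[where m = "- Q (- w)"])
  fix t :: real assume "t \<in> {0..}"
  then have "t * Q v = Q (sc t v)" using assms by (simp add: sublinear_def)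
  also have "\<dots> = Q ((w + sc t v) + (- w))" by simp
  also have "\<dots> \<le> Q (w + sc t v) + Q (- w)" using assms unfolding sublinear_def by blast
  finally show "- Q (- w) \<le> Q (w + sc t v) - t * Q v" by simp
qed

lemma peak_le:
  "sublinear sc Q \<Longrightarrow> 0 \<le> t \<Longrightarrow> peak sc Q v w \<le> Q (w + sc t v) - t * Q v"
  unfolding peak_def by (intro cINF_lower peak_bdd) auto

lemma peak_greatest:
  "(\<And>t. 0 \<le> t \<Longrightarrow> c \<le> Q (w + sc t v) - t * Q v) \<Longrightarrow> c \<le> peak sc Q v w"
  unfolding peak_def by (intro cINF_greatest) auto

lemma peak_le_self: "sublinear sc Q \<Longrightarrow> peak sc Q v \<le> Q"
  using peak_le[of Q 0 v] by (auto simp: le_fun_def)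

text \<open>The value at -v pins down a linear g below the peak: g (-v) \<le> - Q v means g v \<ge>
  Q v.\<close>

lemma peak_neg: "sublinear sc Q \<Longrightarrow> peak sc Q v (- v) \<le> - Q v"
  using peak_le[of Q 1 v "- v"] sublinear_zero[of Q] by simp

text \<open>For subadditivity, a parameter s used for a and a parameter t used for b add up to the
  admissible parameter s + t for a + b.\<close>

lemma sublinear_peak:
  assumes Q: "sublinear sc Q"
  shows "sublinear sc (peak sc Q v)"
proof -
  have add: "peak sc Q v (a + b) \<le> peak sc Q v a + peak sc Q v b" for a b
  proof -
    have "peak sc Q v (a + b) - (Q (b + sc t v) - t * Q v) \<le> peak sc Q v a" if "0 \<le> t" for t
    proof (rule peak_greatest)
      fix s :: real assume "0 \<le> s"
      then have "peak sc Q v (a + b) \<le> Q (a + b + sc (s + t) v) - (s + t) * Q v"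
        using that by (intro peak_le[OF Q]) auto
      also have "a + b + sc (s + t) v = (a + sc s v) + (b + sc t v)"
        by (simp add: scale_left_distrib algebra_simps)
      also have "Q \<dots> \<le> Q (a + sc s v) + Q (b + sc t v)" using Q unfolding sublinear_def by blast
      finally show "peak sc Q v (a + b) - (Q (b + sc t v) - t * Q v) \<le> Q (a + sc s v) - s * Q v"
        by (simp add: algebra_simps)
    qed
    then have "peak sc Q v (a + b) - peak sc Q v a \<le> peak sc Q v b"
      by (intro peak_greatest) (smt (verit))
    then show ?thesis by simp
  qed
  \<comment> \<open>One inequality is enough: with 1 / c and the scaled vector it yields the reverse
    one.\<close>
  have pos: "c * peak sc Q v a \<le> peak sc Q v (sc c a)" if c: "0 < c" for c a
  proof (rule peak_greatest)
    fix t :: real assume t: "0 \<le> t"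
    have "sc c a + sc t v = sc c (a + sc (t / c) v)" using c by (simp add: scale_right_distrib)
    then have "Q (sc c a + sc t v) = c * Q (a + sc (t / c) v)"
      using Q c by (simp add: sublinear_def)
    moreover have "c * peak sc Q v a \<le> c * (Q (a + sc (t / c) v) - (t / c) * Q v)"
      using c t by (intro mult_left_mono peak_le[OF Q]) auto
    ultimately show "c * peak sc Q v a \<le> Q (sc c a + sc t v) - t * Q v"
      using c by (simp add: algebra_simps)
  qed
  have "peak sc Q v (sc c a) = c * peak sc Q v a" if c: "0 \<le> c" for c a
  proof (cases "c = 0")
    case True
    have "peak sc Q v 0 \<le> 0"
      using peak_le[OF Q, of 0 v 0] sublinear_zero[OF Q] by simp
    moreover have "0 \<le> peak sc Q v 0"
      using Q by (intro peak_greatest) (simp add: sublinear_def)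
    ultimately show ?thesis using True by simp
  next
    case False
    then have c: "0 < c" using that by simp
    have "(1 / c) * peak sc Q v (sc c a) \<le> peak sc Q v (sc (1 / c) (sc c a))"
      using c by (intro pos) auto
    then have "peak sc Q v (sc c a) \<le> c * peak sc Q v a"
      using c by (simp add: field_simps)
    then show ?thesis using pos[OF c, of a] by simp
  qed
  with add show ?thesis by (simp add: sublinear_def)
qed

text \<open>Maximizers form a face. A proper convex combination of g and h below the peak takes the
  value Q v at v; neither g v nor h v exceeds Q v, so both equal it, and this places g and h
  themselves below the peak.\<close>

lemma sublinear_face_peak:
  assumes "sublinear_face sc P Q"
  shows "sublinear_face sc P (peak sc Q v)"
proof -
  have Q: "sublinear sc Q" "Q \<le> P"
    and face: "\<And>g h t. \<lbrakk>functional sc g; functional sc h; g \<le> P; h \<le> P; 0 < t; t < 1;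
      \<forall>v. t * g v + (1 - t) * h v \<le> Q v\<rbrakk> \<Longrightarrow> g \<le> Q \<and> h \<le> Q"
    using assms unfolding sublinear_face_def by blast+
  have "g \<le> peak sc Q v \<and> h \<le> peak sc Q v"
    if g: "functional sc g" and h: "functional sc h" and "g \<le> P" "h \<le> P" and t: "0 < t" "t < 1"
      and le: "\<forall>w. t * g w + (1 - t) * h w \<le> peak sc Q v w" for g h t
  proof -
    have "\<forall>w. t * g w + (1 - t) * h w \<le> Q w"
      using le peak_le_self[OF Q(1), of v] by (meson le_funD order_trans)
    then have gh: "g \<le> Q" "h \<le> Q" using face[of g h t] that by auto
    have "t * g (- v) + (1 - t) * h (- v) \<le> - Q v"
      using le peak_neg[OF Q(1), of v] by (meson order_trans)
    then have ge: "Q v \<le> t * g v + (1 - t) * h v"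
      using functional_minus[OF g] functional_minus[OF h] by simp
    have gv: "g v \<le> Q v" and hv: "h v \<le> Q v" using gh by (auto simp: le_fun_def)
    have "t * (Q v - g v) + (1 - t) * (Q v - h v) \<le> 0" using ge by (simp add: algebra_simps)
    moreover have "0 \<le> t * (Q v - g v)" "0 \<le> (1 - t) * (Q v - h v)" using t gv hv by auto
    ultimately have "t * (Q v - g v) = 0" "(1 - t) * (Q v - h v) = 0" by linarith+
    then have eq: "g v = Q v" "h v = Q v" using t by auto
    have key: "k \<le> peak sc Q v" if k: "functional sc k" "k \<le> Q" "k v = Q v" for k
    proof (rule le_funI, rule peak_greatest)
      fix w and s :: real
      have "k (w + sc s v) = k w + s * Q v" using k by (simp add: functional_def)
      then show "k w \<le> Q (w + sc s v) - s * Q v" using k(2) by (metis le_diff_eq le_funD)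
    qed
    show ?thesis using key g h gh eq by blast
  qed
  moreover have "peak sc Q v \<le> P" using peak_le_self[OF Q(1)] Q(2) by (rule order_trans)
  ultimately show ?thesis
    unfolding sublinear_face_def using sublinear_peak[OF Q(1)] by blast
qed

text \<open>Provides the bounds for Zorn's lemma. At v every member lies above - P (- v), so the
  pointwise infimum is finite; the chain condition makes it subadditive.\<close>

lemma sublinear_face_Inf:
  assumes ne: "\<C> \<noteq> {}" and face: "\<And>Q. Q \<in> \<C> \<Longrightarrow> sublinear_face sc P Q"
    and chain: "\<And>Q R. Q \<in> \<C> \<Longrightarrow> R \<in> \<C> \<Longrightarrow> Q \<le> R \<or> R \<le> Q"
  defines "I \<equiv> \<lambda>v. INF Q\<in>\<C>. Q v"
  shows "sublinear_face sc P I" and "\<And>Q. Q \<in> \<C> \<Longrightarrow> I \<le> Q"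
proof -
  have sub: "sublinear sc Q" "Q \<le> P" if "Q \<in> \<C>" for Q
    using face[OF that] by (auto simp: sublinear_face_def)
  have bdd: "bdd_below ((\<lambda>Q. Q v) ` \<C>)" for v
  proof (rule bdd_belowI2[where m = "- P (- v)"])
    fix Q assume "Q \<in> \<C>"
    then show "- P (- v) \<le> Q v"
      using sublinear_neg[OF sub(1), of Q v] sub(2)[of Q] by (smt (verit) le_funD)
  qed
  have lower: "I v \<le> Q v" if "Q \<in> \<C>" for Q v
    unfolding I_def using bdd that by (intro cINF_lower)
  show le: "I \<le> Q" if "Q \<in> \<C>" for Q using lower[OF that] by (rule le_funI)
  have greatest: "c \<le> I v" if "\<And>Q. Q \<in> \<C> \<Longrightarrow> c \<le> Q v" for c v
    unfolding I_def using ne that by (intro cINF_greatest)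
  have "I (u + v) \<le> I u + I v" for u v
  proof -
    \<comment> \<open>The smaller of Q and R serves both summands.\<close>
    have "I (u + v) \<le> Q u + R v" if QR: "Q \<in> \<C>" "R \<in> \<C>" for Q R
    proof -
      obtain T where T: "T \<in> \<C>" "T \<le> Q" "T \<le> R" using chain[OF QR] QR by blast
      have "I (u + v) \<le> T u + T v"
        using lower[OF T(1), of "u + v"] sub(1)[OF T(1)] unfolding sublinear_def
        by (meson order_trans)
      also have "\<dots> \<le> Q u + R v" using T by (intro add_mono) (auto simp: le_fun_def)
      finally show ?thesis .
    qed
    then have "I (u + v) - Q u \<le> I v" if "Q \<in> \<C>" for Q
      using that by (intro greatest) (metis add.commute diff_le_eq)
    then have "I (u + v) - I v \<le> I u" by (intro greatest) (smt (verit))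
    then show ?thesis by simp
  qed
  moreover have "I (sc c v) = c * I v" if c: "0 \<le> c" for c v
  proof -
    have *: "c * I v \<le> I (sc c v)" if "0 \<le> c" for c v
    proof (rule greatest)
      fix Q assume Q: "Q \<in> \<C>"
      have "c * I v \<le> c * Q v" using that lower[OF Q] by (rule mult_left_mono[rotated])
      also have "\<dots> = Q (sc c v)" using that sub(1)[OF Q] by (simp add: sublinear_def)
      finally show "c * I v \<le> Q (sc c v)" .
    qed
    show ?thesis
    proof (cases "c = 0")
      case True
      obtain Q where "Q \<in> \<C>" using ne by blast
      then have "I 0 \<le> 0" using lower[of Q 0] sublinear_zero[OF sub(1)[of Q]] by simp
      moreover have "0 \<le> I 0" by (intro greatest) (simp add: sublinear_zero[OF sub(1)])
      ultimately show ?thesis using True by simp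
    next
      case False
      then have "I (sc c v) \<le> c * I v"
        using *[of "1 / c" "sc c v"] c by (simp add: field_simps)
      then show ?thesis using *[OF c, of v] by simp
    qed
  qed
  moreover have "I \<le> P" using ne le sub(2) by (meson all_not_in_conv order_trans)
  moreover have "g \<le> I \<and> h \<le> I"
    if "functional sc g" "functional sc h" "g \<le> P" "h \<le> P" "0 < t" "t < 1"
      "\<forall>v. t * g v + (1 - t) * h v \<le> I v" for g h t
  proof -
    have "g \<le> Q \<and> h \<le> Q" if Q: "Q \<in> \<C>" for Q
    proof -
      have "\<forall>v. t * g v + (1 - t) * h v \<le> Q v" using \<open>\<forall>v. _ \<le> I v\<close> lower[OF Q]
          by (meson order_trans)
      then show ?thesis using face[OF Q] \<open>functional sc g\<close> \<open>functional sc h\<close> \<open>g \<le> P\<close> \<open>h \<le> P\<close>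
          \<open>0 < t\<close> \<open>t < 1\<close> unfolding sublinear_face_def by blast
    qed
    then show ?thesis by (auto simp: le_fun_def intro!: greatest)
  qed
  ultimately show "sublinear_face sc P I"
    unfolding sublinear_face_def sublinear_def by blast
qed

text \<open>The search for a minimal face starts below \<open>peak sc P x\<close>, so the extreme
  point that it finds still takes the value P x at x.\<close>

lemma extreme_dominated_functional:
  assumes P: "sublinear sc P"
  obtains f where "functional sc f" "f \<le> P" "f x = P x"
    "\<And>g h t. \<lbrakk>functional sc g; functional sc h; g \<le> P; h \<le> P; 0 < t; t < 1;
       \<And>v. f v = t * g v + (1 - t) * h v\<rbrakk> \<Longrightarrow> g = f"
proof -
  define \<F> where "\<F> = {Q. sublinear_face sc P Q \<and> Q \<le> peak sc P x}"
  \<comment> \<open>\<open>predicate_Zorn\<close> yields maximal elements, hence the reversed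
    order.\<close>
  let ?le = "\<lambda>Q R :: 'v \<Rightarrow> real. R \<le> Q"
  have "sublinear_face sc P P" using P by (auto simp: sublinear_face_def)
  then have top: "peak sc P x \<in> \<F>" using sublinear_face_peak by (auto simp: \<F>_def)
  have "\<exists>m\<in>\<F>. \<forall>a\<in>\<F>. ?le m a \<longrightarrow> a = m"
  proof (rule predicate_Zorn)
    show "partial_order_on \<F> (relation_of ?le \<F>)"
      by (rule partial_order_on_relation_ofI) auto
  next
    fix \<C> assume C: "\<C> \<in> Chains (relation_of ?le \<F>)"
    then have CF: "Q \<in> \<F>" if "Q \<in> \<C>" for Q
      using that by (auto simp: Chains_def relation_of_def)
    show "\<exists>u\<in>\<F>. \<forall>a\<in>\<C>. ?le a u"
    proof (cases "\<C> = {}")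
      case True then show ?thesis using top by blast
    next
      case False
      have face: "sublinear_face sc P Q" if "Q \<in> \<C>" for Q using CF[OF that] by (simp add: \<F>_def)
      have chain: "Q \<le> R \<or> R \<le> Q" if "Q \<in> \<C>" "R \<in> \<C>" for Q R
        using that C by (auto simp: Chains_def relation_of_def)
      let ?I = "\<lambda>v. INF Q\<in>\<C>. Q v"
      have I: "sublinear_face sc P ?I" "\<And>Q. Q \<in> \<C> \<Longrightarrow> ?I \<le> Q"
        using sublinear_face_Inf[OF False face chain] by blast+
      obtain Q where Q: "Q \<in> \<C>" using False by blast
      have "?I \<le> peak sc P x" using I(2)[OF Q] CF[OF Q] unfolding \<F>_def by (auto intro: order_trans)
      then show ?thesis using I by (auto simp: \<F>_def)
    qed
  qed
  then obtain f where f: "f \<in> \<F>" and min: "\<And>Q. Q \<in> \<F> \<Longrightarrow> Q \<le> f \<Longrightarrow> Q = f" by blast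
  have face: "sublinear_face sc P f" and fx: "f \<le> peak sc P x" using f by (auto simp: \<F>_def)
  have sub: "sublinear sc f" "f \<le> P" using face by (auto simp: sublinear_face_def)
  have neg: "f (- v) = - f v" for v
  proof -
    \<comment> \<open>Every peak of f is again in the family and lies below f, so minimality makes
      it equal to f; oddness of f follows.\<close>
    have "peak sc f v = f"
      using sublinear_face_peak[OF face, of v] peak_le_self[OF sub(1), of v] fx
      by (intro min) (auto simp: \<F>_def)
    then have "f (- v) \<le> - f v" using peak_neg[OF sub(1), of v] by simp
    then show ?thesis using sublinear_neg[OF sub(1), of v] by simp
  qed
  have lin: "functional sc f"
  proof -
    have le: "f (u + v) \<le> f u + f v" for u v using sub(1) by (simp add: sublinear_def)
    have "f (u + v) = f u + f v" for u v
      using le[of u v] le[of "- u" "- v"] neg[of "u + v"] neg[of u] neg[of v] by simp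
    moreover have "f (sc c v) = c * f v" for c v
    proof (cases "0 \<le> c")
      case True then show ?thesis using sub(1) by (simp add: sublinear_def)
    next
      case False
      then have "f (sc (- c) v) = - c * f v" using sub(1)
          by (simp add: sublinear_def del: scale_minus_left)
      then show ?thesis using neg[of "sc c v"] by simp
    qed
    ultimately show ?thesis by (simp add: functional_def)
  qed
  have "f (- x) \<le> - P x" using fx peak_neg[OF P, of x] by (meson le_funD order_trans)
  then have "f x = P x" using neg[of x] sub(2) by (metis le_funD neg_le_iff_le order_antisym)
  moreover have "g = f"
    if "functional sc g" "functional sc h" "g \<le> P" "h \<le> P" "0 < t" "t < 1"
      "\<And>v. f v = t * g v + (1 - t) * h v" for g h t
  proof -
    \<comment> \<open>The face property gives g \<le> f, and for linear functionals this inequality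
      at v and at -v is equality.\<close>
    have "\<forall>v. t * g v + (1 - t) * h v \<le> f v" using that(7) by simp
    then have "g \<le> f" using face that unfolding sublinear_face_def by blast
    then have "g v = f v" for v
      using neg[of v] functional_minus[OF that(1), of v]
          by (metis le_funD neg_le_iff_le order_antisym)
    then show ?thesis by blast
  qed
  ultimately show thesis using that lin sub(2) by blast
qed

text \<open>The gauge P v, the infimum of all t with t e - v in C, is sublinear, and the linear
  functionals below it are exactly the positive ones with value 1 at e. So an extreme point of these
  is a pure state, and the bound on x carries over because f x = P x.\<close>

lemma pure_state_exists:
  assumes add: "\<And>u v. u \<in> C \<Longrightarrow> v \<in> C \<Longrightarrow> u + v \<in> C"
    and scl: "\<And>c v. 0 \<le> c \<Longrightarrow> v \<in> C \<Longrightarrow> sc c v \<in> C"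
    and unit: "\<And>v. \<exists>t. sc t e - v \<in> C"
    and e: "e \<in> C"
    and nonneg: "\<And>t. sc t e \<in> C \<Longrightarrow> 0 \<le> t"
    and x: "\<And>t. sc t e - x \<in> C \<Longrightarrow> \<tau> \<le> t"
  obtains f where "functional sc f" "\<And>v. v \<in> C \<Longrightarrow> 0 \<le> f v" "f e = 1" "\<tau> \<le> f x"
    "\<And>g v. \<lbrakk>functional sc g; \<And>v. v \<in> C \<Longrightarrow> 0 \<le> g v; \<And>v. v \<in> C \<Longrightarrow> g v \<le> f v\<rbrakk>
       \<Longrightarrow> g v = g e * f v"
proof -
  define T where "T v = {t. sc t e - v \<in> C}" for v
  define P where "P v = Inf (T v)" for v
  have ne: "T v \<noteq> {}" for v using unit by (auto simp: T_def)
  have Tadd: "s + t \<in> T (u + v)" if "s \<in> T u" "t \<in> T v" for s t u v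
  proof -
    have eq: "sc (s + t) e - (u + v) = (sc s e - u) + (sc t e - v)"
      by (simp add: scale_left_distrib algebra_simps)
    then show ?thesis using add[of "sc s e - u" "sc t e - v"] that
        unfolding T_def mem_Collect_eq eq by simp
  qed
  have Tpos: "0 \<le> t" if "t \<in> T 0" for t using that nonneg by (simp add: T_def)
  have bdd: "bdd_below (T v)" for v
  proof -
    obtain s where "s \<in> T (- v)" using ne by blast
    then have "- s \<le> t" if "t \<in> T v" for t using Tpos[of "t + s"] Tadd[OF that, of s "- v"] by simp
    then show ?thesis by (meson bdd_belowI)
  qed
  have lower: "P v \<le> t" if "t \<in> T v" for t v unfolding P_def using that bdd by (rule cInf_lower)
  have greatest: "c \<le> P v" if "\<And>t. t \<in> T v \<Longrightarrow> c \<le> t" for c v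
    unfolding P_def using ne that by (rule cInf_greatest)
  have "P (u + v) \<le> P u + P v" for u v
  proof -
    have "P (u + v) - s \<le> P v" if "s \<in> T u" for s
      using lower[OF Tadd[OF that]] by (intro greatest) (smt (verit))
    then have "P (u + v) - P v \<le> P u" by (intro greatest) (smt (verit))
    then show ?thesis by simp
  qed
  moreover have "P (sc c v) = c * P v" if c: "0 \<le> c" for c v
  proof (cases "c = 0")
    case True
    have "0 \<in> C" using unit[of e] scl[of 0] by force
    then have "P 0 \<le> 0" by (intro lower) (simp add: T_def)
    moreover have "0 \<le> P 0" using Tpos by (intro greatest)
    ultimately show ?thesis using True by simp
  next
    case False
    have *: "c * t \<in> T (sc c v)" if "0 \<le> c" "t \<in> T v" for c t v
    proof -
      have "sc (c * t) e - sc c v = sc c (sc t e - v)" by (simp add: scale_right_diff_distrib)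
      then show ?thesis using scl that by (simp add: T_def)
    qed
    have le: "P (sc c v) \<le> c * P v" if "0 < c" for c v
    proof -
      have "P (sc c v) / c \<le> P v"
        using that lower[OF *[of c]] by (intro greatest) (simp add: pos_divide_le_eq mult.commute)
      then show ?thesis using that by (simp add: field_simps)
    qed
    have "c * P v \<le> P (sc c v)"
      using le[of "1 / c" "sc c v"] c False by (simp add: field_simps)
    then show ?thesis using le[of c v] c False by simp
  qed
  ultimately have "sublinear sc P" by (simp add: sublinear_def)
  then obtain f where f: "functional sc f" "f \<le> P" "f x = P x"
    and ext: "\<And>g h t. \<lbrakk>functional sc g; functional sc h; g \<le> P; h \<le> P; 0 < t; t < 1;
       \<And>v. f v = t * g v + (1 - t) * h v\<rbrakk> \<Longrightarrow> g = f"
    using extreme_dominated_functional[of P x] by blast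
  have pos: "0 \<le> f v" if "v \<in> C" for v
  proof -
    have "P (- v) \<le> 0" using that by (intro lower) (simp add: T_def)
    then have "f (- v) \<le> 0" using f(2) by (meson le_funD order_trans)
    then show ?thesis using functional_minus[OF f(1)] by simp
  qed
  have "0 \<in> C" using unit[of e] scl[of 0] by force
  then have "P e \<le> 1" "P (- e) \<le> - 1" by (auto intro!: lower simp: T_def)
  then have fe: "f e = 1"
    using f(2) functional_minus[OF f(1), of e] by (smt (verit) le_funD)
  have dom: "g \<le> P" if g: "functional sc g" "\<And>v. v \<in> C \<Longrightarrow> 0 \<le> g v" "g e = 1" for g
  proof (rule le_funI, rule greatest)
    fix v t assume "t \<in> T v"
    then have "0 \<le> g (sc t e - v)" using g by (simp add: T_def)
    then show "g v \<le> t" using functional_diff[OF g(1)] g by (simp add: functional_def)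
  qed
  \<comment> \<open>Multiples of e dominate both v and -v, so a positive functional that vanishes at
    e vanishes everywhere. This settles the cases in which g cannot be normalized or f - g
    cannot.\<close>
  have zero: "g v = 0" if g: "functional sc g" "\<And>v. v \<in> C \<Longrightarrow> 0 \<le> g v" "g e = 0" for g v
  proof -
    have le: "g v \<le> 0" for v
    proof -
      obtain t where "sc t e - v \<in> C" using unit by blast
      then have "0 \<le> g (sc t e - v)" using g by blast
      then show ?thesis using functional_diff[OF g(1)] g by (simp add: functional_def)
    qed
    show ?thesis using le[of v] le[of "- v"] functional_minus[OF g(1), of v] by simp
  qed
  have "g v = g e * f v" if g: "functional sc g" "\<And>v. v \<in> C \<Longrightarrow> 0 \<le> g v"
      "\<And>v. v \<in> C \<Longrightarrow> g v \<le> f v" for g v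
  proof -
    let ?h = "\<lambda>v. f v - g v"
    have h: "functional sc ?h" using f(1) g(1) by (auto simp: functional_def algebra_simps)
    have e: "0 \<le> g e" "g e \<le> 1" using g(2)[OF e] g(3)[OF e] fe by auto
    show ?thesis
    proof (cases "g e = 0 \<or> g e = 1")
      case True
      then show ?thesis using zero[OF g(1,2)] zero[OF h] g(3) fe by force
    next
      case False
      then have t: "0 < g e" "g e < 1" using e by auto
      \<comment> \<open>f is the convex combination of the normalized g and the normalized f - g
        with weights g e and 1 - g e.\<close>
      have "(\<lambda>v. g v / g e) = f"
      proof (rule ext)
        show lin: "functional sc (\<lambda>v. g v / g e)" "functional sc (\<lambda>v. ?h v / (1 - g e))"
          by (rule functional_divide[OF g(1)], rule functional_divide[OF h])
        show "(\<lambda>v. g v / g e) \<le> P"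
          using t g(2) by (intro dom lin) auto
        show "(\<lambda>v. ?h v / (1 - g e)) \<le> P"
          using t fe by (intro dom lin divide_nonneg_nonneg) (auto simp: g(3))
        show "f v = g e * (g v / g e) + (1 - g e) * (?h v / (1 - g e))" for v
          using t by simp
      qed (use t in auto)
      then show ?thesis using t by (metis nonzero_mult_div_cancel_left order_less_irrefl
          times_divide_eq_right)
    qed
  qed
  moreover have "\<tau> \<le> f x" unfolding f(3) using x by (intro greatest) (simp add: T_def)
  ultimately show thesis using that f(1) pos fe by blast
qed

end

section \<open>Sums, adjoints and operator norms\<close>

lemma sum_lessThan_add:
  fixes f :: "nat \<Rightarrow> 'b::comm_monoid_add"
  shows "(\<Sum>i<a + b. f i) = (\<Sum>i<a. f i) + (\<Sum>i<b. f (a + i))"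
  by (induction b) (simp_all add: add.assoc)

lemma sum_lessThan_times:
  fixes f :: "nat \<Rightarrow> 'b::comm_monoid_add"
  shows "(\<Sum>i<a * b. f i) = (\<Sum>i<a. \<Sum>j<b. f (i * b + j))"
proof (induction a)
  case (Suc a)
  have "(\<Sum>i<Suc a * b. f i) = (\<Sum>i<a * b + b. f i)" by (simp add: add.commute)
  then show ?case using Suc by (simp only: sum_lessThan_add sum.lessThan_Suc)
qed simp

lemma sum_swap4:
  fixes h :: "nat \<Rightarrow> nat \<Rightarrow> nat \<Rightarrow> nat \<Rightarrow> 'b::comm_monoid_add"
  shows "(\<Sum>i<n. \<Sum>j<m. \<Sum>p<k. \<Sum>q<l. h i j p q) = (\<Sum>p<k. \<Sum>q<l. \<Sum>i<n. \<Sum>j<m. h i j p q)"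
proof -
  have "(\<Sum>i<n. \<Sum>j<m. \<Sum>p<k. \<Sum>q<l. h i j p q) = (\<Sum>i<n. \<Sum>p<k. \<Sum>j<m. \<Sum>q<l. h i j p q)"
    by (intro sum.cong refl sum.swap)
  also have "\<dots> = (\<Sum>p<k. \<Sum>i<n. \<Sum>j<m. \<Sum>q<l. h i j p q)" by (rule sum.swap)
  also have "\<dots> = (\<Sum>p<k. \<Sum>i<n. \<Sum>q<l. \<Sum>j<m. h i j p q)"
    by (intro sum.cong refl sum.swap)
  also have "\<dots> = (\<Sum>p<k. \<Sum>q<l. \<Sum>i<n. \<Sum>j<m. h i j p q)"
    by (intro sum.cong refl sum.swap)
  finally show ?thesis .
qed

lemma mat_adjoint_dim [simp]:
  "dim_row (mat_adjoint A) = dim_col A" "dim_col (mat_adjoint A) = dim_row A"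
  unfolding mat_adjoint_def by auto

lemma mat_adjoint_carrier: "A \<in> carrier_mat r c \<Longrightarrow> mat_adjoint A \<in> carrier_mat c r"
  by auto

lemma mat_adjoint_index [simp]:
  fixes A :: "complex mat"
  assumes "i < dim_col A" "j < dim_row A"
  shows "mat_adjoint A $$ (i, j) = cnj (A $$ (j, i))"
  using assms unfolding mat_adjoint_def by (simp add: mat_of_rows_def)

lemma mat_mult_index_sum:
  assumes "A \<in> carrier_mat a b" "B \<in> carrier_mat b c" "i < a" "j < c"
  shows "(A * B) $$ (i, j) = (\<Sum>k<b. A $$ (i, k) * B $$ (k, j))"
  using assms by (auto simp: scalar_prod_def lessThan_atLeast0 intro!: sum.cong)

lemma mat_adjoint_mult:
  fixes A :: "complex mat"
  assumes A: "A \<in> carrier_mat a b" and B: "B \<in> carrier_mat b c"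
  shows "mat_adjoint (A * B) = mat_adjoint B * mat_adjoint A"
proof (rule eq_matI)
  fix i j
  assume "i < dim_row (mat_adjoint B * mat_adjoint A)" "j < dim_col (mat_adjoint B * mat_adjoint A)"
  then have ij: "i < c" "j < a" using A B by auto
  have "mat_adjoint (A * B) $$ (i, j) = cnj (\<Sum>k<b. A $$ (j, k) * B $$ (k, i))"
    using ij A B by (simp add: mat_mult_index_sum[OF A B ij(2,1)] del: index_mult_mat(1))
  also have "\<dots> = (\<Sum>k<b. mat_adjoint B $$ (i, k) * mat_adjoint A $$ (k, j))"
    using ij A B by (simp add: mult.commute)
  also have "\<dots> = (mat_adjoint B * mat_adjoint A) $$ (i, j)"
    by (rule mat_mult_index_sum[OF mat_adjoint_carrier[OF B] mat_adjoint_carrier[OF A] ij,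
        symmetric])
  finally show "mat_adjoint (A * B) $$ (i, j) = (mat_adjoint B * mat_adjoint A) $$ (i, j)" .
qed auto

lemma mat_adjoint_adjoint [simp]: "mat_adjoint (mat_adjoint A) = (A :: complex mat)"
  by (intro eq_matI) auto

section \<open>Euclidean norms, and the operator norm expressed by pairings\<close>

definition sqnorm :: "nat \<Rightarrow> (nat \<Rightarrow> complex) \<Rightarrow> real" where
  "sqnorm N v = (\<Sum>i<N. (cmod (v i))\<^sup>2)"

lemma sqnorm_nonneg [simp]: "0 \<le> sqnorm N v"
  by (auto simp: sqnorm_def sum_nonneg)

lemma l2norm_eq: "l2norm v = sqrt (sqnorm (dim_vec v) (\<lambda>i. v $ i))"
  by (simp add: l2norm_def L2_set_def sqnorm_def)

lemma sqnorm_eq_0D: "sqnorm N v = 0 \<Longrightarrow> i < N \<Longrightarrow> v i = 0"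
  unfolding sqnorm_def by (subst (asm) sum_nonneg_eq_0_iff) auto

lemma sqnorm_scale: "sqnorm N (\<lambda>i. c * v i) = (cmod c)\<^sup>2 * sqnorm N v"
  by (simp add: sqnorm_def norm_mult power_mult_distrib sum_distrib_left)

lemma sum_cnj_mult_self: "(\<Sum>i<N. cnj (v i) * v i) = of_real (sqnorm N v)"
  by (simp add: sqnorm_def complex_norm_square mult.commute flip: of_real_power)

lemma cmod_sum_mult_le:
  "cmod (\<Sum>i<N. cnj (u i) * v i) \<le> sqrt (sqnorm N u) * sqrt (sqnorm N v)"
proof -
  have "cmod (\<Sum>i<N. cnj (u i) * v i) \<le> (\<Sum>i<N. \<bar>cmod (u i)\<bar> * \<bar>cmod (v i)\<bar>)"
    by (rule order_trans[OF norm_sum]) (simp add: norm_mult)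
  also have "\<dots> \<le> L2_set (\<lambda>i. cmod (u i)) {..<N} * L2_set (\<lambda>i. cmod (v i)) {..<N}"
    by (rule L2_set_mult_ineq)
  finally show ?thesis by (simp add: L2_set_def sqnorm_def)
qed

lemma two_sqrt_mult_le:
  assumes "0 \<le> a" "0 \<le> b" shows "2 * (sqrt a * sqrt b) \<le> a + b"
proof -
  have "0 \<le> (sqrt a - sqrt b)\<^sup>2" by simp
  then show ?thesis using assms by (simp add: power2_diff)
qed

lemma mult_mat_vec_index:
  "M \<in> carrier_mat N N' \<Longrightarrow> v \<in> carrier_vec N' \<Longrightarrow> i < N \<Longrightarrow>
    (M *\<^sub>v v) $ i = (\<Sum>j<N'. M $$ (i, j) * v $ j)"
  by (auto simp: scalar_prod_def lessThan_atLeast0 intro!: sum.cong)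

text \<open>A real supremum bounds its members only if the set is bounded above; the sum of the
  moduli of all entries is a crude bound on the unit ball.\<close>

lemma op_norm_upper:
  assumes M: "M \<in> carrier_mat N N'" and v: "v \<in> carrier_vec N'" "l2norm v \<le> 1"
  shows "l2norm (M *\<^sub>v v) \<le> op_norm M"
proof -
  have "bdd_above ((\<lambda>v. l2norm (M *\<^sub>v v)) ` {v \<in> carrier_vec (dim_col M). l2norm v \<le> 1})"
  proof (rule bdd_aboveI2[where M = "\<Sum>i<N. \<Sum>j<N'. cmod (M $$ (i, j))"])
    fix v :: "complex vec" assume "v \<in> {v \<in> carrier_vec (dim_col M). l2norm v \<le> 1}"
    then have v: "v \<in> carrier_vec N'" "l2norm v \<le> 1" using M by auto
    have "cmod (v $ j) \<le> 1" if "j < N'" for j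
    proof -
      have "cmod (v $ j) \<le> l2norm v"
        unfolding l2norm_def using that v by (intro member_le_L2_set) auto
      then show ?thesis using v by simp
    qed
    then have *: "cmod (M $$ (i, j) * v $ j) \<le> cmod (M $$ (i, j))" if "j < N'" for i j
      using that by (simp add: norm_mult mult_left_le)
    have "l2norm (M *\<^sub>v v) \<le> (\<Sum>i<N. cmod ((M *\<^sub>v v) $ i))"
      unfolding l2norm_def using M by (intro order_trans[OF L2_set_le_sum]) auto
    also have "\<dots> \<le> (\<Sum>i<N. \<Sum>j<N'. cmod (M $$ (i, j)))"
    proof (rule sum_mono)
      fix i assume "i \<in> {..<N}"
      then have "(M *\<^sub>v v) $ i = (\<Sum>j<N'. M $$ (i, j) * v $ j)"
        using mult_mat_vec_index[OF M v(1)] by simp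
      then show "cmod ((M *\<^sub>v v) $ i) \<le> (\<Sum>j<N'. cmod (M $$ (i, j)))"
        using * by (auto intro!: order_trans[OF norm_sum] sum_mono)
    qed
    finally show "l2norm (M *\<^sub>v v) \<le> (\<Sum>i<N. \<Sum>j<N'. cmod (M $$ (i, j)))" .
  qed
  then show ?thesis unfolding op_norm_def using v M by (intro cSUP_upper) auto
qed

lemma op_norm_nonneg: "0 \<le> op_norm M"
proof -
  have "l2norm (M *\<^sub>v 0\<^sub>v (dim_col M)) \<le> op_norm M"
    by (rule op_norm_upper[of M "dim_row M" "dim_col M"]) (auto simp: l2norm_eq sqnorm_def)
  moreover have "0 \<le> l2norm (M *\<^sub>v 0\<^sub>v (dim_col M))" by (simp add: l2norm_eq)
  ultimately show ?thesis by linarith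
qed

lemma op_norm_pairing:
  assumes M: "M \<in> carrier_mat N N'"
  shows "cmod (\<Sum>p<N. \<Sum>q<N'. cnj (\<xi> p) * M $$ (p, q) * \<eta> q)
    \<le> op_norm M * (sqrt (sqnorm N \<xi>) * sqrt (sqnorm N' \<eta>))"
proof (cases "sqnorm N' \<eta> = 0")
  case True
  then have "\<eta> q = 0" if "q < N'" for q using sqnorm_eq_0D that by blast
  then show ?thesis using True by simp
next
  case False
  define t where "t = sqrt (sqnorm N' \<eta>)"
  have t: "0 < t" using False sqnorm_nonneg[of N' \<eta>] by (simp add: t_def less_le)
  define v where "v = vec N' (\<lambda>q. \<eta> q / of_real t)"
  have v: "v \<in> carrier_vec N'" by (simp add: v_def)
  have "sqnorm N' (\<lambda>q. v $ q) = sqnorm N' (\<lambda>q. (1 / of_real t) * \<eta> q)"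
    by (simp add: sqnorm_def v_def)
  also have "\<dots> = 1"
    unfolding sqnorm_scale using t False by (simp add: norm_divide power_divide t_def)
  finally have "l2norm v \<le> 1" using v by (simp add: l2norm_eq)
  then have le: "sqrt (sqnorm N (\<lambda>i. (M *\<^sub>v v) $ i)) \<le> op_norm M"
    using op_norm_upper[OF M v] M by (simp add: l2norm_eq)
  have idx: "(M *\<^sub>v v) $ p * of_real t = (\<Sum>q<N'. M $$ (p, q) * \<eta> q)" if "p < N" for p
    using that t by (subst mult_mat_vec_index[OF M v that]) (simp add: v_def sum_distrib_right)
  have "(\<Sum>p<N. \<Sum>q<N'. cnj (\<xi> p) * M $$ (p, q) * \<eta> q)
      = (\<Sum>p<N. cnj (\<xi> p) * ((M *\<^sub>v v) $ p * of_real t))"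
    by (intro sum.cong refl) (simp add: idx sum_distrib_left mult.assoc)
  also have "\<dots> = (\<Sum>p<N. cnj (\<xi> p) * (M *\<^sub>v v) $ p) * of_real t"
    by (simp add: sum_distrib_right mult.assoc)
  also have "cmod \<dots> \<le> (sqrt (sqnorm N \<xi>) * sqrt (sqnorm N (\<lambda>i. (M *\<^sub>v v) $ i))) * t"
    unfolding norm_mult using t cmod_sum_mult_le by (intro mult_mono) auto
  also have "\<dots> \<le> (sqrt (sqnorm N \<xi>) * op_norm M) * t"
    using t le by (intro mult_right_mono mult_left_mono) auto
  finally show ?thesis by (simp add: t_def mult_ac)
qed

text \<open>A converse to \<open>op_norm_pairing\<close>. The hypothesis has a sum of squares in
  place of a product of norms because positivity on the cone supplies it in this shape; on unit
  vectors the two agree.\<close>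

lemma op_norm_leI:
  assumes M: "M \<in> carrier_mat N N'" and c: "0 \<le> c"
    and le: "\<And>\<xi> \<eta>. 2 * Re (\<Sum>p<N. \<Sum>q<N'. cnj (\<xi> p) * M $$ (p, q) * \<eta> q)
      \<le> c * (sqnorm N \<xi> + sqnorm N' \<eta>)"
  shows "op_norm M \<le> c"
  unfolding op_norm_def
proof (rule cSUP_least)
  show "{v \<in> carrier_vec (dim_col M). l2norm v \<le> 1} \<noteq> {}"
    by (auto intro!: exI[of _ "0\<^sub>v (dim_col M)"] simp: l2norm_eq sqnorm_def)
next
  fix v assume "v \<in> {v \<in> carrier_vec (dim_col M). l2norm v \<le> 1}"
  then have v: "v \<in> carrier_vec N'" "l2norm v \<le> 1" using M by auto
  define w where "w = M *\<^sub>v v"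
  define t where "t = l2norm w"
  have t2: "sqnorm N (\<lambda>p. w $ p) = t\<^sup>2" using M by (simp add: t_def l2norm_eq w_def)
  show "l2norm (M *\<^sub>v v) \<le> c"
  proof (cases "t = 0")
    case True then show ?thesis using c by (simp add: t_def w_def)
  next
    case False
    then have t: "0 < t" by (simp add: t_def l2norm_eq less_le)
    \<comment> \<open>The unit vector in the direction of M v, for which the pairing is the norm of
      M v.\<close>
    let ?\<xi> = "\<lambda>p. (1 / of_real t) * w $ p"
    have "(\<Sum>p<N. \<Sum>q<N'. cnj (?\<xi> p) * M $$ (p, q) * v $ q) = (\<Sum>p<N. cnj (?\<xi> p) * w $ p)"
      by (intro sum.cong refl)
        (simp add: w_def mult_mat_vec_index[OF M v(1)] sum_distrib_left mult.assoc
          del: index_mult_mat_vec)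
    also have "\<dots> = (1 / of_real t) * (\<Sum>p<N. cnj (w $ p) * w $ p)"
      by (simp add: sum_distrib_left mult_ac)
    also have "\<dots> = of_real t"
      using t by (simp add: sum_cnj_mult_self t2 power2_eq_square)
    finally have "2 * t \<le> c * (sqnorm N ?\<xi> + sqnorm N' (\<lambda>q. v $ q))"
      using le[of ?\<xi> "\<lambda>q. v $ q"] by simp
    also have "sqnorm N ?\<xi> = 1" unfolding sqnorm_scale t2 using t
        by (simp add: norm_divide power_divide)
    also have "sqnorm N' (\<lambda>q. v $ q) \<le> 1" using v by (simp add: l2norm_eq)
    finally have "2 * t \<le> c * (1 + 1)" using c by (simp add: mult_left_mono)
    then show ?thesis by (simp add: t_def w_def)
  qed
qed

text \<open>The bound t is on squared norms, hence sqrt t. One pairing estimate gives both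
  conclusions, that for the adjoint by conjugating and exchanging \<xi> and \<eta>.\<close>

lemma op_norm_le_of_contraction:
  assumes t: "0 \<le> t"
    and le: "\<And>v. sqnorm k (\<lambda>p. \<Sum>j<n. \<alpha> p j * v j) \<le> t * sqnorm n v"
  shows "op_norm (mat k n (\<lambda>(p, j). \<alpha> p j)) \<le> sqrt t"
    and "op_norm (mat n k (\<lambda>(j, p). cnj (\<alpha> p j))) \<le> sqrt t"
proof -
  have *: "2 * cmod (\<Sum>p<k. \<Sum>j<n. cnj (\<xi> p) * \<alpha> p j * \<eta> j) \<le> sqrt t * (sqnorm k \<xi> + sqnorm n \<eta>)"
    for \<xi> \<eta>
  proof -
    have "(\<Sum>p<k. \<Sum>j<n. cnj (\<xi> p) * \<alpha> p j * \<eta> j) = (\<Sum>p<k. cnj (\<xi> p) * (\<Sum>j<n. \<alpha> p j * \<eta> j))"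
      by (simp add: sum_distrib_left mult.assoc)
    also have "cmod \<dots> \<le> sqrt (sqnorm k \<xi>) * sqrt (sqnorm k (\<lambda>p. \<Sum>j<n. \<alpha> p j * \<eta> j))"
      by (rule cmod_sum_mult_le)
    also have "\<dots> \<le> sqrt (sqnorm k \<xi>) * sqrt (t * sqnorm n \<eta>)"
      using le by (intro mult_left_mono real_sqrt_le_mono) auto
    finally have "2 * cmod (\<Sum>p<k. \<Sum>j<n. cnj (\<xi> p) * \<alpha> p j * \<eta> j)
        \<le> sqrt t * (2 * (sqrt (sqnorm k \<xi>) * sqrt (sqnorm n \<eta>)))"
      by (simp add: real_sqrt_mult mult_ac)
    also have "\<dots> \<le> sqrt t * (sqnorm k \<xi> + sqnorm n \<eta>)"
      using t by (intro mult_left_mono two_sqrt_mult_le) auto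
    finally show ?thesis .
  qed
  show "op_norm (mat k n (\<lambda>(p, j). \<alpha> p j)) \<le> sqrt t"
  proof (rule op_norm_leI[of _ k n])
    fix \<xi> \<eta> :: "nat \<Rightarrow> complex"
    have "(\<Sum>p<k. \<Sum>q<n. cnj (\<xi> p) * mat k n (\<lambda>(p, j). \<alpha> p j) $$ (p, q) * \<eta> q)
        = (\<Sum>p<k. \<Sum>j<n. cnj (\<xi> p) * \<alpha> p j * \<eta> j)" by simp
    then show "2 * Re (\<Sum>p<k. \<Sum>q<n. cnj (\<xi> p) * mat k n (\<lambda>(p, j). \<alpha> p j) $$ (p, q) * \<eta> q)
        \<le> sqrt t * (sqnorm k \<xi> + sqnorm n \<eta>)"
      using *[of \<xi> \<eta>] complex_Re_le_cmod by (smt (verit))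
  qed (use t in auto)
  show "op_norm (mat n k (\<lambda>(j, p). cnj (\<alpha> p j))) \<le> sqrt t"
  proof (rule op_norm_leI[of _ n k])
    fix \<xi> \<eta> :: "nat \<Rightarrow> complex"
    have "(\<Sum>p<n. \<Sum>q<k. cnj (\<xi> p) * mat n k (\<lambda>(j, p). cnj (\<alpha> p j)) $$ (p, q) * \<eta> q)
        = (\<Sum>j<n. \<Sum>p<k. cnj (\<xi> j) * cnj (\<alpha> p j) * \<eta> p)" by simp
    also have "\<dots> = (\<Sum>p<k. \<Sum>j<n. cnj (\<xi> j) * cnj (\<alpha> p j) * \<eta> p)" by (rule sum.swap)
    also have "\<dots> = cnj (\<Sum>p<k. \<Sum>j<n. cnj (\<eta> p) * \<alpha> p j * \<xi> j)" by (simp add: mult_ac)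
    finally show "2 * Re (\<Sum>p<n. \<Sum>q<k. cnj (\<xi> p) * mat n k (\<lambda>(j, p). cnj (\<alpha> p j)) $$ (p, q) * \<eta> q)
        \<le> sqrt t * (sqnorm n \<xi> + sqnorm k \<eta>)"
      using *[of \<eta> \<xi>] complex_Re_le_cmod by (smt (verit) complex_mod_cnj)
  qed (use t in auto)
qed

section \<open>The cone of a Paulsen system\<close>

text \<open>The (i, j) entry of the product \<alpha>^* y \<beta>, for coefficient families without
  fixed size.\<close>

definition compress ::
  "(complex \<Rightarrow> 'a::ab_group_add \<Rightarrow> 'a) \<Rightarrow> nat \<Rightarrow> nat \<Rightarrow> (nat \<Rightarrow> nat \<Rightarrow> complex) \<Rightarrow> 'a mat \<Rightarrow>
   (nat \<Rightarrow> nat \<Rightarrow> complex) \<Rightarrow> nat \<Rightarrow> nat \<Rightarrow> 'a" where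
  "compress scale k l \<alpha> y \<beta> i j = (\<Sum>p<k. \<Sum>q<l. scale (cnj (\<alpha> p i) * \<beta> q j) (y $$ (p, q)))"

definition quad_form :: "nat \<Rightarrow> (nat \<Rightarrow> nat \<Rightarrow> complex) \<Rightarrow> (nat \<Rightarrow> complex) \<Rightarrow> complex" where
  "quad_form n a v = (\<Sum>i<n. \<Sum>j<n. cnj (v i) * a i j * v j)"

definition apply_coeffs :: "nat \<Rightarrow> (nat \<Rightarrow> nat \<Rightarrow> complex) \<Rightarrow> (nat \<Rightarrow> complex) \<Rightarrow> nat \<Rightarrow> complex" where
  "apply_coeffs n \<alpha> v p = (\<Sum>j<n. \<alpha> p j * v j)"

text \<open>The inequality a \<ge> \<alpha>^* \<alpha> tested on vectors; through the real part only
  the Hermitian part of \<open>a\<close> counts.\<close>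

definition dominates_gram ::
  "nat \<Rightarrow> (nat \<Rightarrow> nat \<Rightarrow> complex) \<Rightarrow> nat \<Rightarrow> (nat \<Rightarrow> nat \<Rightarrow> complex) \<Rightarrow> bool" where
  "dominates_gram n a k \<alpha> \<longleftrightarrow> (\<forall>v. sqnorm k (apply_coeffs n \<alpha> v) \<le> Re (quad_form n a v))"

text \<open>The triple \<open>(a, z, b)\<close> stands for the block matrix with diagonal \<open>a\<close>, \<open>b\<close> and corner \<open>z\<close>.
  Entries outside the sizes \<open>n\<close>, \<open>m\<close> and the skew-Hermitian parts of \<open>a\<close> and \<open>b\<close> are irrelevant to
      the
  cone below, so that \<open>corner_unit\<close> is an order unit for the whole type.\<close>

type_synonym 'a corner = "(nat \<Rightarrow> nat \<Rightarrow> complex) \<times> (nat \<Rightarrow> nat \<Rightarrow> 'a) \<times> (nat \<Rightarrow> nat \<Rightarrow> complex)"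

definition corner_scale ::
  "(complex \<Rightarrow> 'a::ab_group_add \<Rightarrow> 'a) \<Rightarrow> real \<Rightarrow> 'a corner \<Rightarrow> 'a corner" where
  "corner_scale scale c = (\<lambda>(a, z, b). (\<lambda>i j. of_real c * a i j,
     \<lambda>i j. scale (of_real c) (z i j), \<lambda>i j. of_real c * b i j))"

text \<open>The size of the middle factor y is left free so that the direct sum of two such factors
  is again allowed.\<close>

definition corner_cone ::
  "(complex \<Rightarrow> 'a::ab_group_add \<Rightarrow> 'a) \<Rightarrow> ('a mat \<Rightarrow> real) \<Rightarrow> nat \<Rightarrow> nat \<Rightarrow> 'a corner set" where
  "corner_cone scale nrm n m = {(a, z, b). \<exists>k l \<alpha> \<beta> y. 1 \<le> k \<and> 1 \<le> l \<and> y \<in> carrier_mat k l \<and> nrm y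
      \<le> 1 \<and>
     dominates_gram n a k \<alpha> \<and> dominates_gram m b l \<beta> \<and>
     (\<forall>i<n. \<forall>j<m. z i j = compress scale k l \<alpha> y \<beta> i j)}"

definition id_coeffs :: "nat \<Rightarrow> nat \<Rightarrow> complex" where
  "id_coeffs i j = (if i = j then 1 else 0)"

definition corner_unit :: "'a::ab_group_add corner" where
  "corner_unit = (id_coeffs, 0, id_coeffs)"

lemma corner_coneI:
  assumes "1 \<le> k" "1 \<le> l" "y \<in> carrier_mat k l" "nrm y \<le> 1"
    "dominates_gram n a k \<alpha>" "dominates_gram m b l \<beta>"
    "\<And>i j. i < n \<Longrightarrow> j < m \<Longrightarrow> z i j = compress scale k l \<alpha> y \<beta> i j"
  shows "(a, z, b) \<in> corner_cone scale nrm n m"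
  unfolding corner_cone_def using assms by blast

lemma corner_coneE:
  assumes "(a, z, b) \<in> corner_cone scale nrm n m"
  obtains k l \<alpha> \<beta> y where "1 \<le> k" "1 \<le> l" "y \<in> carrier_mat k l" "nrm y \<le> 1"
    "dominates_gram n a k \<alpha>" "dominates_gram m b l \<beta>"
    "\<And>i j. i < n \<Longrightarrow> j < m \<Longrightarrow> z i j = compress scale k l \<alpha> y \<beta> i j"
  using assms unfolding corner_cone_def by blast

lemma quad_form_add: "quad_form n (a + a') v = quad_form n a v + quad_form n a' v"
  by (simp add: quad_form_def algebra_simps sum.distrib)

lemma quad_form_scale: "quad_form n (\<lambda>i j. c * a i j) v = c * quad_form n a v"
  by (simp add: quad_form_def sum_distrib_left mult_ac)

lemma quad_form_diff: "quad_form n (a - a') v = quad_form n a v - quad_form n a' v"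
  by (simp add: quad_form_def algebra_simps sum_subtractf)

lemma quad_form_id: "quad_form n id_coeffs v = of_real (sqnorm n v)"
proof -
  have "quad_form n id_coeffs v = (\<Sum>i<n. \<Sum>j<n. if i = j then cnj (v i) * v j else 0)"
    unfolding quad_form_def by (intro sum.cong refl) (auto simp: id_coeffs_def)
  then show ?thesis by (simp add: sum_cnj_mult_self)
qed

lemma apply_coeffs_id: "p < n \<Longrightarrow> apply_coeffs n (\<lambda>p j. c * id_coeffs p j) v p = c * v p"
proof -
  assume p: "p < n"
  have "apply_coeffs n (\<lambda>p j. c * id_coeffs p j) v p = (\<Sum>j<n. if p = j then c * v j else 0)"
    unfolding apply_coeffs_def by (intro sum.cong refl) (auto simp: id_coeffs_def)
  then show ?thesis using p by simp
qed

lemma quad_form_bound: "cmod (quad_form n a v) \<le> (\<Sum>i<n. \<Sum>j<n. cmod (a i j)) * sqnorm n v"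
proof -
  have v: "cmod (v i) \<le> sqrt (sqnorm n v)" if "i < n" for i
    unfolding sqnorm_def using that by (intro real_le_rsqrt member_le_sum) auto
  have "cmod (quad_form n a v) \<le> (\<Sum>i<n. \<Sum>j<n. cmod (cnj (v i) * a i j * v j))"
    unfolding quad_form_def by (intro order_trans[OF norm_sum] sum_mono order_refl)
  also have "\<dots> \<le> (\<Sum>i<n. \<Sum>j<n. cmod (a i j) * sqnorm n v)"
  proof (intro sum_mono)
    fix i j assume "i \<in> {..<n}" "j \<in> {..<n}"
    then have "cmod (v i) * cmod (v j) \<le> sqrt (sqnorm n v) * sqrt (sqnorm n v)"
      using v by (intro mult_mono) auto
    then have "cmod (a i j) * (cmod (v i) * cmod (v j)) \<le> cmod (a i j) * sqnorm n v"
      by (intro mult_left_mono) auto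
    then show "cmod (cnj (v i) * a i j * v j) \<le> cmod (a i j) * sqnorm n v"
      by (simp add: norm_mult mult_ac)
  qed
  finally show ?thesis by (simp add: sum_distrib_right)
qed

text \<open>Stacking the rows of \<alpha> on those of \<alpha>' adds the Gram matrices.\<close>

lemma dominates_gram_add:
  assumes "dominates_gram n a k \<alpha>" "dominates_gram n a' k' \<alpha>'"
  shows "dominates_gram n (a + a') (k + k') (\<lambda>p. if p < k then \<alpha> p else \<alpha>' (p - k))"
  unfolding dominates_gram_def
proof
  fix v
  have "sqnorm (k + k') (apply_coeffs n (\<lambda>p. if p < k then \<alpha> p else \<alpha>' (p - k)) v)
      = sqnorm k (apply_coeffs n \<alpha> v) + sqnorm k' (apply_coeffs n \<alpha>' v)"
    unfolding sqnorm_def sum_lessThan_add by (simp add: apply_coeffs_def)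
  also have "\<dots> \<le> Re (quad_form n a v) + Re (quad_form n a' v)"
    using assms by (intro add_mono) (auto simp: dominates_gram_def)
  finally show "sqnorm (k + k') (apply_coeffs n (\<lambda>p. if p < k then \<alpha> p else \<alpha>' (p - k)) v)
      \<le> Re (quad_form n (a + a') v)" by (simp add: quad_form_add)
qed

lemma dominates_gram_scale:
  assumes "dominates_gram n a k \<alpha>" "0 \<le> c"
  shows "dominates_gram n (\<lambda>i j. of_real c * a i j) k (\<lambda>p j. of_real (sqrt c) * \<alpha> p j)"
  unfolding dominates_gram_def
proof
  fix v
  have "apply_coeffs n (\<lambda>p j. of_real (sqrt c) * \<alpha> p j) v
      = (\<lambda>p. of_real (sqrt c) * apply_coeffs n \<alpha> v p)"
    by (rule ext) (simp add: apply_coeffs_def sum_distrib_left mult_ac)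
  then have "sqnorm k (apply_coeffs n (\<lambda>p j. of_real (sqrt c) * \<alpha> p j) v)
      = c * sqnorm k (apply_coeffs n \<alpha> v)"
    using assms(2) by (simp add: sqnorm_scale)
  also have "\<dots> \<le> c * Re (quad_form n a v)"
    using assms by (intro mult_left_mono) (auto simp: dominates_gram_def)
  finally show "sqnorm k (apply_coeffs n (\<lambda>p j. of_real (sqrt c) * \<alpha> p j) v)
      \<le> Re (quad_form n (\<lambda>i j. of_real c * a i j) v)" by (simp add: quad_form_scale)
qed

text \<open>The sum of the moduli of the entries bounds the quadratic form of \<open>a\<close>, so t
  leaves room for s times the identity, which is the Gram matrix of sqrt s times the
  identity.\<close>

lemma dominates_gram_unit:
  assumes "0 \<le> s" "(\<Sum>i<n. \<Sum>j<n. cmod (a i j)) + s \<le> t"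
  shows "dominates_gram n ((\<lambda>i j. of_real t * id_coeffs i j) - a) n (\<lambda>p j. of_real (sqrt s) *
      id_coeffs p j)"
  unfolding dominates_gram_def
proof
  fix v
  have "sqnorm n (apply_coeffs n (\<lambda>p j. of_real (sqrt s) * id_coeffs p j) v)
      = sqnorm n (\<lambda>p. of_real (sqrt s) * v p)"
    unfolding sqnorm_def by (intro sum.cong refl) (simp add: apply_coeffs_id)
  also have "\<dots> = s * sqnorm n v" using assms by (simp add: sqnorm_scale)
  also have "\<dots> \<le> t * sqnorm n v - (\<Sum>i<n. \<Sum>j<n. cmod (a i j)) * sqnorm n v"
    using mult_right_mono[OF assms(2) sqnorm_nonneg[of n v]] by (simp add: algebra_simps)
  also have "\<dots> \<le> t * sqnorm n v - Re (quad_form n a v)"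
    using quad_form_bound[of n a v] complex_Re_le_cmod[of "quad_form n a v"] by linarith
  finally show "sqnorm n (apply_coeffs n (\<lambda>p j. of_real (sqrt s) * id_coeffs p j) v)
      \<le> Re (quad_form n ((\<lambda>i j. of_real t * id_coeffs i j) - a) v)"
    by (simp add: quad_form_diff quad_form_scale quad_form_id)
qed

section \<open>Order unit and norm bound from Ruan's axioms\<close>

context operator_space
begin

lemma vector_space_corner: "vector_space (corner_scale scale)"
  by unfold_locales
    (simp_all add: corner_scale_def split_beta prod_eq_iff fun_eq_iff algebra_simps
      scale_right_distrib scale_left_distrib)

lemma nrm_zero: "1 \<le> k \<Longrightarrow> 1 \<le> l \<Longrightarrow> nrm (0\<^sub>m k l) = 0"
  using nrm_eq_0_iff by simp

text \<open>Follows from 0 = ||y - y|| \<le> 2 ||y||.\<close>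

lemma nrm_nonneg:
  assumes "1 \<le> k" "1 \<le> l" "y \<in> carrier_mat k l" shows "0 \<le> nrm y"
proof -
  have y: "map_mat (scale (- 1)) y \<in> carrier_mat k l" using assms by simp
  have "y + map_mat (scale (- 1)) y = 0\<^sub>m k l" using assms by (intro eq_matI) auto
  then show ?thesis
    using nrm_triangle[OF assms y] nrm_scale[OF assms, of "- 1"] nrm_zero[OF assms(1,2)] by simp
qed

text \<open>Here the axiom on direct sums enters: stacked coefficients compress
  \<open>dsum y y'\<close> to the sum of the two corners, and this middle factor still has norm at
  most 1.\<close>

lemma corner_cone_add:
  assumes "u \<in> corner_cone scale nrm n m" "v \<in> corner_cone scale nrm n m"
  shows "u + v \<in> corner_cone scale nrm n m"
proof -
  obtain a z b where u: "u = (a, z, b)" using prod_cases3 by blast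
  obtain a' z' b' where v: "v = (a', z', b')" using prod_cases3 by blast
  from assms(1)[unfolded u] obtain k l \<alpha> \<beta> y
      where 1: "1 \<le> k" "1 \<le> l" "y \<in> carrier_mat k l" "nrm y \<le> 1"
    "dominates_gram n a k \<alpha>" "dominates_gram m b l \<beta>"
    "\<And>i j. i < n \<Longrightarrow> j < m \<Longrightarrow> z i j = compress scale k l \<alpha> y \<beta> i j"
    by (rule corner_coneE) blast
  from assms(2)[unfolded v] obtain k' l' \<alpha>' \<beta>' y'
      where 2: "1 \<le> k'" "1 \<le> l'" "y' \<in> carrier_mat k' l'" "nrm y' \<le> 1"
    "dominates_gram n a' k' \<alpha>'" "dominates_gram m b' l' \<beta>'"
    "\<And>i j. i < n \<Longrightarrow> j < m \<Longrightarrow> z' i j = compress scale k' l' \<alpha>' y' \<beta>' i j"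
    by (rule corner_coneE) blast
  let ?\<alpha> = "\<lambda>p. if p < k then \<alpha> p else \<alpha>' (p - k)" and ?\<beta> = "\<lambda>p. if p < l then \<beta> p else \<beta>' (p - l)"
  have "(a + a', z + z', b + b') \<in> corner_cone scale nrm n m"
  proof (rule corner_coneI)
    show "dsum y y' \<in> carrier_mat (k + k') (l + l')" using 1(3) 2(3) by (auto simp: dsum_def)
    show "nrm (dsum y y') \<le> 1" using nrm_dsum[OF 1(1,2) 2(1,2) 1(3) 2(3)] 1(4) 2(4) by simp
    show "dominates_gram n (a + a') (k + k') ?\<alpha>" using 1(5) 2(5) by (rule dominates_gram_add)
    show "dominates_gram m (b + b') (l + l') ?\<beta>" using 1(6) 2(6) by (rule dominates_gram_add)
    show "(z + z') i j = compress scale (k + k') (l + l') ?\<alpha> (dsum y y') ?\<beta> i j"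
        if "i < n" "j < m" for i j
      using 1(3) 2(3) 1(7)[OF that] 2(7)[OF that]
      unfolding compress_def sum_lessThan_add dsum_def by simp
  qed (use 1 in auto)
  then show ?thesis by (simp add: u v)
qed

lemma compress_scale:
  "compress scale k l (\<lambda>p j. c * \<alpha> p j) y (\<lambda>p j. d * \<beta> p j) i j
      = scale (cnj c * d) (compress scale k l \<alpha> y \<beta> i j)"
  by (simp add: compress_def scale_sum_right mult_ac)

lemma corner_cone_scale:
  assumes c: "0 \<le> c" and "u \<in> corner_cone scale nrm n m"
  shows "corner_scale scale c u \<in> corner_cone scale nrm n m"
proof -
  obtain a z b where u: "u = (a, z, b)" using prod_cases3 by blast
  from assms(2)[unfolded u] obtain k l \<alpha> \<beta> y
      where 1: "1 \<le> k" "1 \<le> l" "y \<in> carrier_mat k l" "nrm y \<le> 1"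
    "dominates_gram n a k \<alpha>" "dominates_gram m b l \<beta>"
    "\<And>i j. i < n \<Longrightarrow> j < m \<Longrightarrow> z i j = compress scale k l \<alpha> y \<beta> i j"
    by (rule corner_coneE) blast
  have "(\<lambda>i j. of_real c * a i j, \<lambda>i j. scale (of_real c) (z i j), \<lambda>i j. of_real c * b i j)
      \<in> corner_cone scale nrm n m"
  proof (rule corner_coneI[where nrm = nrm])
    show "dominates_gram n (\<lambda>i j. of_real c * a i j) k (\<lambda>p j. of_real (sqrt c) * \<alpha> p j)"
      "dominates_gram m (\<lambda>i j. of_real c * b i j) l (\<lambda>p j. of_real (sqrt c) * \<beta> p j)"
      using 1(5,6) c by (auto intro: dominates_gram_scale)
    show "scale (of_real c) (z i j) = compress scale k l (\<lambda>p j. of_real (sqrt c) * \<alpha> p j) y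
        (\<lambda>p j. of_real (sqrt c) * \<beta> p j) i j" if "i < n" "j < m" for i j
      using 1(7)[OF that] c by (simp add: compress_scale flip: of_real_mult)
  qed (use 1 in auto)
  then show ?thesis by (simp add: u corner_scale_def)
qed

lemma corner_cone_unit: "corner_unit \<in> corner_cone scale nrm n m"
  unfolding corner_unit_def
  by (rule corner_coneI[of 1 1 "0\<^sub>m 1 1" _ _ _ "\<lambda>_ _. 0" _ _ "\<lambda>_ _. 0"])
    (auto simp: nrm_zero dominates_gram_def quad_form_id compress_def apply_coeffs_def[abs_def]
        sqnorm_def sum_nonneg)

text \<open>Such triples lie in the cone together with their negatives, so positive functionals
  cannot detect skew-Hermitian diagonal parts or entries beyond the sizes.\<close>

lemma corner_cone_zero_form:
  assumes "\<And>v. Re (quad_form n a v) = 0" "\<And>v. Re (quad_form m b v) = 0"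
    "\<And>i j. i < n \<Longrightarrow> j < m \<Longrightarrow> z i j = 0"
  shows "(a, z, b) \<in> corner_cone scale nrm n m"
  using assms
  by (intro corner_coneI[of 1 1 "0\<^sub>m 1 1" _ _ _ "\<lambda>_ _. 0" _ _ "\<lambda>_ _. 0"])
    (auto simp: nrm_zero dominates_gram_def compress_def apply_coeffs_def sqnorm_def)

lemma corner_order_unit:
  assumes n: "1 \<le> n" and m: "1 \<le> m"
  shows "\<exists>t. corner_scale scale t corner_unit - u \<in> corner_cone scale nrm n m"
proof -
  obtain a z b where u: "u = (a, z, b)" using prod_cases3 by blast
  define Z where "Z = mat n m (\<lambda>(i, j). z i j)"
  have Z: "Z \<in> carrier_mat n m" by (simp add: Z_def)
  \<comment> \<open>Division by s brings Z into the unit ball; the added 1 keeps s positive when Z =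
    0.\<close>
  define s where "s = nrm Z + 1"
  have s: "1 \<le> s" using nrm_nonneg[OF n m Z] by (simp add: s_def)
  define A where "A = (\<Sum>i<n. \<Sum>j<n. cmod (a i j))"
  define B where "B = (\<Sum>i<m. \<Sum>j<m. cmod (b i j))"
  have AB: "0 \<le> A" "0 \<le> B" by (auto simp: A_def B_def sum_nonneg)
  \<comment> \<open>Each diagonal block needs t to exceed its own entry sum by at least s; this
    value serves both.\<close>
  define t where "t = A + B + s"
  define y where "y = map_mat (scale (of_real (- 1 / s))) Z"
  have y: "y \<in> carrier_mat n m" using Z by (simp add: y_def)
  have "nrm y = cmod (of_real (- 1 / s)) * nrm Z" unfolding y_def by (rule nrm_scale[OF n m Z])
  also have "\<dots> = nrm Z / s" using s by (simp only: norm_of_real) simp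
  finally have ny: "nrm y \<le> 1" using s by (simp add: s_def)
  have "compress scale n m id_coeffs y id_coeffs i j = y $$ (i, j)" if "i < n" "j < m" for i j
  proof -
    have "compress scale n m id_coeffs y id_coeffs i j
        = (\<Sum>p<n. \<Sum>q<m. if q = j then if p = i then y $$ (p, q) else 0 else 0)"
      unfolding compress_def by (intro sum.cong refl) (auto simp: id_coeffs_def)
    then show ?thesis using that by simp
  qed
  \<comment> \<open>The coefficient sqrt s on either side undoes the division by s in y.\<close>
  then have comp: "compress scale n m (\<lambda>p j. of_real (sqrt s) * id_coeffs p j) y (\<lambda>p j. of_real
      (sqrt s) * id_coeffs p j) i j
      = - z i j" if "i < n" "j < m" for i j
    unfolding compress_scale using that s by (simp add: y_def Z_def flip: of_real_mult)
  have "((\<lambda>i j. of_real t * id_coeffs i j) - a, - z, (\<lambda>i j. of_real t * id_coeffs i j) - b) \<in>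
      corner_cone scale nrm n m"
  proof (rule corner_coneI[where nrm = nrm])
    show "dominates_gram n ((\<lambda>i j. of_real t * id_coeffs i j) - a) n (\<lambda>p j. of_real (sqrt s) *
        id_coeffs p j)"
      "dominates_gram m ((\<lambda>i j. of_real t * id_coeffs i j) - b) m (\<lambda>p j. of_real (sqrt s) *
          id_coeffs p j)"
      using s AB by (intro dominates_gram_unit; simp add: t_def flip: A_def B_def)+
  qed (use n m y ny comp in auto)
  moreover have "corner_scale scale t corner_unit - u
      = ((\<lambda>i j. of_real t * id_coeffs i j) - a, - z, (\<lambda>i j. of_real t * id_coeffs i j) - b)"
    by (auto simp: u corner_scale_def corner_unit_def fun_eq_iff)
  ultimately show ?thesis by metis
qed

text \<open>At the first basis vector, which exists as n \<ge> 1, the form of t times the identity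
  has the value t and dominates a squared norm.\<close>

lemma corner_unit_nonneg:
  assumes n: "1 \<le> n" and "corner_scale scale t corner_unit \<in> corner_cone scale nrm n m"
  shows "0 \<le> t"
proof -
  have "(\<lambda>i j. of_real t * id_coeffs i j, \<lambda>i j. scale (of_real t) ((0 :: nat \<Rightarrow> nat \<Rightarrow> 'a) i j), \<lambda>i
      j. of_real t * id_coeffs i j) \<in> corner_cone scale nrm n m"
    using assms(2) by (simp add: corner_scale_def corner_unit_def)
  then obtain k \<alpha> where "dominates_gram n (\<lambda>i j. of_real t * id_coeffs i j) k \<alpha>"
    by (rule corner_coneE) blast
  then have "sqnorm k (apply_coeffs n \<alpha> (\<lambda>i. if i = 0 then 1 else 0)) \<le> t * sqnorm n (\<lambda>i.
      if i = 0 then 1 else 0)"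
    unfolding dominates_gram_def by (simp add: quad_form_scale quad_form_id)
  moreover have "sqnorm n (\<lambda>i. if i = 0 then 1 else 0) = 1"
  proof -
    have "sqnorm n (\<lambda>i. if i = 0 then 1 else 0) = (\<Sum>i<n. if i = 0 then 1 else 0)"
      unfolding sqnorm_def by (intro sum.cong refl) auto
    then show ?thesis using n by simp
  qed
  ultimately show ?thesis using order_trans[OF sqnorm_nonneg] by simp
qed

text \<open>Here the axiom on products enters. The diagonal conditions say \<alpha>^* \<alpha> \<le>
  t and \<beta>^* \<beta> \<le> t, so both coefficient matrices have norm at most sqrt t, and -x =
  \<alpha>^* y \<beta> has norm at most sqrt t * 1 * sqrt t = t.\<close>

lemma corner_norm_le:
  assumes n: "1 \<le> n" and m: "1 \<le> m" and x: "x \<in> carrier_mat n m"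
    and C: "corner_scale scale t corner_unit - (0, \<lambda>i j. x $$ (i, j), 0) \<in> corner_cone scale nrm n
        m"
  shows "nrm x \<le> t"
proof -
  have "(\<lambda>i j. of_real t * id_coeffs i j, \<lambda>i j. - x $$ (i, j), \<lambda>i j. of_real t * id_coeffs i j) \<in>
      corner_cone scale nrm n m"
    using C by (simp add: corner_scale_def corner_unit_def fun_diff_def)
  then obtain k l \<alpha> \<beta> y where *: "1 \<le> k" "1 \<le> l" "y \<in> carrier_mat k l" "nrm y \<le> 1"
    "dominates_gram n (\<lambda>i j. of_real t * id_coeffs i j) k \<alpha>"
        "dominates_gram m (\<lambda>i j. of_real t * id_coeffs i j) l \<beta>"
    "\<And>i j. i < n \<Longrightarrow> j < m \<Longrightarrow> - x $$ (i, j) = compress scale k l \<alpha> y \<beta> i j"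
    by (rule corner_coneE) blast
  \<comment> \<open>Replacing y by 0 keeps the diagonal conditions and removes the corner.\<close>
  have t: "0 \<le> t"
  proof (rule corner_unit_nonneg[OF n])
    show "corner_scale scale t corner_unit \<in> corner_cone scale nrm n m"
      unfolding corner_unit_def corner_scale_def prod.case
      using *(5,6) nrm_zero[of k l] *(1,2)
      by (intro corner_coneI[of k l "0\<^sub>m k l"]) (auto simp: compress_def)
  qed
  let ?\<alpha> = "mat n k (\<lambda>(j, p). cnj (\<alpha> p j))" and ?\<beta> = "mat l m (\<lambda>(p, j). \<beta> p j)"
  have op: "op_norm ?\<alpha> \<le> sqrt t" "op_norm ?\<beta> \<le> sqrt t"
    using *(5,6) t by (auto intro!: op_norm_le_of_contraction
        simp: dominates_gram_def quad_form_scale quad_form_id apply_coeffs_def[abs_def])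
  have eq: "map_mat (scale (- 1)) x = rmult scale (lmult scale ?\<alpha> y) ?\<beta>"
  proof (rule eq_matI)
    fix i j assume "i < dim_row (rmult scale (lmult scale ?\<alpha> y) ?\<beta>)"
        "j < dim_col (rmult scale (lmult scale ?\<alpha> y) ?\<beta>)"
    then have ij: "i < n" "j < m" by (auto simp: rmult_def lmult_def)
    have "map_mat (scale (- 1)) x $$ (i, j) = compress scale k l \<alpha> y \<beta> i j"
      using x ij *(7)[OF ij] by simp
    also have "\<dots> = (\<Sum>q<l. \<Sum>p<k. scale (\<beta> q j) (scale (cnj (\<alpha> p i)) (y $$ (p, q))))"
      unfolding compress_def by (subst sum.swap) (simp add: mult.commute)
    also have "\<dots> = rmult scale (lmult scale ?\<alpha> y) ?\<beta> $$ (i, j)"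
      using ij *(3) by (auto simp: rmult_def lmult_def scale_sum_right intro!: sum.cong)
    finally show "map_mat (scale (- 1)) x $$ (i, j) = rmult scale (lmult scale ?\<alpha> y) ?\<beta> $$ (i, j)" .
  qed (use x in \<open>auto simp: rmult_def lmult_def\<close>)
  have "nrm x = nrm (map_mat (scale (- 1)) x)" using nrm_scale[OF n m x, of "- 1"] by simp
  also have "\<dots> \<le> op_norm ?\<alpha> * nrm y * op_norm ?\<beta>"
    unfolding eq by (rule nrm_mult[OF *(1,2) n m *(3)]) auto
  also have "\<dots> \<le> sqrt t * 1 * sqrt t"
    using op *(4) op_norm_nonneg t nrm_nonneg[OF *(1-3)] by (intro mult_mono) auto
  finally show ?thesis using t by simp
qed

lemma pure_corner_state_exists:
  assumes n: "1 \<le> n" and m: "1 \<le> m" and x: "x \<in> carrier_mat n m"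
  obtains f where "functional (corner_scale scale) f"
    "\<And>v. v \<in> corner_cone scale nrm n m \<Longrightarrow> 0 \<le> f v"
    "f corner_unit = 1" "nrm x \<le> f (0, \<lambda>i j. x $$ (i, j), 0)"
    "\<And>g v. \<lbrakk>functional (corner_scale scale) g; \<And>v. v \<in> corner_cone scale nrm n m \<Longrightarrow> 0 \<le> g v;
       \<And>v. v \<in> corner_cone scale nrm n m \<Longrightarrow> g v \<le> f v\<rbrakk> \<Longrightarrow> g v = g corner_unit * f v"
proof (rule pure_state_exists[OF vector_space_corner, where C = "corner_cone scale nrm n m"
      and e = corner_unit and x = "(0, \<lambda>i j. x $$ (i, j), 0)" and \<tau> = "nrm x"])
  show "\<exists>t. corner_scale scale t corner_unit - v \<in> corner_cone scale nrm n m" for v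
    by (rule corner_order_unit[OF n m])
  show "0 \<le> t" if "corner_scale scale t corner_unit \<in> corner_cone scale nrm n m" for t
    by (rule corner_unit_nonneg[OF n that])
  show "nrm x \<le> t"
    if "corner_scale scale t corner_unit - (0, \<lambda>i j. x $$ (i, j), 0) \<in> corner_cone scale nrm n m"
        for t
    by (rule corner_norm_le[OF n m x that])
qed (use that in \<open>auto intro: corner_cone_add corner_cone_scale corner_cone_unit\<close>)

end

section \<open>Factorization of positive semidefinite forms\<close>

lemma cnj_id_coeffs [simp]: "cnj (id_coeffs i j) = id_coeffs i j"
  by (simp add: id_coeffs_def)

lemma sum_id_coeffs:
  assumes "k < n"
  shows "(\<Sum>j<n. g j * id_coeffs k j) = g k" "(\<Sum>j<n. id_coeffs k j * g j) = g k"
proof -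
  have "(\<Sum>j<n. g j * id_coeffs k j) = (\<Sum>j<n. if j = k then g k else 0)"
    by (intro sum.cong refl) (auto simp: id_coeffs_def)
  then show "(\<Sum>j<n. g j * id_coeffs k j) = g k" using assms by simp
  then show "(\<Sum>j<n. id_coeffs k j * g j) = g k" by (simp add: mult.commute)
qed

lemma quad_form_rows: "quad_form n p v = (\<Sum>i<n. cnj (v i) * (\<Sum>j<n. p i j * v j))"
  by (simp add: quad_form_def sum_distrib_left mult.assoc)

text \<open>Changing one coordinate is the only perturbation that \<open>row_zero\<close> and
  \<open>schur_complement\<close> require.\<close>

lemma quad_form_shift:
  assumes k: "k < n"
  shows "quad_form n p (\<lambda>i. u i + c * id_coeffs k i)
    = quad_form n p u + c * (\<Sum>i<n. cnj (u i) * p i k) + cnj c * (\<Sum>j<n. p k j * u j) + cnj c * c *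
        p k k"
proof -
  define row where "row i = (\<Sum>j<n. p i j * u j) + c * p i k" for i
  have *: "(\<Sum>j<n. p i j * (u j + c * id_coeffs k j)) = row i" for i
    using sum_id_coeffs(1)[OF k, of "\<lambda>j. p i j * c"]
    by (simp add: row_def distrib_left sum.distrib mult_ac)
  have "quad_form n p (\<lambda>i. u i + c * id_coeffs k i)
      = (\<Sum>i<n. cnj (u i) * row i + (cnj c * row i) * id_coeffs k i)"
    unfolding quad_form_rows * by (intro sum.cong refl) (simp add: algebra_simps)
  also have "\<dots> = (\<Sum>i<n. cnj (u i) * row i) + cnj c * row k"
    by (simp add: sum.distrib sum_id_coeffs[OF k])
  also have "(\<Sum>i<n. cnj (u i) * row i) = quad_form n p u + c * (\<Sum>i<n. cnj (u i) * p i k)"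
    by (simp add: row_def quad_form_rows distrib_left sum.distrib sum_distrib_left mult_ac)
  finally show ?thesis by (simp add: row_def algebra_simps)
qed

lemma quadratic_nonneg_imp_zero:
  fixes h :: real
  assumes "0 \<le> h" "\<And>t. 0 \<le> t \<Longrightarrow> 2 * t * h \<le> q"
  shows "h = 0"
proof (rule ccontr)
  assume "h \<noteq> 0"
  then have h: "0 < h" using assms(1) by simp
  have "2 * ((\<bar>q\<bar> + 1) / (2 * h)) * h \<le> q" using h by (intro assms(2)) auto
  then show False using h by simp
qed

locale psd_coeffs =
  fixes n :: nat and p :: "nat \<Rightarrow> nat \<Rightarrow> complex"
  assumes herm: "\<And>i j. i < n \<Longrightarrow> j < n \<Longrightarrow> p j i = cnj (p i j)"
    and psd: "\<And>v. 0 \<le> Re (quad_form n p v)"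
begin

lemma row_col: "k < n \<Longrightarrow> (\<Sum>i<n. cnj (u i) * p i k) = cnj (\<Sum>j<n. p k j * u j)"
  unfolding cnj_sum by (intro sum.cong refl) (simp add: herm[of k] mult.commute)

lemma diag_real: "i < n \<Longrightarrow> p i i = of_real (Re (p i i))"
  using arg_cong[OF herm[of i i], of Im] by (simp add: complex_eq_iff)

lemma quad_form_id_coeffs: "k < n \<Longrightarrow> quad_form n p (id_coeffs k) = p k k"
  by (simp add: quad_form_rows sum_id_coeffs mult.commute[of "id_coeffs k _"])

lemma diag_nonneg: "i < n \<Longrightarrow> 0 \<le> Re (p i i)"
  using psd[of "id_coeffs i"] by (simp add: quad_form_id_coeffs)

text \<open>Adding - t p_ij times the i-th basis vector to the j-th changes the form by -2 t
  |p_ij|^2, with no quadratic term because p_ii = 0. Nonnegativity for all t \<ge> 0 leaves only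
  p_ij = 0.\<close>

lemma row_zero:
  assumes i: "i < n" and j: "j < n" and z: "p i i = 0"
  shows "p i j = 0"
proof -
  have "(cmod (p i j))\<^sup>2 = 0"
  proof (rule quadratic_nonneg_imp_zero)
    fix t :: real assume "0 \<le> t"
    let ?c = "- of_real t * p i j"
    have "quad_form n p (\<lambda>k. id_coeffs j k + ?c * id_coeffs i k)
        = p j j + ?c * p j i + cnj ?c * p i j"
      unfolding quad_form_shift[OF i] quad_form_id_coeffs[OF j] using z
      by (simp add: sum_id_coeffs[OF j])
    also have "\<dots> = p j j - 2 * of_real t * (p i j * cnj (p i j))"
      using herm[OF i j] by (simp add: algebra_simps)
    finally have "Re (quad_form n p (\<lambda>k. id_coeffs j k + ?c * id_coeffs i k))
        = Re (p j j) - 2 * t * (cmod (p i j))\<^sup>2"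
      by (simp add: complex_mult_cnj cmod_power2)
    then show "2 * t * (cmod (p i j))\<^sup>2 \<le> Re (p j j)"
      using psd[of "\<lambda>k. id_coeffs j k + ?c * id_coeffs i k"] by simp
  qed simp
  then show ?thesis by simp
qed

text \<open>Its form at v is the form of p at v - (s / p_kk) e_k, the minimum of the latter over all
  changes of the k-th coordinate, and is therefore nonnegative.\<close>

lemma schur_complement:
  assumes k: "k < n" and c: "0 < Re (p k k)"
  shows "psd_coeffs n (\<lambda>i j. p i j - p i k * p k j / p k k)"
proof
  let ?c = "Re (p k k)"
  fix i j assume ij: "i < n" "j < n"
  show "p j i - p j k * p k i / p k k = cnj (p i j - p i k * p k j / p k k)"
    by (simp add: mult.commute herm[OF ij] herm[OF k ij(2)] herm[OF ij(1) k] flip: herm[OF k k])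
next
  fix v
  define s where "s = (\<Sum>j<n. p k j * v j)"
  have nz: "p k k \<noteq> 0" using c by auto
  have kk: "cnj (p k k) = p k k" using herm[OF k k] by simp
  have "quad_form n (\<lambda>i j. p i j - p i k * p k j / p k k) v
      = (\<Sum>i<n. cnj (v i) * (\<Sum>j<n. p i j * v j) - (cnj (v i) * p i k) * (s / p k k))"
    unfolding quad_form_rows
  proof (intro sum.cong refl)
    fix i
    have "(\<Sum>j<n. (p i j - p i k * p k j / p k k) * v j) = (\<Sum>j<n. p i j * v j) - p i k * (s / p k k)"
    proof -
      have "(\<Sum>j<n. (p i j - p i k * p k j / p k k) * v j)
          = (\<Sum>j<n. p i j * v j - p i k / p k k * (p k j * v j))"
        by (intro sum.cong refl) (simp add: algebra_simps)
      then show ?thesis unfolding sum_subtractf s_def sum_distrib_left[symmetric] by simp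
    qed
    then show "cnj (v i) * (\<Sum>j<n. (p i j - p i k * p k j / p k k) * v j)
        = cnj (v i) * (\<Sum>j<n. p i j * v j) - (cnj (v i) * p i k) * (s / p k k)"
      by (simp add: right_diff_distrib mult_ac)
  qed
  also have "\<dots> = quad_form n p v - cnj s * (s / p k k)"
    unfolding sum_subtractf quad_form_rows[symmetric] sum_distrib_right[symmetric]
    by (simp add: row_col[OF k] s_def)
  also have "\<dots> = quad_form n p (\<lambda>i. v i + (- s / p k k) * id_coeffs k i)"
    unfolding quad_form_shift[OF k] row_col[OF k] s_def[symmetric] using nz
        by (simp add: kk field_simps)
  finally show "0 \<le> Re (quad_form n (\<lambda>i j. p i j - p i k * p k j / p k k) v)" using psd by simp
qed

end

text \<open>Cholesky elimination. Each pivot contributes one row to \<open>A\<close> and makes at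
  least one more diagonal entry zero, so the number of rows is bounded by the number of nonzero
  diagonal entries. The right inverse \<open>R\<close> is carried along and certifies that no row is
  redundant.\<close>

lemma psd_coeffs_factor:
  assumes "psd_coeffs n p"
  shows "\<exists>r A R. r \<le> card {i. i < n \<and> p i i \<noteq> 0} \<and>
    (\<forall>i<n. \<forall>j<n. p i j = (\<Sum>k<r. cnj (A k i) * A k j)) \<and>
    (\<forall>k<r. \<forall>l<r. (\<Sum>i<n. A k i * R i l) = id_coeffs k l)"
  using assms
proof (induction "card {i. i < n \<and> p i i \<noteq> 0}" arbitrary: p rule: less_induct)
  case less
  interpret psd_coeffs n p by fact
  show ?case
  proof (cases "\<exists>k<n. p k k \<noteq> 0")
    case False
    then have "\<forall>i<n. \<forall>j<n. p i j = 0" using row_zero by blast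
    then show ?thesis by (intro exI[of _ 0]) auto
  next
    case True
    then obtain k where k: "k < n" "p k k \<noteq> 0" by blast
    define c where "c = Re (p k k)"
    have pkk: "p k k = of_real c" using diag_real[OF k(1)] by (simp add: c_def)
    have c: "0 < c" using diag_nonneg[OF k(1)] k(2) unfolding pkk by (simp add: less_le)
    define p' where "p' i j = p i j - p i k * p k j / p k k" for i j
    have psd': "psd_coeffs n p'"
      using schur_complement[OF k(1)] c unfolding p'_def[abs_def] c_def by blast
    have p'k: "p' i k = 0" "p' k i = 0" for i using k(2) by (auto simp: p'_def)
    \<comment> \<open>A zero diagonal entry survives the elimination because its whole row is zero,
      and the pivot joins the zero entries.\<close>
    have sub: "{i. i < n \<and> p' i i \<noteq> 0} \<subset> {i. i < n \<and> p i i \<noteq> 0}"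
    proof (rule psubsetI)
      have "p' i i = 0" if "i < n" "p i i = 0" for i
        unfolding p'_def row_zero[OF that(1) k(1) that(2)] using that(2) by simp
      then show "{i. i < n \<and> p' i i \<noteq> 0} \<subseteq> {i. i < n \<and> p i i \<noteq> 0}" by blast
      show "{i. i < n \<and> p' i i \<noteq> 0} \<noteq> {i. i < n \<and> p i i \<noteq> 0}" using k p'k by blast
    qed
    have card: "card {i. i < n \<and> p' i i \<noteq> 0} < card {i. i < n \<and> p i i \<noteq> 0}"
      by (rule psubset_card_mono[OF _ sub]) simp
    from less(1)[OF card psd'] obtain r A R where
      r: "r \<le> card {i. i < n \<and> p' i i \<noteq> 0}" and
      A: "\<And>i j. i < n \<Longrightarrow> j < n \<Longrightarrow> p' i j = (\<Sum>a<r. cnj (A a i) * A a j)" and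
      R: "\<And>a b. a < r \<Longrightarrow> b < r \<Longrightarrow> (\<Sum>i<n. A a i * R i b) = id_coeffs a b" by blast
    \<comment> \<open>The pivot entry of p' is 0 and equals the sum of the |A a k|^2. So the earlier
      rows ignore the k-th coordinate, and the right inverse may be corrected there freely.\<close>
    have Ak: "A a k = 0" if "a < r" for a
    proof -
      have "of_real (sqnorm r (\<lambda>a. A a k)) = p' k k"
        using A[OF k(1) k(1)] by (simp only: sum_cnj_mult_self)
      then have "sqnorm r (\<lambda>a. A a k) = 0" by (simp add: p'k)
      then show ?thesis using that by (rule sqnorm_eq_0D)
    qed
    define rc where "rc = complex_of_real (sqrt c)"
    have rc: "rc * rc = p k k" "rc \<noteq> 0" "cnj rc = rc"
      using c by (auto simp: rc_def pkk simp flip: of_real_mult)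
    define A' where "A' a = (if a < r then A a else (\<lambda>j. p k j / rc))" for a
    \<comment> \<open>The new column is a multiple of the k-th basis vector; the old columns are
      shifted along that vector until the new row annihilates them.\<close>
    define R' where "R' i b = (if b < r then R i b - (\<Sum>j<n. p k j * R j b) / p k k * id_coeffs k i
      else id_coeffs k i / rc)" for i b
    have fac: "p i j = (\<Sum>a<Suc r. cnj (A' a i) * A' a j)" if ij: "i < n" "j < n" for i j
    proof -
      have "(\<Sum>a<Suc r. cnj (A' a i) * A' a j) = p' i j + cnj (p k i / rc) * (p k j / rc)"
        using A[OF ij] by (simp add: A'_def)
      also have "cnj (p k i / rc) * (p k j / rc) = p i k * p k j / p k k"
        unfolding rc(1)[symmetric] herm[OF k(1) ij(1)] by (simp add: rc(3))
      finally show ?thesis by (simp add: p'_def)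
    qed
    have inv: "(\<Sum>i<n. A' a i * R' i b) = id_coeffs a b" if ab: "a < Suc r" "b < Suc r" for a b
    proof -
      have less: "(\<Sum>i<n. g i * R' i b)
          = (\<Sum>i<n. g i * R i b) - g k * ((\<Sum>j<n. p k j * R j b) / p k k)"
        if "b < r" for g :: "nat \<Rightarrow> complex"
        using that sum_id_coeffs(1)[OF k(1), of "\<lambda>i. g i * ((\<Sum>j<n. p k j * R j b) / p k k)"]
        by (simp add: R'_def right_diff_distrib sum_subtractf mult.assoc)
      have eq: "(\<Sum>i<n. g i * R' i b) = g k / rc" if "\<not> b < r" for g :: "nat \<Rightarrow> complex"
        using that sum_id_coeffs(1)[OF k(1), of "\<lambda>i. g i / rc"] by (simp add: R'_def)
      show ?thesis
      proof (cases "a < r")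
        case True
        then show ?thesis
          using Ak[OF True] R[OF True] ab
              by (cases "b < r") (auto simp: less eq A'_def id_coeffs_def)
      next
        case False
        then have a: "a = r" using ab by simp
        show ?thesis
        proof (cases "b < r")
          case True
          have "(\<Sum>i<n. p k i / rc * R i b) = (\<Sum>j<n. p k j * R j b) / rc"
            by (simp add: sum_divide_distrib)
          then have "(\<Sum>i<n. p k i / rc * R' i b) = 0"
            unfolding less[OF True] using k(2) by simp
          then show ?thesis using True by (simp add: a A'_def id_coeffs_def)
        next
          case False
          have "(\<Sum>i<n. p k i / rc * R' i b) = 1"
            unfolding eq[OF False] using rc(2) by (simp flip: rc(1))
          then show ?thesis using False ab by (simp add: a A'_def id_coeffs_def)
        qed
      qed
    qed
    have le: "Suc r \<le> card {i. i < n \<and> p i i \<noteq> 0}" using r card by linarith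
    have fac': "\<forall>i<n. \<forall>j<n. p i j = (\<Sum>a<Suc r. cnj (A' a i) * A' a j)" by (intro allI impI fac)
    have inv': "\<forall>a<Suc r. \<forall>b<Suc r. (\<Sum>i<n. A' a i * R' i b) = id_coeffs a b"
        by (intro allI impI inv)
    show ?thesis
      by (rule exI[of _ "Suc r"], rule exI[of _ A'], rule exI[of _ R'], intro conjI le fac' inv')
  qed
qed

section \<open>Representation of states\<close>

text \<open>The real part of the vector functional at (A, B) in C^n (x) C^r + C^m (x) C^s of the
  block matrix with diagonal a (x) 1 and b (x) 1 and corner [\<phi>(z_ij)]; the factor 2 accounts
  for the adjoint corner.\<close>

definition corner_functional ::
  "nat \<Rightarrow> nat \<Rightarrow> nat \<Rightarrow> nat \<Rightarrow> (nat \<Rightarrow> nat \<Rightarrow> complex) \<Rightarrow> ('a \<Rightarrow> complex mat) \<Rightarrow> (nat \<Rightarrow> nat \<Rightarrow> complex) \<Rightarrow>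
   'a corner \<Rightarrow> real" where
  "corner_functional n m r s A \<phi> B = (\<lambda>(a, z, b).
     Re (\<Sum>k<r. quad_form n a (A k)) + Re (\<Sum>l<s. quad_form m b (B l)) +
     2 * Re (\<Sum>i<n. \<Sum>j<m. \<Sum>k<r. \<Sum>l<s. cnj (A k i) * \<phi> (z i j) $$ (k, l) * B l j))"

lemma amplify_pairing:
  assumes y: "y \<in> carrier_mat k l"
  shows "(\<Sum>p<k * r. \<Sum>q<l * s. cnj (\<xi> (p div r) (p mod r)) * amplify r s \<phi> y $$ (p, q) * \<eta> (q div
      s) (q mod s))
    = (\<Sum>p<k. \<Sum>q<l. \<Sum>a<r. \<Sum>c<s. cnj (\<xi> p a) * \<phi> (y $$ (p, q)) $$ (a, c) * \<eta> q c)"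
proof -
  have idx: "p * r + a < k * r" if "p < k" "a < r" for p a r k :: nat
  proof -
    have "p * r + a < Suc p * r" using that by simp
    also have "\<dots> \<le> k * r" using that by (intro mult_right_mono) auto
    finally show ?thesis .
  qed
  have "(\<Sum>p<k * r. \<Sum>q<l * s. cnj (\<xi> (p div r) (p mod r)) * amplify r s \<phi> y $$ (p, q) * \<eta> (q div s)
      (q mod s))
      = (\<Sum>p<k. \<Sum>a<r. \<Sum>q<l. \<Sum>c<s. cnj (\<xi> p a) * \<phi> (y $$ (p, q)) $$ (a, c) * \<eta> q c)"
    unfolding sum_lessThan_times using y by (intro sum.cong refl) (auto simp: amplify_def idx)
  also have "\<dots> = (\<Sum>p<k. \<Sum>q<l. \<Sum>a<r. \<Sum>c<s. cnj (\<xi> p a) * \<phi> (y $$ (p, q)) $$ (a, c) * \<eta> q c)"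
    by (intro sum.cong refl sum.swap)
  finally show ?thesis .
qed

lemma sqnorm_blocks: "sqnorm (k * r) (\<lambda>p. \<xi> (p div r) (p mod r)) = (\<Sum>p<k. sqnorm r (\<xi> p))"
  unfolding sqnorm_def sum_lessThan_times by (intro sum.cong refl) auto

lemma amplify_carrier: "y \<in> carrier_mat k l \<Longrightarrow> amplify r s \<phi> y \<in> carrier_mat (k * r) (l * s)"
  by (auto simp: amplify_def)

lemma op_norm_amplify_pairing:
  assumes y: "y \<in> carrier_mat k l"
  shows "2 * Re (\<Sum>p<k. \<Sum>q<l. \<Sum>a<r. \<Sum>c<s. cnj (\<xi> p a) * \<phi> (y $$ (p, q)) $$ (a, c) * \<eta> q c)
    \<le> op_norm (amplify r s \<phi> y) * ((\<Sum>p<k. sqnorm r (\<xi> p)) + (\<Sum>q<l. sqnorm s (\<eta> q)))"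
proof -
  let ?X = "\<Sum>p<k. sqnorm r (\<xi> p)" and ?Y = "\<Sum>q<l. sqnorm s (\<eta> q)"
  let ?S = "\<Sum>p<k. \<Sum>q<l. \<Sum>a<r. \<Sum>c<s. cnj (\<xi> p a) * \<phi> (y $$ (p, q)) $$ (a, c) * \<eta> q c"
  have "cmod ?S \<le> op_norm (amplify r s \<phi> y) * (sqrt ?X * sqrt ?Y)"
    using op_norm_pairing[OF amplify_carrier[OF y, of r s \<phi>],
        of "\<lambda>p. \<xi> (p div r) (p mod r)" "\<lambda>q. \<eta> (q div s) (q mod s)"]
    unfolding amplify_pairing[OF y] sqnorm_blocks .
  then have "2 * Re ?S \<le> op_norm (amplify r s \<phi> y) * (2 * (sqrt ?X * sqrt ?Y))"
    using complex_Re_le_cmod[of ?S] by simp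
  also have "\<dots> \<le> op_norm (amplify r s \<phi> y) * (?X + ?Y)"
    by (intro mult_left_mono two_sqrt_mult_le op_norm_nonneg sum_nonneg) auto
  finally show ?thesis .
qed

section \<open>Positivity of the functionals built from completely contractive maps\<close>

context operator_space
begin

lemma linear_to_mat_add:
  assumes "linear_to_mat scale r s \<phi>" "a < r" "c < s"
  shows "\<phi> (x + y) $$ (a, c) = \<phi> x $$ (a, c) + \<phi> y $$ (a, c)"
  using assms unfolding linear_to_mat_def by (metis carrier_matD index_add_mat(1))

lemma linear_to_mat_scale:
  assumes "linear_to_mat scale r s \<phi>" "a < r" "c < s"
  shows "\<phi> (scale t x) $$ (a, c) = t * \<phi> x $$ (a, c)"
  using assms unfolding linear_to_mat_def by (metis carrier_matD index_smult_mat(1))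

lemma linear_to_mat_zero:
  assumes "linear_to_mat scale r s \<phi>" "a < r" "c < s"
  shows "\<phi> 0 $$ (a, c) = 0"
  using linear_to_mat_scale[OF assms, of 0 0] by simp

text \<open>Moves \<alpha> and \<beta> from the compressed element onto the vectors A and B, so that
  only entries of y remain inside h.\<close>

lemma compress_pairing:
  assumes lin: "\<And>x y. h (x + y) = h x + h y" "\<And>t x. h (scale t x) = t * h x"
  shows "(\<Sum>i<n. \<Sum>j<m. cnj (A i) * h (compress scale k l \<alpha> y \<beta> i j) * B j)
    = (\<Sum>p<k. \<Sum>q<l. cnj (apply_coeffs n \<alpha> A p) * h (y $$ (p, q)) * apply_coeffs m \<beta> B q)"
proof -
  have h0: "h 0 = 0" using lin(2)[of 0 0] by simp
  have hsum: "h (sum g I) = (\<Sum>i\<in>I. h (g i))" for g and I :: "nat set"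
    by (induction I rule: infinite_finite_induct) (simp_all add: h0 lin)
  have "(\<Sum>i<n. \<Sum>j<m. cnj (A i) * h (compress scale k l \<alpha> y \<beta> i j) * B j)
      = (\<Sum>i<n. \<Sum>j<m. \<Sum>p<k. \<Sum>q<l. (cnj (\<alpha> p i) * cnj (A i)) * h (y $$ (p, q)) * (\<beta> q j * B j))"
    by (simp add: compress_def hsum lin sum_distrib_left sum_distrib_right mult_ac)
  also have "\<dots> = (\<Sum>p<k. \<Sum>q<l. \<Sum>i<n. \<Sum>j<m. (cnj (\<alpha> p i) * cnj (A i)) * h (y $$ (p, q)) * (\<beta> q j * B
      j))"
    by (rule sum_swap4)
  also have "\<dots> = (\<Sum>p<k. \<Sum>q<l. cnj (apply_coeffs n \<alpha> A p) * h (y $$ (p, q)) * apply_coeffs m \<beta> B q)"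
    unfolding apply_coeffs_def
    by (simp add: sum_distrib_left sum_distrib_right)
      (intro sum.cong refl sum.swap)
  finally show ?thesis .
qed

text \<open>Complete contractivity bounds the pairing from above; replacing \<xi> by -\<xi> turns
  this into the lower bound that positivity needs.\<close>

lemma CBall_pairing:
  assumes \<phi>: "\<phi> \<in> CBall scale nrm r s" and kl: "1 \<le> k" "1 \<le> l"
    and y: "y \<in> carrier_mat k l" and le: "nrm y \<le> 1"
  shows "0 \<le> (\<Sum>p<k. sqnorm r (\<xi> p)) + (\<Sum>q<l. sqnorm s (\<eta> q))
    + 2 * Re (\<Sum>p<k. \<Sum>q<l. \<Sum>a<r. \<Sum>c<s. cnj (\<xi> p a) * \<phi> (y $$ (p, q)) $$ (a, c) * \<eta> q c)"
proof -
  let ?S = "\<Sum>p<k. \<Sum>q<l. \<Sum>a<r. \<Sum>c<s. cnj (\<xi> p a) * \<phi> (y $$ (p, q)) $$ (a, c) * \<eta> q c"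
  have "op_norm (amplify r s \<phi> y) \<le> nrm y"
    using \<phi> kl y by (auto simp: CBall_def completely_contractive_def)
  then have "op_norm (amplify r s \<phi> y) \<le> 1" using le by simp
  moreover have "2 * Re (- ?S) \<le> op_norm (amplify r s \<phi> y) * ((\<Sum>p<k. sqnorm r (\<xi> p)) + (\<Sum>q<l.
      sqnorm s (\<eta> q)))"
  proof -
    have "(\<Sum>p<k. sqnorm r (\<lambda>a. - \<xi> p a)) = (\<Sum>p<k. sqnorm r (\<xi> p))" by (simp add: sqnorm_def)
    moreover have "(\<Sum>p<k. \<Sum>q<l. \<Sum>a<r. \<Sum>c<s. cnj (- \<xi> p a) * \<phi> (y $$ (p, q)) $$ (a, c) * \<eta> q c)
        = - ?S"
      by (simp add: sum_negf)
    ultimately show ?thesis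
      using op_norm_amplify_pairing[OF y,
          where \<xi> = "\<lambda>p a. - \<xi> p a" and r = r and s = s and \<phi> = \<phi> and \<eta> = \<eta>] by metis
  qed
  moreover have "0 \<le> (\<Sum>p<k. sqnorm r (\<xi> p)) + (\<Sum>q<l. sqnorm s (\<eta> q))"
    by (intro add_nonneg_nonneg sum_nonneg) auto
  ultimately have "2 * Re (- ?S) \<le> 1 * ((\<Sum>p<k. sqnorm r (\<xi> p)) + (\<Sum>q<l. sqnorm s (\<eta> q)))"
    by (meson mult_right_mono order_trans)
  then show ?thesis by simp
qed

text \<open>The diagonal terms are at least the squared norms of \<alpha> A and \<beta> B, and the
  corner term is the pairing of the amplified \<phi> at y with these vectors, so
  \<open>CBall_pairing\<close> applies.\<close>

lemma corner_functional_nonneg: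
  assumes \<phi>: "\<phi> \<in> CBall scale nrm r s" and v: "v \<in> corner_cone scale nrm n m"
  shows "0 \<le> corner_functional n m r s A \<phi> B v"
proof -
  obtain a z b where vd: "v = (a, z, b)" using prod_cases3 by blast
  from v[unfolded vd] obtain k l \<alpha> \<beta> y where 1: "1 \<le> k" "1 \<le> l" "y \<in> carrier_mat k l" "nrm y \<le> 1"
    "dominates_gram n a k \<alpha>" "dominates_gram m b l \<beta>"
    "\<And>i j. i < n \<Longrightarrow> j < m \<Longrightarrow> z i j = compress scale k l \<alpha> y \<beta> i j"
    by (rule corner_coneE) blast
  have lin: "linear_to_mat scale r s \<phi>" using \<phi> by (simp add: CBall_def)
  define \<xi> where "\<xi> p c = apply_coeffs n \<alpha> (A c) p" for p c
  define \<eta> where "\<eta> q c = apply_coeffs m \<beta> (B c) q" for q c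
  have swap: "(\<Sum>p<K. sqnorm R (\<lambda>c. g p c)) = (\<Sum>c<R. sqnorm K (\<lambda>p. g p c))" for K R g
    unfolding sqnorm_def by (rule sum.swap)
  have "(\<Sum>p<k. sqnorm r (\<xi> p)) = (\<Sum>c<r. sqnorm k (apply_coeffs n \<alpha> (A c)))"
    by (subst swap) (simp add: \<xi>_def)
  also have "\<dots> \<le> Re (\<Sum>c<r. quad_form n a (A c))"
    unfolding Re_sum using 1(5) by (intro sum_mono) (auto simp: dominates_gram_def)
  finally have le1: "(\<Sum>p<k. sqnorm r (\<xi> p)) \<le> Re (\<Sum>c<r. quad_form n a (A c))" .
  have "(\<Sum>q<l. sqnorm s (\<eta> q)) = (\<Sum>c<s. sqnorm l (apply_coeffs m \<beta> (B c)))"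
    by (subst swap) (simp add: \<eta>_def)
  also have "\<dots> \<le> Re (\<Sum>c<s. quad_form m b (B c))"
    unfolding Re_sum using 1(6) by (intro sum_mono) (auto simp: dominates_gram_def)
  finally have le2: "(\<Sum>q<l. sqnorm s (\<eta> q)) \<le> Re (\<Sum>c<s. quad_form m b (B c))" .
  have "(\<Sum>i<n. \<Sum>j<m. \<Sum>c<r. \<Sum>d<s. cnj (A c i) * \<phi> (z i j) $$ (c, d) * B d j)
      = (\<Sum>i<n. \<Sum>j<m. \<Sum>c<r. \<Sum>d<s. cnj (A c i) * \<phi> (compress scale k l \<alpha> y \<beta> i j) $$ (c, d) * B d j)"
    using 1(7) by (intro sum.cong refl) simp
  also have "\<dots> = (\<Sum>c<r. \<Sum>d<s. \<Sum>i<n. \<Sum>j<m. cnj (A c i) * \<phi> (compress scale k l \<alpha> y \<beta> i j) $$ (c, d)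
      * B d j)"
    by (rule sum_swap4)
  also have "\<dots> = (\<Sum>c<r. \<Sum>d<s. \<Sum>p<k. \<Sum>q<l. cnj (\<xi> p c) * \<phi> (y $$ (p, q)) $$ (c, d) * \<eta> q d)"
    unfolding \<xi>_def \<eta>_def
    by (intro sum.cong refl compress_pairing linear_to_mat_add[OF lin] linear_to_mat_scale[OF
        lin]) auto
  also have "\<dots> = (\<Sum>p<k. \<Sum>q<l. \<Sum>c<r. \<Sum>d<s. cnj (\<xi> p c) * \<phi> (y $$ (p, q)) $$ (c, d) * \<eta> q d)"
    by (rule sum_swap4)
  finally have eq: "(\<Sum>i<n. \<Sum>j<m. \<Sum>c<r. \<Sum>d<s. cnj (A c i) * \<phi> (z i j) $$ (c, d) * B d j)
      = (\<Sum>p<k. \<Sum>q<l. \<Sum>c<r. \<Sum>d<s. cnj (\<xi> p c) * \<phi> (y $$ (p, q)) $$ (c, d) * \<eta> q d)" .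
  show ?thesis
    unfolding corner_functional_def vd prod.case eq
    using le1 le2 CBall_pairing[OF \<phi> 1(1-4), of \<xi> \<eta>] by linarith
qed

lemma functional_corner_functional:
  assumes lin: "linear_to_mat scale r s \<phi>"
  shows "functional (corner_scale scale) (corner_functional n m r s A \<phi> B)"
proof -
  note [simp] = linear_to_mat_add[OF lin] linear_to_mat_scale[OF lin]
  have add: "(\<Sum>i<n. \<Sum>j<m. \<Sum>k<r. \<Sum>l<s. cnj (A k i) * \<phi> (z i j + z' i j) $$ (k, l) * B l j)
    = (\<Sum>i<n. \<Sum>j<m. \<Sum>k<r. \<Sum>l<s. cnj (A k i) * \<phi> (z i j) $$ (k, l) * B l j)
     + (\<Sum>i<n. \<Sum>j<m. \<Sum>k<r. \<Sum>l<s. cnj (A k i) * \<phi> (z' i j) $$ (k, l) * B l j)" for z z'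
    unfolding sum.distrib[symmetric] by (intro sum.cong refl) (simp add: algebra_simps)
  have scl: "(\<Sum>i<n. \<Sum>j<m. \<Sum>k<r. \<Sum>l<s. cnj (A k i) * \<phi> (scale t (z i j)) $$ (k, l) * B l j)
    = t * (\<Sum>i<n. \<Sum>j<m. \<Sum>k<r. \<Sum>l<s. cnj (A k i) * \<phi> (z i j) $$ (k, l) * B l j)" for t z
    unfolding sum_distrib_left by (intro sum.cong refl) simp
  have "corner_functional n m r s A \<phi> B (u + v)
      = corner_functional n m r s A \<phi> B u + corner_functional n m r s A \<phi> B v" for u v
    unfolding corner_functional_def split_beta fst_add snd_add plus_fun_apply quad_form_add add
      sum.distrib plus_complex.sel by simp
  moreover have "corner_functional n m r s A \<phi> B (corner_scale scale c v)
      = c * corner_functional n m r s A \<phi> B v" for c v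
    unfolding corner_functional_def corner_scale_def split_beta fst_conv snd_conv quad_form_scale
        scl
      sum_distrib_left[symmetric]
    by (simp add: algebra_simps)
  ultimately show ?thesis by (simp add: functional_def)
qed

end

section \<open>Coordinates of functionals and Gram matrices\<close>

definition single_entry :: "nat \<Rightarrow> nat \<Rightarrow> 'b::zero \<Rightarrow> nat \<Rightarrow> nat \<Rightarrow> 'b" where
  "single_entry i j c = (\<lambda>i' j'. if i' = i \<and> j' = j then c else 0)"

definition gram :: "nat \<Rightarrow> (nat \<Rightarrow> nat \<Rightarrow> complex) \<Rightarrow> nat \<Rightarrow> nat \<Rightarrow> complex" where
  "gram k \<alpha> i j = (\<Sum>p<k. cnj (\<alpha> p i) * \<alpha> p j)"

lemma sum_fun_apply: "(sum g (I :: nat set)) x = (\<Sum>i\<in>I. g i x)"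
  for g :: "nat \<Rightarrow> 'b \<Rightarrow> 'c::ab_group_add"
  by (induction I rule: infinite_finite_induct) simp_all

lemma additive_sum:
  fixes h :: "'b::ab_group_add \<Rightarrow> 'c::ab_group_add"
  assumes "\<And>u v. h (u + v) = h u + h v"
  shows "h (sum g (I :: nat set)) = (\<Sum>i\<in>I. h (g i))"
proof -
  have "h 0 = 0" using assms[of 0 0] by simp
  then show ?thesis by (induction I rule: infinite_finite_induct) (simp_all add: assms)
qed

lemma additive_entries:
  fixes h :: "(nat \<Rightarrow> nat \<Rightarrow> 'b::ab_group_add) \<Rightarrow> real"
  assumes add: "\<And>u v. h (u + v) = h u + h v"
    and cong: "\<And>a a'. (\<And>i j. i < n \<Longrightarrow> j < m \<Longrightarrow> a i j = a' i j) \<Longrightarrow> h a = h a'"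
  shows "h a = (\<Sum>i<n. \<Sum>j<m. h (single_entry i j (a i j)))"
proof -
  have "h a = h (\<Sum>i<n. \<Sum>j<m. single_entry i j (a i j))"
  proof (rule cong)
    fix i j assume ij: "i < n" "j < m"
    have "(\<Sum>i<n. \<Sum>j<m. single_entry i j (a i j)) i j
        = (\<Sum>i'<n. if i' = i then \<Sum>j'<m. if j' = j then a i' j' else 0 else 0)"
      unfolding sum_fun_apply by (intro sum.cong refl) (auto simp: single_entry_def intro!:
          sum.cong)
    then show "a i j = (\<Sum>i<n. \<Sum>j<m. single_entry i j (a i j)) i j" using ij by simp
  qed
  then show ?thesis by (simp add: additive_sum[of h, OF add])
qed

lemma quad_form_gram: "quad_form n (gram k \<alpha>) v = of_real (sqnorm k (apply_coeffs n \<alpha> v))"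
proof -
  have "quad_form n (gram k \<alpha>) v = (\<Sum>i<n. \<Sum>j<n. \<Sum>p<k. cnj (\<alpha> p i * v i) * (\<alpha> p j * v j))"
    by (simp add: quad_form_def gram_def sum_distrib_left sum_distrib_right mult_ac)
  also have "\<dots> = (\<Sum>i<n. \<Sum>p<k. \<Sum>j<n. cnj (\<alpha> p i * v i) * (\<alpha> p j * v j))"
    by (intro sum.cong refl sum.swap)
  also have "\<dots> = (\<Sum>p<k. \<Sum>i<n. \<Sum>j<n. cnj (\<alpha> p i * v i) * (\<alpha> p j * v j))" by (rule sum.swap)
  also have "\<dots> = (\<Sum>p<k. cnj (apply_coeffs n \<alpha> v p) * apply_coeffs n \<alpha> v p)"
    unfolding apply_coeffs_def cnj_sum sum_product ..
  finally show ?thesis by (simp add: sum_cnj_mult_self)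
qed

lemma sum_mult_gram: "(\<Sum>i<n. \<Sum>j<n. a i j * gram k \<alpha> i j) = (\<Sum>p<k. quad_form n a (\<alpha> p))"
proof -
  have "(\<Sum>i<n. \<Sum>j<n. a i j * gram k \<alpha> i j) = (\<Sum>i<n. \<Sum>j<n. \<Sum>p<k. cnj (\<alpha> p i) * a i j * \<alpha> p j)"
    by (simp add: gram_def sum_distrib_left mult_ac)
  also have "\<dots> = (\<Sum>i<n. \<Sum>p<k. \<Sum>j<n. cnj (\<alpha> p i) * a i j * \<alpha> p j)"
    by (intro sum.cong refl sum.swap)
  also have "\<dots> = (\<Sum>p<k. quad_form n a (\<alpha> p))"
    unfolding quad_form_def by (rule sum.swap)
  finally show ?thesis .
qed

lemma quad_form_cong:
  "(\<And>i j. i < n \<Longrightarrow> j < n \<Longrightarrow> a i j = b i j) \<Longrightarrow> quad_form n a v = quad_form n b v"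
  unfolding quad_form_def by (intro sum.cong refl) simp

lemma quad_form_adjoint: "quad_form n (\<lambda>i j. cnj (a j i)) v = cnj (quad_form n a v)"
proof -
  have "quad_form n (\<lambda>i j. cnj (a j i)) v = (\<Sum>j<n. \<Sum>i<n. cnj (v i) * cnj (a j i) * v j)"
    unfolding quad_form_def by (rule sum.swap)
  then show ?thesis by (simp add: quad_form_def mult_ac)
qed

lemma dominates_gram_self: "dominates_gram n (gram k \<alpha>) k \<alpha>"
  by (simp add: dominates_gram_def quad_form_gram)

lemma apply_right_inverse:
  assumes "\<And>k l. k < r \<Longrightarrow> l < r \<Longrightarrow> (\<Sum>i<n. A k i * R i l) = id_coeffs k l" "k < r"
  shows "apply_coeffs n A (\<lambda>i. \<Sum>a<r. R i a * c a) k = c k"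
proof -
  have "apply_coeffs n A (\<lambda>i. \<Sum>a<r. R i a * c a) k = (\<Sum>i<n. \<Sum>a<r. A k i * R i a * c a)"
    by (simp add: apply_coeffs_def sum_distrib_left mult_ac)
  also have "\<dots> = (\<Sum>a<r. (\<Sum>i<n. A k i * R i a) * c a)"
    unfolding sum_distrib_right by (rule sum.swap)
  also have "\<dots> = (\<Sum>a<r. id_coeffs k a * c a)" using assms by (intro sum.cong refl) simp
  finally show ?thesis by (simp add: sum_id_coeffs[OF assms(2)])
qed

context operator_space
begin

text \<open>A real-linear h is the real part of the complex-linear functional h(x) - i h(i
  x).\<close>

lemma complexify:
  fixes h :: "'a \<Rightarrow> real"
  assumes add: "\<And>x y. h (x + y) = h x + h y"
    and hom: "\<And>t x. h (scale (of_real t) x) = t * h x"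
  defines "g \<equiv> \<lambda>x. Complex (h x) (- h (scale \<i> x))"
  shows "g (x + y) = g x + g y" "g (scale c x) = c * g x"
proof -
  show "g (x + y) = g x + g y" by (simp add: g_def add scale_right_distrib complex_eq_iff)
  have h: "h (scale c x) = Re c * h x + Im c * h (scale \<i> x)" for c x
  proof -
    have "scale c x = scale (of_real (Re c)) x + scale (of_real (Im c)) (scale \<i> x)"
      using complex_eq[of c] by (simp add: mult.commute flip: scale_left_distrib)
    then show ?thesis by (simp only: add hom)
  qed
  have "h (scale \<i> (scale c x)) = Re c * h (scale \<i> x) + Im c * h (scale \<i> (scale \<i> x))"
    using h[of c "scale \<i> x"] by (simp add: mult.commute)
  also have "h (scale \<i> (scale \<i> x)) = - h x" using hom[of "- 1" x] by simp
  finally have "h (scale \<i> (scale c x)) = Re c * h (scale \<i> x) - Im c * h x" by simp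
  then show "g (scale c x) = c * g x" using h[of c x]
      by (simp add: g_def complex_eq_iff algebra_simps)
qed

section \<open>The shape of a positive functional\<close>

context
  fixes f :: "'a corner \<Rightarrow> real" and n m :: nat
  assumes f: "functional (corner_scale scale) f"
    and pos: "\<And>v. v \<in> corner_cone scale nrm n m \<Longrightarrow> 0 \<le> f v"
begin

lemma state_add: "f (u + v) = f u + f v"
  using f unfolding functional_def by blast

lemma state_scale: "f (corner_scale scale c v) = c * f v"
  using f unfolding functional_def by blast

text \<open>The difference of the two triples and its negative both lie in the cone, so f vanishes
  on it.\<close>

lemma state_cong:
  assumes "\<And>v. Re (quad_form n a v) = Re (quad_form n a' v)"
    "\<And>i j. i < n \<Longrightarrow> j < m \<Longrightarrow> z i j = z' i j"
    "\<And>v. Re (quad_form m b v) = Re (quad_form m b' v)"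
  shows "f (a, z, b) = f (a', z', b')"
proof -
  have "(a - a', z - z', b - b') \<in> corner_cone scale nrm n m"
    "(a' - a, z' - z, b' - b) \<in> corner_cone scale nrm n m"
    using assms by (auto intro!: corner_cone_zero_form simp: quad_form_diff)
  then have "0 \<le> f (a - a', z - z', b - b')" "0 \<le> f (a' - a, z' - z, b' - b)" using pos by auto
  moreover have "f (a, z, b) = f (a', z', b') + f (a - a', z - z', b - b')"
    "f (a', z', b') = f (a, z, b) + f (a' - a, z' - z, b' - b)"
    unfolding state_add[symmetric] by simp_all
  ultimately show ?thesis by linarith
qed

text \<open>A coefficient is read off from the values at a matrix unit and at i times it. The
  coefficients are Hermitian because c E_ij and its adjoint have forms with equal real parts, and
  semidefinite because h at the rank one Gram matrix of v is the form of p at v.\<close>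

lemma coeffs_of_form:
  fixes h :: "(nat \<Rightarrow> nat \<Rightarrow> complex) \<Rightarrow> real"
  assumes add: "\<And>u v. h (u + v) = h u + h v"
    and hom: "\<And>t u. h (\<lambda>i j. of_real t * u i j) = t * h u"
    and cong: "\<And>a a'. (\<And>v. Re (quad_form N a v) = Re (quad_form N a' v)) \<Longrightarrow> h a = h a'"
    and pos: "\<And>w. 0 \<le> h (gram 1 (\<lambda>_. w))"
  obtains p where "psd_coeffs N p" "\<And>a. h a = Re (\<Sum>i<N. \<Sum>j<N. p i j * a i j)"
proof -
  define p where "p i j = Complex (h (single_entry i j 1)) (- h (single_entry i j \<i>))" for i j
  have entry: "h (single_entry i j c) = Re (p i j * c)" for i j c
  proof -
    have "single_entry i j c = (\<lambda>k l. of_real (Re c) * single_entry i j 1 k l) + (\<lambda>k l. of_real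
        (Im c) * single_entry i j \<i> k l)"
      by (auto simp: single_entry_def fun_eq_iff complex_eq_iff)
    then have "h (single_entry i j c)
        = Re c * h (single_entry i j 1) + Im c * h (single_entry i j \<i>)"
      by (simp only: add hom)
    then show ?thesis by (simp add: p_def)
  qed
  have expand: "h a = Re (\<Sum>i<N. \<Sum>j<N. p i j * a i j)" for a
  proof -
    have "h a = (\<Sum>i<N. \<Sum>j<N. h (single_entry i j (a i j)))"
    proof (rule additive_entries[OF add])
      fix a a' :: "nat \<Rightarrow> nat \<Rightarrow> complex"
      assume "\<And>i j. i < N \<Longrightarrow> j < N \<Longrightarrow> a i j = a' i j"
      then show "h a = h a'" by (intro cong arg_cong[of _ _ Re] quad_form_cong) auto
    qed
    then show ?thesis by (simp add: entry)
  qed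
  have "psd_coeffs N p"
  proof
    fix i j
    have "Re (p i j * c) = Re (p j i * cnj c)" for c
    proof -
      have "h (single_entry i j c) = h (single_entry j i (cnj c))"
      proof (rule cong)
        fix v
        have "single_entry j i (cnj c) = (\<lambda>k l. cnj (single_entry i j c l k))"
          by (auto simp: single_entry_def fun_eq_iff)
        then show "Re (quad_form N (single_entry i j c) v)
            = Re (quad_form N (single_entry j i (cnj c)) v)"
          by (simp add: quad_form_adjoint)
      qed
      then show ?thesis by (simp add: entry)
    qed
    from this[of 1] this[of \<i>] show "p j i = cnj (p i j)" by (simp add: complex_eq_iff)
  next
    fix v
    have "0 \<le> h (gram 1 (\<lambda>_. v))" by (rule pos)
    then show "0 \<le> Re (quad_form N p v)" by (simp only: expand sum_mult_gram) simp
  qed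
  then show thesis using that expand by blast
qed

lemma state_components:
  obtains p q F where "psd_coeffs n p" "psd_coeffs m q"
    "\<And>i j x y. F i j (x + y) = F i j x + F i j y" "\<And>i j c x. F i j (scale c x) = c * F i j x"
    "\<And>a z b. f (a, z, b) = Re (\<Sum>i<n. \<Sum>j<n. p i j * a i j) + Re (\<Sum>i<m. \<Sum>j<m. q i j * b i j)
      + 2 * Re (\<Sum>i<n. \<Sum>j<m. F i j (z i j))"
proof -
  have cs: "corner_scale scale t (a, z, b)
      = (\<lambda>i j. of_real t * a i j, \<lambda>i j. scale (of_real t) (z i j), \<lambda>i j. of_real t * b i j)"
          for t a z b
    by (simp add: corner_scale_def)
  obtain p where p: "psd_coeffs n p" "\<And>a. f (a, 0, 0) = Re (\<Sum>i<n. \<Sum>j<n. p i j * a i j)"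
  proof (rule coeffs_of_form[of "\<lambda>a. f (a, 0, 0)" n])
    show "f (u + v, 0, 0) = f (u, 0, 0) + f (v, 0, 0)" for u v by (simp flip: state_add)
    show "f (\<lambda>i j. of_real t * u i j, 0, 0) = t * f (u, 0, 0)" for t u
      using state_scale[of t "(u, 0, 0)"] by (simp add: cs zero_fun_def)
    show "f (a, 0, 0) = f (a', 0, 0)" if "\<And>v. Re (quad_form n a v) = Re (quad_form n a' v)" for a a'
      using that by (intro state_cong) auto
    show "0 \<le> f (gram 1 (\<lambda>_. w), 0, 0)" for w
      by (intro pos corner_coneI[of 1 1 "0\<^sub>m 1 1" _ _ _ "\<lambda>_. w" _ _ "\<lambda>_ _. 0"] dominates_gram_self)
        (auto simp: nrm_zero compress_def dominates_gram_def quad_form_def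
            apply_coeffs_def[abs_def] sqnorm_def)
  qed blast
  obtain q where q: "psd_coeffs m q" "\<And>b. f (0, 0, b) = Re (\<Sum>i<m. \<Sum>j<m. q i j * b i j)"
  proof (rule coeffs_of_form[of "\<lambda>b. f (0, 0, b)" m])
    show "f (0, 0, u + v) = f (0, 0, u) + f (0, 0, v)" for u v by (simp flip: state_add)
    show "f (0, 0, \<lambda>i j. of_real t * u i j) = t * f (0, 0, u)" for t u
      using state_scale[of t "(0, 0, u)"] by (simp add: cs zero_fun_def)
    show "f (0, 0, a) = f (0, 0, a')" if "\<And>v. Re (quad_form m a v) = Re (quad_form m a' v)" for a a'
      using that by (intro state_cong) auto
    show "0 \<le> f (0, 0, gram 1 (\<lambda>_. w))" for w
      by (intro pos corner_coneI[of 1 1 "0\<^sub>m 1 1" _ _ _ "\<lambda>_ _. 0" _ _ "\<lambda>_. w"] dominates_gram_self)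
        (auto simp: nrm_zero compress_def dominates_gram_def quad_form_def
            apply_coeffs_def[abs_def] sqnorm_def)
  qed blast
  \<comment> \<open>Halved because the corner of f is to appear with the factor 2.\<close>
  define h where "h i j x = f (0, single_entry i j x, 0) / 2" for i j x
  define F where "F i j x = Complex (h i j x) (- h i j (scale \<i> x))" for i j x
  have hadd: "h i j (x + y) = h i j x + h i j y" for i j x y
  proof -
    have "single_entry i j (x + y) = single_entry i j x + single_entry i j y"
      by (auto simp: single_entry_def fun_eq_iff)
    then show ?thesis by (simp add: h_def add_divide_distrib flip: state_add)
  qed
  have hhom: "h i j (scale (of_real t) x) = t * h i j x" for i j t x
  proof -
    have "single_entry i j (scale (of_real t) x)
        = (\<lambda>k l. scale (of_real t) (single_entry i j x k l))"
      by (auto simp: single_entry_def fun_eq_iff)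
    then show ?thesis
      using state_scale[of t "(0, single_entry i j x, 0)"] by (simp add: h_def cs zero_fun_def)
  qed
  have F: "F i j (x + y) = F i j x + F i j y" "F i j (scale c x) = c * F i j x" for i j c x y
    unfolding F_def by (rule complexify; rule hadd hhom)+
  have F0: "f (0, z, 0) = 2 * Re (\<Sum>i<n. \<Sum>j<m. F i j (z i j))" for z
  proof -
    have "f (0, z, 0) = (\<Sum>i<n. \<Sum>j<m. f (0, single_entry i j (z i j), 0))"
      by (rule additive_entries[of "\<lambda>z. f (0, z, 0)"]) (auto intro: state_cong simp flip: state_add)
    then show ?thesis by (simp add: F_def h_def sum_distrib_left)
  qed
  have split: "f (a, z, b) = f (a, 0, 0) + f (0, 0, b) + f (0, z, 0)" for a z b
    unfolding state_add[symmetric] by simp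
  have "f (a, z, b) = Re (\<Sum>i<n. \<Sum>j<n. p i j * a i j) + Re (\<Sum>i<m. \<Sum>j<m. q i j * b i j)
      + 2 * Re (\<Sum>i<n. \<Sum>j<m. F i j (z i j))" for a z b
    using split[of a z b] by (simp only: p(2) q(2) F0)
  then show thesis by (rule that[OF p(1) q(1) F(1) F(2)])
qed

text \<open>The diagonal coefficients factor as A^* A and B^* B. Positivity forces the corner form
  to vanish on the kernels of A and B, so it descends to a map \<phi> into r by s matrices, written
  with the right inverses as R^* F S. Complete contractivity of \<phi> is positivity of f at triples
  whose coefficients are R \<xi> and S \<eta>.\<close>

lemma state_representation:
  obtains r s A R B S \<phi> where "r \<le> n" "s \<le> m" "\<phi> \<in> CBall scale nrm r s"
    "\<And>k l. k < r \<Longrightarrow> l < r \<Longrightarrow> (\<Sum>i<n. A k i * R i l) = id_coeffs k l"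
    "\<And>k l. k < s \<Longrightarrow> l < s \<Longrightarrow> (\<Sum>i<m. B k i * S i l) = id_coeffs k l"
    "f = corner_functional n m r s A \<phi> B"
proof -
  obtain p q F where p: "psd_coeffs n p" and q: "psd_coeffs m q"
    and F: "\<And>i j x y. F i j (x + y) = F i j x + F i j y" "\<And>i j c x. F i j (scale c x) = c * F i j x"
    and feq: "\<And>a z b. f (a, z, b) = Re (\<Sum>i<n. \<Sum>j<n. p i j * a i j) + Re (\<Sum>i<m. \<Sum>j<m. q i j * b i j)
      + 2 * Re (\<Sum>i<n. \<Sum>j<m. F i j (z i j))"
    by (rule state_components) blast
  have card: "card {i. i < N \<and> P i} \<le> N" for N :: nat and P
    using card_mono[of "{..<N}" "{i. i < N \<and> P i}"] by auto
  obtain r A R where r': "r \<le> card {i. i < n \<and> p i i \<noteq> 0}"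
    and A: "\<And>i j. i < n \<Longrightarrow> j < n \<Longrightarrow> p i j = gram r A i j"
    and R: "\<And>k l. k < r \<Longrightarrow> l < r \<Longrightarrow> (\<Sum>i<n. A k i * R i l) = id_coeffs k l"
    using psd_coeffs_factor[OF p] unfolding gram_def[symmetric] by blast
  have r: "r \<le> n" by (rule order_trans[OF r' card])
  obtain s B S where s': "s \<le> card {i. i < m \<and> q i i \<noteq> 0}"
    and B: "\<And>i j. i < m \<Longrightarrow> j < m \<Longrightarrow> q i j = gram s B i j"
    and S: "\<And>k l. k < s \<Longrightarrow> l < s \<Longrightarrow> (\<Sum>i<m. B k i * S i l) = id_coeffs k l"
    using psd_coeffs_factor[OF q] unfolding gram_def[symmetric] by blast
  have s: "s \<le> m" by (rule order_trans[OF s' card])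
  have pq: "quad_form n p u = of_real (sqnorm r (apply_coeffs n A u))"
    "quad_form m q w = of_real (sqnorm s (apply_coeffs m B w))" for u w
    using quad_form_cong[OF A, where v = u] quad_form_cong[OF B, where v = w]
        by (simp_all add: quad_form_gram)
  define H where "H u w x = (\<Sum>i<n. \<Sum>j<m. cnj (u i) * F i j x * w j)" for u w x
  have Hadd: "H u w (x + y) = H u w x + H u w y" for u w x y
    by (simp add: H_def F algebra_simps sum.distrib)
  have Hscale: "H u w (scale c x) = c * H u w x" for u w c x
    by (simp add: H_def F sum_distrib_left mult_ac)
  have Hu: "H (\<lambda>i. c * u i) w x = cnj c * H u w x" "H u (\<lambda>j. c * w j) x = c * H u w x" for c u w x
    by (simp_all add: H_def sum_distrib_left mult_ac)
  have Hdiff: "H (\<lambda>i. u i - u' i) w x = H u w x - H u' w x" "H u (\<lambda>j. w j - w' j) x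
      = H u w x - H u w' x" for u u' w w' x
    by (simp_all add: H_def algebra_simps sum_subtractf)
  \<comment> \<open>Positivity of f at the triple with corner \<alpha>^* y \<beta> and the smallest
    possible diagonal, the Gram matrices of \<alpha> and \<beta>.\<close>
  have key: "0 \<le> (\<Sum>p<k. sqnorm r (apply_coeffs n A (\<alpha> p))) + (\<Sum>q<l. sqnorm s (apply_coeffs m B (\<beta>
      q)))
      + 2 * Re (\<Sum>p<k. \<Sum>q<l. H (\<alpha> p) (\<beta> q) (y $$ (p, q)))"
    if kl: "1 \<le> k" "1 \<le> l" "y \<in> carrier_mat k l" "nrm y \<le> 1" for k l \<alpha> \<beta> y
  proof -
    have "(gram k \<alpha>, compress scale k l \<alpha> y \<beta>, gram l \<beta>) \<in> corner_cone scale nrm n m"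
      by (rule corner_coneI[where nrm = nrm and k = k and l = l and y = y and \<alpha> = \<alpha> and \<beta> = \<beta>])
        (use kl dominates_gram_self in auto)
    then have "0 \<le> f (gram k \<alpha>, compress scale k l \<alpha> y \<beta>, gram l \<beta>)" by (rule pos)
    moreover have "(\<Sum>i<n. \<Sum>j<m. F i j (compress scale k l \<alpha> y \<beta> i j))
        = (\<Sum>p<k. \<Sum>q<l. H (\<alpha> p) (\<beta> q) (y $$ (p, q)))"
    proof -
      have "(\<Sum>i<n. \<Sum>j<m. F i j (compress scale k l \<alpha> y \<beta> i j))
          = (\<Sum>i<n. \<Sum>j<m. \<Sum>p<k. \<Sum>q<l. cnj (\<alpha> p i) * F i j (y $$ (p, q)) * \<beta> q j)"
        by (simp add: compress_def additive_sum[of "F _ _", OF F(1)] F(2) mult_ac)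
      then show ?thesis unfolding H_def by (subst (asm) sum_swap4)
    qed
    ultimately show ?thesis by (simp add: feq sum_mult_gram pq)
  qed
  \<comment> \<open>Scaling a kernel vector costs nothing on the diagonal while the cross term
    scales along. A negative multiple aligned with h makes 2 t |h|^2 bounded in t, hence h =
    0.\<close>
  have kernel: "H u w x = 0"
    if z: "(\<forall>k<r. apply_coeffs n A u k = 0) \<or> (\<forall>k<s. apply_coeffs m B w k = 0)" for u w x
  proof -
    \<comment> \<open>x is scaled to norm below 1 as a 1 by 1 matrix; the added 1 avoids dividing by
      0.\<close>
    define N where "N = nrm (mat 1 1 (\<lambda>_. x)) + 1"
    have N: "1 \<le> N" using nrm_nonneg[of 1 1 "mat 1 1 (\<lambda>_. x)"] by (simp add: N_def)
    define x' where "x' = scale (of_real (1 / N)) x"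
    define y where "y = mat 1 1 (\<lambda>_. x')"
    have y: "y \<in> carrier_mat 1 1" by (simp add: y_def)
    have "y = map_mat (scale (of_real (1 / N))) (mat 1 1 (\<lambda>_. x))" by (auto simp: y_def x'_def)
    then have "nrm y = cmod (of_real (1 / N)) * nrm (mat 1 1 (\<lambda>_. x))"
      by (simp only: nrm_scale[of 1 1 "mat 1 1 (\<lambda>_. x)"] mat_carrier order_refl)
    also have "\<dots> = nrm (mat 1 1 (\<lambda>_. x)) / N" using N by (simp only: norm_of_real) simp
    finally have ny: "nrm y \<le> 1" using N by (simp add: N_def)
    define h where "h = H u w x'"
    have key1: "0 \<le> sqnorm r (apply_coeffs n A u') + sqnorm s (apply_coeffs m B w') + 2 * Re (H u'
        w' x')" for u' w'
      using key[OF _ _ y ny, of "\<lambda>_. u'" "\<lambda>_. w'"] by (simp add: y_def)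
    have null: "sqnorm M (apply_coeffs N K (\<lambda>i. c * v i)) = 0" if "\<forall>k<M. apply_coeffs N K v k = 0"
        for M N K c v
    proof -
      have "apply_coeffs N K (\<lambda>i. c * v i) = (\<lambda>k. c * apply_coeffs N K v k)"
        by (rule ext) (simp add: apply_coeffs_def sum_distrib_left mult_ac)
      then show ?thesis using that by (simp add: sqnorm_def)
    qed
    have "\<exists>Q. \<forall>t\<ge>0. 2 * t * (cmod h)\<^sup>2 \<le> Q"
    proof (cases "\<forall>k<r. apply_coeffs n A u k = 0")
      case True
      have "2 * t * (cmod h)\<^sup>2 \<le> sqnorm s (apply_coeffs m B w)" for t
      proof -
        have "Re (cnj (- of_real t * h) * h) = - (t * (cmod h)\<^sup>2)"
          unfolding cmod_power2 by (simp add: power2_eq_square algebra_simps)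
        then show ?thesis
          using key1[of "\<lambda>i. (- of_real t * h) * u i" w]
          unfolding Hu h_def[symmetric] null[OF True] by linarith
      qed
      then show ?thesis by blast
    next
      case False
      then have w: "\<forall>k<s. apply_coeffs m B w k = 0" using z by blast
      have "2 * t * (cmod h)\<^sup>2 \<le> sqnorm r (apply_coeffs n A u)" for t
      proof -
        have "Re ((- of_real t * cnj h) * h) = - (t * (cmod h)\<^sup>2)"
          unfolding cmod_power2 by (simp add: power2_eq_square algebra_simps)
        then show ?thesis
          using key1[of u "\<lambda>i. (- of_real t * cnj h) * w i"]
          unfolding Hu h_def[symmetric] null[OF w] by linarith
      qed
      then show ?thesis by blast
    qed
    then have "(cmod h)\<^sup>2 = 0" using quadratic_nonneg_imp_zero[of "(cmod h)\<^sup>2"] by auto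
    then have "h = 0" by simp
    then show ?thesis using N by (simp add: h_def x'_def Hscale)
  qed
  define \<phi> where "\<phi> x = mat r s (\<lambda>(a, c). H (\<lambda>i. R i a) (\<lambda>j. S j c) x)" for x
  have Hsum: "H (\<lambda>i. \<Sum>a<r. R i a * \<xi> a) (\<lambda>j. \<Sum>c<s. S j c * \<eta> c) x
      = (\<Sum>a<r. \<Sum>c<s. cnj (\<xi> a) * \<phi> x $$ (a, c) * \<eta> c)" for \<xi> \<eta> x
  proof -
    have "H (\<lambda>i. \<Sum>a<r. R i a * \<xi> a) (\<lambda>j. \<Sum>c<s. S j c * \<eta> c) x
        = (\<Sum>i<n. \<Sum>j<m. \<Sum>a<r. \<Sum>c<s. cnj (\<xi> a) * (cnj (R i a) * F i j x * S j c) * \<eta> c)"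
      unfolding H_def by (simp add: sum_distrib_left sum_distrib_right mult_ac sum.swap[of _
          "{..<s}" "{..<r}"])
    also have "\<dots> = (\<Sum>a<r. \<Sum>c<s. \<Sum>i<n. \<Sum>j<m. cnj (\<xi> a) * (cnj (R i a) * F i j x * S j c) * \<eta> c)"
      by (rule sum_swap4)
    also have "\<dots> = (\<Sum>a<r. \<Sum>c<s. cnj (\<xi> a) * \<phi> x $$ (a, c) * \<eta> c)"
      by (intro sum.cong refl) (simp add: \<phi>_def H_def sum_distrib_left sum_distrib_right)
    finally show ?thesis .
  qed
  \<comment> \<open>u and R A u have the same image under A, so by \<open>kernel\<close> the form
    does not distinguish them; likewise w and S B w.\<close>
  have Hproj: "H u w x = (\<Sum>a<r. \<Sum>c<s. cnj (apply_coeffs n A u a) * \<phi> x $$ (a, c) * apply_coeffs m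
      B w c)" for u w x
  proof -
    define u' where "u' i = (\<Sum>a<r. R i a * apply_coeffs n A u a)" for i
    define w' where "w' j = (\<Sum>c<s. S j c * apply_coeffs m B w c)" for j
    have "apply_coeffs n A (\<lambda>i. u i - u' i) k = 0" if "k < r" for k
      using apply_right_inverse[OF R that, where c = "apply_coeffs n A u"]
      unfolding u'_def by (simp add: apply_coeffs_def right_diff_distrib sum_subtractf)
    then have "H u w x = H u' w x" using kernel[of "\<lambda>i. u i - u' i" w x] by (simp add: Hdiff)
    also have "apply_coeffs m B (\<lambda>i. w i - w' i) k = 0" if "k < s" for k
      using apply_right_inverse[OF S that, where c = "apply_coeffs m B w"]
      unfolding w'_def by (simp add: apply_coeffs_def right_diff_distrib sum_subtractf)
    then have "H u' w x = H u' w' x"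
        using kernel[of "\<lambda>i. w i - w' i" u' x] kernel[of u' "\<lambda>i. w i - w' i" x] by (simp add: Hdiff)
    finally show ?thesis unfolding u'_def w'_def Hsum .
  qed
  have FA: "F i j x = (\<Sum>a<r. \<Sum>c<s. cnj (A a i) * \<phi> x $$ (a, c) * B c j)" if ij: "i < n" "j < m"
      for i j x
  proof -
    have "F i j x = H (id_coeffs i) (id_coeffs j) x"
      using ij by (simp add: H_def sum_id_coeffs mult.assoc flip: sum_distrib_left)
    then show ?thesis unfolding Hproj using ij by (simp add: apply_coeffs_def sum_id_coeffs)
  qed
  have lin: "linear_to_mat scale r s \<phi>"
    unfolding linear_to_mat_def \<phi>_def by (auto simp: Hadd Hscale)
  have "op_norm (amplify r s \<phi> y) \<le> nrm y" if kl: "1 \<le> k" "1 \<le> l" "y \<in> carrier_mat k l" for k l y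
  proof (rule op_norm_leI[OF amplify_carrier[OF kl(3)] nrm_nonneg[OF kl]])
    fix \<xi>' \<eta>' :: "nat \<Rightarrow> complex"
    define \<xi> where "\<xi> p a = \<xi>' (p * r + a)" for p a
    define \<eta> where "\<eta> q c = \<eta>' (q * s + c)" for q c
    have xe: "\<xi>' = (\<lambda>t. \<xi> (t div r) (t mod r))" "\<eta>' = (\<lambda>t. \<eta> (t div s) (t mod s))"
      by (auto simp: \<xi>_def \<eta>_def)
    let ?P = "\<lambda>y. \<Sum>p<k. \<Sum>q<l. \<Sum>a<r. \<Sum>c<s. cnj (\<xi> p a) * \<phi> (y $$ (p, q)) $$ (a, c) * \<eta> q c"
    let ?X = "(\<Sum>p<k. sqnorm r (\<xi> p)) + (\<Sum>q<l. sqnorm s (\<eta> q))"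
    \<comment> \<open>Positivity at the vectors -R \<xi> and S \<eta>: as A R = 1 and B S = 1, the
      diagonal terms are the squared norms of \<xi> and \<eta>, and the sign produces an upper
      bound.\<close>
    have P: "2 * Re (?P y) \<le> ?X" if y: "y \<in> carrier_mat k l" "nrm y \<le> 1" for y
    proof -
      have "(\<Sum>p<k. sqnorm r (apply_coeffs n A (\<lambda>i. \<Sum>a<r. R i a * - \<xi> p a)))
          = (\<Sum>p<k. sqnorm r (\<xi> p))"
        unfolding sqnorm_def by (intro sum.cong refl) (simp only: lessThan_iff
            apply_right_inverse[OF R], simp)
      moreover have "(\<Sum>q<l. sqnorm s (apply_coeffs m B (\<lambda>i. \<Sum>a<s. S i a * \<eta> q a)))
          = (\<Sum>q<l. sqnorm s (\<eta> q))"
        unfolding sqnorm_def by (intro sum.cong refl) (simp only: lessThan_iff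
            apply_right_inverse[OF S])
      moreover have "(\<Sum>p<k. \<Sum>q<l. H (\<lambda>i. \<Sum>a<r. R i a * - \<xi> p a) (\<lambda>i. \<Sum>a<s. S i a * \<eta> q a) (y $$
          (p, q))) = - ?P y"
        unfolding Hsum by (simp add: sum_negf)
      ultimately show ?thesis
        using key[OF kl(1,2) y, of "\<lambda>p i. \<Sum>a<r. R i a * - \<xi> p a" "\<lambda>q i. \<Sum>a<s. S i a * \<eta> q a"]
            by simp
    qed
    \<comment> \<open>The estimate on the unit ball extends by homogeneity; norm 0 is separate since
      it excludes dividing by the norm.\<close>
    have "2 * Re (?P y) \<le> nrm y * ?X"
    proof (cases "nrm y = 0")
      case True
      then have "y = 0\<^sub>m k l" using nrm_eq_0_iff kl by blast
      then have "?P y = 0" by (simp add: linear_to_mat_zero[OF lin])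
      then show ?thesis using True by simp
    next
      case False
      define t where "t = nrm y"
      have t: "0 < t" using False nrm_nonneg[OF kl] by (simp add: t_def)
      define y' where "y' = map_mat (scale (of_real (1 / t))) y"
      have y': "y' \<in> carrier_mat k l" using kl by (simp add: y'_def)
      have "nrm y' = cmod (of_real (1 / t)) * nrm y" unfolding y'_def by (rule nrm_scale[OF kl])
      then have "nrm y' \<le> 1" using t by (simp only: norm_of_real t_def) simp
      then have le: "2 * Re (?P y') \<le> ?X" by (rule P[OF y'])
      have "?P y' = of_real (1 / t) * ?P y"
        using kl(3) unfolding sum_distrib_left y'_def
        by (intro sum.cong refl) (simp add: linear_to_mat_scale[OF lin])
      then have "Re (?P y') = Re (?P y) / t"
          by (simp only: Re_complex_of_real times_complex.sel Im_complex_of_real) simp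
      moreover have "2 * a \<le> t * X" if "b = a / t" "2 * b \<le> X" for a b X :: real
        using mult_right_mono[OF that(2), of t] that(1) t by (simp add: field_simps)
      ultimately have "2 * Re (?P y) \<le> t * ?X" using le by blast
      then show ?thesis by (simp add: t_def)
    qed
    then show "2 * Re (\<Sum>p<k * r. \<Sum>q<l * s. cnj (\<xi>' p) * amplify r s \<phi> y $$ (p, q) * \<eta>' q)
        \<le> nrm y * (sqnorm (k * r) \<xi>' + sqnorm (l * s) \<eta>')"
      unfolding xe amplify_pairing[OF kl(3)] sqnorm_blocks .
  qed
  then have cb: "\<phi> \<in> CBall scale nrm r s" using lin
      by (auto simp: CBall_def completely_contractive_def)
  have "f (a, z, b) = corner_functional n m r s A \<phi> B (a, z, b)" for a z b
  proof -
    have "(\<Sum>i<n. \<Sum>j<n. p i j * a i j) = (\<Sum>i<n. \<Sum>j<n. a i j * gram r A i j)"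
      using A by (intro sum.cong refl) simp
    moreover have "(\<Sum>i<m. \<Sum>j<m. q i j * b i j) = (\<Sum>i<m. \<Sum>j<m. b i j * gram s B i j)"
      using B by (intro sum.cong refl) simp
    moreover have "(\<Sum>i<n. \<Sum>j<m. F i j (z i j))
        = (\<Sum>i<n. \<Sum>j<m. \<Sum>a<r. \<Sum>c<s. cnj (A a i) * \<phi> (z i j) $$ (a, c) * B c j)"
      using FA by (intro sum.cong refl) simp
    ultimately show ?thesis unfolding feq corner_functional_def prod.case
        by (simp only: sum_mult_gram)
  qed
  then have "f = corner_functional n m r s A \<phi> B" by (auto simp: fun_eq_iff)
  then show thesis using that[OF r s cb R S] by blast
qed

end
end

section \<open>Extremality of the representing maps\<close>

lemma mat_adjoint_smult: "mat_adjoint (c \<cdot>\<^sub>m A) = cnj c \<cdot>\<^sub>m mat_adjoint (A :: complex mat)"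
  by (intro eq_matI) auto

lemma mat_adjoint_one [simp]: "mat_adjoint (1\<^sub>m n) = (1\<^sub>m n :: complex mat)"
  by (intro eq_matI) auto

lemma sandwich_entry:
  fixes A :: "complex mat"
  assumes A: "A \<in> carrier_mat r n" and M: "M \<in> carrier_mat r s" and B: "B \<in> carrier_mat s m"
    and ij: "i < n" "j < m"
  shows "(mat_adjoint A * M * B) $$ (i, j)
      = (\<Sum>k<r. \<Sum>l<s. cnj (A $$ (k, i)) * M $$ (k, l) * B $$ (l, j))"
proof -
  note A' = mat_adjoint_carrier[OF A]
  have "(mat_adjoint A * M * B) $$ (i, j) = (\<Sum>l<s. (mat_adjoint A * M) $$ (i, l) * B $$ (l, j))"
    by (rule mat_mult_index_sum[OF mult_carrier_mat[OF A' M] B ij])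
  also have "\<dots> = (\<Sum>l<s. \<Sum>k<r. cnj (A $$ (k, i)) * M $$ (k, l) * B $$ (l, j))"
  proof (intro sum.cong refl)
    fix l assume "l \<in> {..<s}"
    then have "(mat_adjoint A * M) $$ (i, l) = (\<Sum>k<r. mat_adjoint A $$ (i, k) * M $$ (k, l))"
      by (intro mat_mult_index_sum[OF A' M ij(1)]) simp
    also have "\<dots> = (\<Sum>k<r. cnj (A $$ (k, i)) * M $$ (k, l))"
      using A ij by (intro sum.cong refl) simp
    finally show "(mat_adjoint A * M) $$ (i, l) * B $$ (l, j)
        = (\<Sum>k<r. cnj (A $$ (k, i)) * M $$ (k, l) * B $$ (l, j))"
      by (simp add: sum_distrib_right)
  qed
  also have "\<dots> = (\<Sum>k<r. \<Sum>l<s. cnj (A $$ (k, i)) * M $$ (k, l) * B $$ (l, j))" by (rule sum.swap)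
  finally show ?thesis .
qed

lemma gram_entry:
  fixes A :: "complex mat"
  assumes A: "A \<in> carrier_mat r n" and ij: "i < n" "j < n"
  shows "(mat_adjoint A * A) $$ (i, j) = gram r (\<lambda>k i. A $$ (k, i)) i j"
  using ij A unfolding gram_def mat_mult_index_sum[OF mat_adjoint_carrier[OF A] A ij]
  by (intro sum.cong refl) simp

lemma sandwich_assoc:
  fixes A :: "complex mat"
  assumes "A \<in> carrier_mat r n" "\<alpha> \<in> carrier_mat \<rho> r" "M \<in> carrier_mat \<rho> \<sigma>"
    "\<beta> \<in> carrier_mat \<sigma> s" "B \<in> carrier_mat s m"
  shows "mat_adjoint (\<alpha> * A) * M * (\<beta> * B) = mat_adjoint A * (mat_adjoint \<alpha> * M * \<beta>) * B"
proof -
  have c: "mat_adjoint A \<in> carrier_mat n r" "mat_adjoint \<alpha> \<in> carrier_mat r \<rho>" using assms by auto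
  have "mat_adjoint (\<alpha> * A) * M * (\<beta> * B) = mat_adjoint A * mat_adjoint \<alpha> * M * (\<beta> * B)"
    using assms by (simp add: mat_adjoint_mult)
  also have "\<dots> = mat_adjoint A * (mat_adjoint \<alpha> * M) * (\<beta> * B)"
    by (simp add: assoc_mult_mat[OF c assms(3)])
  also have "\<dots> = mat_adjoint A * (mat_adjoint \<alpha> * M) * \<beta> * B"
    by (rule assoc_mult_mat[symmetric, of _ n \<sigma> _ s _ m]) (use assms c in auto)
  also have "mat_adjoint A * (mat_adjoint \<alpha> * M) * \<beta> = mat_adjoint A * (mat_adjoint \<alpha> * M * \<beta>)"
    by (rule assoc_mult_mat[of _ n r _ \<sigma> _ s]) (use assms c in auto)
  finally show ?thesis .
qed

lemma sandwich_msum: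
  fixes A :: "complex mat"
  assumes A: "A \<in> carrier_mat r n" and M: "\<And>t. t < l
      \<Longrightarrow> M t \<in> carrier_mat r s" and B: "B \<in> carrier_mat s m"
    and ij: "i < n" "j < m"
  shows "(\<Sum>t<l. (mat_adjoint A * M t * B) $$ (i, j)) = (mat_adjoint A * msum r s l M * B) $$ (i, j)"
proof -
  have S: "msum r s l M \<in> carrier_mat r s" by (simp add: msum_def)
  have "(\<Sum>t<l. (mat_adjoint A * M t * B) $$ (i, j))
      = (\<Sum>t<l. \<Sum>k<r. \<Sum>c<s. cnj (A $$ (k, i)) * M t $$ (k, c) * B $$ (c, j))"
    by (intro sum.cong refl sandwich_entry[OF A M B ij]) simp
  also have "\<dots> = (\<Sum>k<r. \<Sum>t<l. \<Sum>c<s. cnj (A $$ (k, i)) * M t $$ (k, c) * B $$ (c, j))"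
    by (rule sum.swap)
  also have "\<dots> = (\<Sum>k<r. \<Sum>c<s. \<Sum>t<l. cnj (A $$ (k, i)) * M t $$ (k, c) * B $$ (c, j))"
    by (intro sum.cong refl sum.swap)
  also have "\<dots> = (\<Sum>k<r. \<Sum>c<s. cnj (A $$ (k, i)) * msum r s l M $$ (k, c) * B $$ (c, j))"
    by (intro sum.cong refl) (simp add: msum_def sum_distrib_left sum_distrib_right)
  finally show ?thesis using sandwich_entry[OF A S B ij] by simp
qed

text \<open>Multiplication by R^* on the left and by S on the right recovers the middle
  factor.\<close>

lemma sandwich_cancel:
  fixes A :: "complex mat"
  assumes A: "A \<in> carrier_mat r n" "R \<in> carrier_mat n r" "A * R = 1\<^sub>m r"
    and B: "B \<in> carrier_mat s m" "S \<in> carrier_mat m s" "B * S = 1\<^sub>m s"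
    and MN: "M \<in> carrier_mat r s" "N \<in> carrier_mat r s"
    and eq: "mat_adjoint A * M * B = mat_adjoint A * N * B"
  shows "M = N"
proof -
  have "mat_adjoint R * (mat_adjoint A * M * B) * S = M" if M: "M \<in> carrier_mat r s" for M
  proof -
    have "mat_adjoint R * (mat_adjoint A * M * B) * S = mat_adjoint (A * R) * M * (B * S)"
    proof -
      have "mat_adjoint R * (mat_adjoint A * M * B) * S = mat_adjoint (A * R) * M * B * S"
        using sandwich_assoc[OF A(2,1) M B(1), of "1\<^sub>m m" m] A B M
        by (simp add: mat_adjoint_mult[OF A(1,2)] right_mult_one_mat[of _ r m]
            right_mult_one_mat[of _ s m])
      also have "\<dots> = mat_adjoint (A * R) * M * (B * S)"
        by (rule assoc_mult_mat[of _ r s _ m _ s]) (use A B M in auto)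
      finally show ?thesis .
    qed
    then show ?thesis using M by (simp add: A(3) B(3))
  qed
  then show ?thesis using MN eq by metis
qed

text \<open>With a right inverse X, \<alpha>^* = \<alpha>^* \<alpha> X = c X, and so \<alpha>
  \<alpha>^* = c 1. If c were 0, then \<alpha> would be 0, which is impossible with \<rho> \<ge> 1
  rows.\<close>

lemma scaled_coisometry:
  fixes \<alpha> :: "complex mat"
  assumes \<alpha>: "\<alpha> \<in> carrier_mat \<rho> r" and \<rho>: "1 \<le> \<rho>" and inv: "right_invertible_mat \<alpha>"
    and eq: "mat_adjoint \<alpha> * \<alpha> = c \<cdot>\<^sub>m 1\<^sub>m r"
  shows "c \<noteq> 0" "\<rho> = r" "\<alpha> * mat_adjoint \<alpha> = c \<cdot>\<^sub>m 1\<^sub>m \<rho>"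
proof -
  note \<alpha>' = mat_adjoint_carrier[OF \<alpha>]
  obtain X where X: "X \<in> carrier_mat r \<rho>" "\<alpha> * X = 1\<^sub>m \<rho>"
    using inv \<alpha> by (auto simp: right_invertible_mat_def inverts_mat_def)
  have "mat_adjoint \<alpha> = mat_adjoint \<alpha> * (\<alpha> * X)" unfolding X(2) using right_mult_one_mat[OF \<alpha>']
      by simp
  also have "\<dots> = (c \<cdot>\<^sub>m 1\<^sub>m r) * X" using assoc_mult_mat[OF \<alpha>' \<alpha> X(1)] by (simp add: eq)
  also have "\<dots> = c \<cdot>\<^sub>m X" using X(1) by (simp add: mult_smult_assoc_mat[of _ r r])
  finally have adj: "mat_adjoint \<alpha> = c \<cdot>\<^sub>m X" .
  then show co: "\<alpha> * mat_adjoint \<alpha> = c \<cdot>\<^sub>m 1\<^sub>m \<rho>"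
    using mult_smult_distrib[OF \<alpha> X(1)] X(2) by simp
  show c: "c \<noteq> 0"
  proof
    assume "c = 0"
    then have "\<alpha> = mat_adjoint (0 \<cdot>\<^sub>m X)" using adj by (metis mat_adjoint_adjoint)
    then have "\<alpha> = 0\<^sub>m \<rho> r" using X(1) by (auto simp: mat_adjoint_smult)
    then have "(1\<^sub>m \<rho> :: complex mat) = 0\<^sub>m \<rho> \<rho>" using X by simp
    then have "(1\<^sub>m \<rho> :: complex mat) $$ (0, 0) = 0\<^sub>m \<rho> \<rho> $$ (0, 0)" by simp
    then show False using \<rho> by simp
  qed
  \<comment> \<open>The two products have the same trace, c \<rho> and c r.\<close>
  have "(\<Sum>p<\<rho>. (\<alpha> * mat_adjoint \<alpha>) $$ (p, p)) = (\<Sum>p<\<rho>. \<Sum>k<r. \<alpha> $$ (p, k) * mat_adjoint \<alpha> $$ (k, p))"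
    by (intro sum.cong refl mat_mult_index_sum[OF \<alpha> \<alpha>']) auto
  also have "\<dots> = (\<Sum>k<r. \<Sum>p<\<rho>. mat_adjoint \<alpha> $$ (k, p) * \<alpha> $$ (p, k))"
    by (subst sum.swap) (simp add: mult.commute)
  also have "\<dots> = (\<Sum>k<r. (mat_adjoint \<alpha> * \<alpha>) $$ (k, k))"
    by (intro sum.cong refl mat_mult_index_sum[OF \<alpha>' \<alpha>, symmetric]) auto
  finally have "of_nat \<rho> * c = of_nat r * c" by (simp add: eq co)
  then show "\<rho> = r" using c by simp
qed

context operator_space
begin

lemma corner_functional_sandwich:
  assumes "linear_to_mat scale r s \<phi>" and A: "A \<in> carrier_mat r n" and B: "B \<in> carrier_mat s m"
  shows "corner_functional n m r s (\<lambda>k i. A $$ (k, i)) \<phi> (\<lambda>l j. B $$ (l, j)) (a, z, b)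
    = Re (\<Sum>i<n. \<Sum>j<n. a i j * (mat_adjoint A * A) $$ (i, j))
    + Re (\<Sum>i<m. \<Sum>j<m. b i j * (mat_adjoint B * B) $$ (i, j))
    + 2 * Re (\<Sum>i<n. \<Sum>j<m. (mat_adjoint A * \<phi> (z i j) * B) $$ (i, j))"
proof -
  have \<phi>: "\<phi> x \<in> carrier_mat r s" for x using assms(1) by (simp add: linear_to_mat_def)
  have "(\<Sum>i<n. \<Sum>j<n. a i j * (mat_adjoint A * A) $$ (i, j))
      = (\<Sum>k<r. quad_form n a (\<lambda>i. A $$ (k, i)))"
    unfolding sum_mult_gram[symmetric]
        by (intro sum.cong refl) (simp add: gram_entry[OF A] del: index_mult_mat)
  moreover have "(\<Sum>i<m. \<Sum>j<m. b i j * (mat_adjoint B * B) $$ (i, j))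
      = (\<Sum>k<s. quad_form m b (\<lambda>i. B $$ (k, i)))"
    unfolding sum_mult_gram[symmetric]
        by (intro sum.cong refl) (simp add: gram_entry[OF B] del: index_mult_mat)
  moreover have "(\<Sum>i<n. \<Sum>j<m. (mat_adjoint A * \<phi> (z i j) * B) $$ (i, j))
      = (\<Sum>i<n. \<Sum>j<m. \<Sum>k<r. \<Sum>l<s. cnj (A $$ (k, i)) * \<phi> (z i j) $$ (k, l) * B $$ (l, j))"
    by (intro sum.cong refl sandwich_entry[OF A \<phi> B]) auto
  ultimately show ?thesis by (simp only: corner_functional_def prod.case)
qed

lemma sum_single_entry:
  assumes "p < n" "q < m" "\<And>i j. h i j 0 = 0"
  shows "(\<Sum>i<n. \<Sum>j<m. h i j (single_entry p q c i j)) = h p q c"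
proof -
  have "(\<Sum>i<n. \<Sum>j<m. h i j (single_entry p q c i j))
      = (\<Sum>i<n. \<Sum>j<m. if j = q then if i = p then h p q c else 0 else 0)"
    by (intro sum.cong refl) (auto simp: single_entry_def assms(3))
  then show ?thesis using assms by simp
qed

text \<open>Evaluation at triples with a single nonzero entry isolates one matrix entry. The
  functionals give only real parts; the imaginary parts come from multiplying that entry by
  i.\<close>

lemma corner_functional_eq_scaled:
  assumes lin: "linear_to_mat scale r s \<phi>" and A: "A \<in> carrier_mat r n" and B: "B \<in> carrier_mat s m"
    and lin': "linear_to_mat scale r' s' \<phi>'" and A': "A' \<in> carrier_mat r' n" and B': "B' \<in>
        carrier_mat s' m"
    and eq: "\<And>v. corner_functional n m r' s' (\<lambda>k i. A' $$ (k, i)) \<phi>' (\<lambda>l j. B' $$ (l, j)) v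
      = t * corner_functional n m r s (\<lambda>k i. A $$ (k, i)) \<phi> (\<lambda>l j. B $$ (l, j)) v"
  shows "mat_adjoint A' * A' = of_real t \<cdot>\<^sub>m (mat_adjoint A * A)"
    and "mat_adjoint B' * B' = of_real t \<cdot>\<^sub>m (mat_adjoint B * B)"
    and "mat_adjoint A' * \<phi>' x * B' = of_real t \<cdot>\<^sub>m (mat_adjoint A * \<phi> x * B)"
proof -
  have \<phi>: "\<phi> y \<in> carrier_mat r s" and \<phi>': "\<phi>' y \<in> carrier_mat r' s'" for y
    using lin lin' by (auto simp: linear_to_mat_def)
  note corner = corner_functional_sandwich[OF lin A B] corner_functional_sandwich[OF lin' A' B']
  have z: "(mat_adjoint A * \<phi> 0 * B) $$ (i, j) = 0" "(mat_adjoint A' * \<phi>' 0 * B') $$ (i, j) = 0"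
    if "i < n" "j < m" for i j
    by (simp_all add: sandwich_entry[OF A \<phi> B that] sandwich_entry[OF A' \<phi>' B' that]
        linear_to_mat_zero[OF lin] linear_to_mat_zero[OF lin'] del: index_mult_mat)
  have z0: "(\<Sum>i<n. \<Sum>j<m. (mat_adjoint A * \<phi> 0 * B) $$ (i, j)) = 0"
    "(\<Sum>i<n. \<Sum>j<m. (mat_adjoint A' * \<phi>' 0 * B') $$ (i, j)) = 0"
    by (auto intro!: sum.neutral simp: z simp del: index_mult_mat)
  have ceq: "u = of_real t * w" if "Re (1 * u) = t * Re (1 * w)" "Re (\<i> * u) = t * Re (\<i> * w)"
      for u w
    using that by (simp add: complex_eq_iff)
  show "mat_adjoint A' * A' = of_real t \<cdot>\<^sub>m (mat_adjoint A * A)"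
  proof (rule eq_matI)
    fix p q assume "p < dim_row (of_real t \<cdot>\<^sub>m (mat_adjoint A * A))"
        "q < dim_col (of_real t \<cdot>\<^sub>m (mat_adjoint A * A))"
    then have pq: "p < n" "q < n" using A by auto
    have "Re (c * (mat_adjoint A' * A') $$ (p, q)) = t * Re (c * (mat_adjoint A * A) $$ (p, q))"
        for c
      using eq[of "(single_entry p q c, \<lambda>_ _. 0, \<lambda>_ _. 0)"] unfolding corner z0
      by (subst (asm) (1 2) sum_single_entry[OF pq]) simp_all
    then have "(mat_adjoint A' * A') $$ (p, q) = of_real t * (mat_adjoint A * A) $$ (p, q)"
        by (intro ceq)
    then show "(mat_adjoint A' * A') $$ (p, q) = (of_real t \<cdot>\<^sub>m (mat_adjoint A * A)) $$ (p, q)"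
      using pq A by simp
  qed (use A A' in auto)
  show "mat_adjoint B' * B' = of_real t \<cdot>\<^sub>m (mat_adjoint B * B)"
  proof (rule eq_matI)
    fix p q assume "p < dim_row (of_real t \<cdot>\<^sub>m (mat_adjoint B * B))"
        "q < dim_col (of_real t \<cdot>\<^sub>m (mat_adjoint B * B))"
    then have pq: "p < m" "q < m" using B by auto
    have "Re (c * (mat_adjoint B' * B') $$ (p, q)) = t * Re (c * (mat_adjoint B * B) $$ (p, q))"
        for c
      using eq[of "(\<lambda>_ _. 0, \<lambda>_ _. 0, single_entry p q c)"] unfolding corner z0
      by (subst (asm) (1 2) sum_single_entry[OF pq]) simp_all
    then have "(mat_adjoint B' * B') $$ (p, q) = of_real t * (mat_adjoint B * B) $$ (p, q)"
        by (intro ceq)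
    then show "(mat_adjoint B' * B') $$ (p, q) = (of_real t \<cdot>\<^sub>m (mat_adjoint B * B)) $$ (p, q)"
      using pq B by simp
  qed (use B B' in auto)
  show "mat_adjoint A' * \<phi>' x * B' = of_real t \<cdot>\<^sub>m (mat_adjoint A * \<phi> x * B)"
  proof (rule eq_matI)
    fix p q assume "p < dim_row (of_real t \<cdot>\<^sub>m (mat_adjoint A * \<phi> x * B))"
        "q < dim_col (of_real t \<cdot>\<^sub>m (mat_adjoint A * \<phi> x * B))"
    then have pq: "p < n" "q < m" using A B by auto
    have val: "Re ((mat_adjoint A' * \<phi>' y * B') $$ (p, q))
        = t * Re ((mat_adjoint A * \<phi> y * B) $$ (p, q))" for y
    proof -
      \<comment> \<open>\<open>sum_single_entry\<close> asks for summands that vanish at 0 for all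
        indices, whereas entries outside the matrix are unspecified; hence the case distinction on i
        < n and j < m.\<close>
      have "(\<Sum>i<n. \<Sum>j<m. (mat_adjoint A * \<phi> (single_entry p q y i j) * B) $$ (i, j))
          = (mat_adjoint A * \<phi> y * B) $$ (p, q)"
        "(\<Sum>i<n. \<Sum>j<m. (mat_adjoint A' * \<phi>' (single_entry p q y i j) * B') $$ (i, j))
            = (mat_adjoint A' * \<phi>' y * B') $$ (p, q)"
        using sum_single_entry[OF pq, of "\<lambda>i j y.
            if i < n \<and> j < m then (mat_adjoint A * \<phi> y * B) $$ (i, j) else 0" y]
          sum_single_entry[OF pq, of "\<lambda>i j y.
              if i < n \<and> j < m then (mat_adjoint A' * \<phi>' y * B') $$ (i, j) else 0" y] pq z
        by (simp_all del: index_mult_mat)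
      then show ?thesis using eq[of "(\<lambda>_ _. 0, single_entry p q y, \<lambda>_ _. 0)"] unfolding corner
          by simp
    qed
    have "(mat_adjoint A * \<phi> (scale \<i> x) * B) $$ (p, q) = \<i> * (mat_adjoint A * \<phi> x * B) $$ (p, q)"
      "(mat_adjoint A' * \<phi>' (scale \<i> x) * B') $$ (p, q)
          = \<i> * (mat_adjoint A' * \<phi>' x * B') $$ (p, q)"
      by (simp_all add: sandwich_entry[OF A \<phi> B pq] sandwich_entry[OF A' \<phi>' B' pq]
          linear_to_mat_scale[OF lin] linear_to_mat_scale[OF lin'] sum_distrib_left mult_ac del:
              index_mult_mat)
    then have "(mat_adjoint A' * \<phi>' x * B') $$ (p, q)
        = of_real t * (mat_adjoint A * \<phi> x * B) $$ (p, q)"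
      using val[of x] val[of "scale \<i> x"] by (intro ceq) (simp_all del: index_mult_mat)
    then show "(mat_adjoint A' * \<phi>' x * B') $$ (p, q)
        = (of_real t \<cdot>\<^sub>m (mat_adjoint A * \<phi> x * B)) $$ (p, q)"
      using pq A B by simp
  qed (use A A' B B' in auto)
qed

end

text \<open>Multiplying by \<alpha> on the left and \<beta>^* on the right gives t^2 N = t \<alpha>
  M \<beta>^* , and one factor t cancels.\<close>

lemma smult_conjugation:
  fixes \<alpha> :: "complex mat"
  assumes \<alpha>: "\<alpha> \<in> carrier_mat r r" and \<beta>: "\<beta> \<in> carrier_mat s s" and M: "M \<in> carrier_mat r s"
    and N: "N \<in> carrier_mat r s" and t: "t \<noteq> 0"
    and \<alpha>\<alpha>: "\<alpha> * mat_adjoint \<alpha> = t \<cdot>\<^sub>m 1\<^sub>m r" and \<beta>\<beta>: "\<beta> * mat_adjoint \<beta> = t \<cdot>\<^sub>m 1\<^sub>m s"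
    and eq: "mat_adjoint \<alpha> * N * \<beta> = t \<cdot>\<^sub>m M"
  shows "t \<cdot>\<^sub>m N = \<alpha> * M * mat_adjoint \<beta>"
proof -
  note c = mat_adjoint_carrier[OF \<alpha>] mat_adjoint_carrier[OF \<beta>]
  have "\<alpha> * (mat_adjoint \<alpha> * N * \<beta>) * mat_adjoint \<beta> = (\<alpha> * mat_adjoint \<alpha>) * N * (\<beta> * mat_adjoint \<beta>)"
  proof -
    have "\<alpha> * (mat_adjoint \<alpha> * N * \<beta>) = \<alpha> * (mat_adjoint \<alpha> * N) * \<beta>"
      by (rule assoc_mult_mat[OF \<alpha> mult_carrier_mat[OF c(1) N] \<beta>, symmetric])
    also have "\<alpha> * (mat_adjoint \<alpha> * N) = (\<alpha> * mat_adjoint \<alpha>) * N"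
      by (rule assoc_mult_mat[OF \<alpha> c(1) N, symmetric])
    finally show ?thesis
      using assoc_mult_mat[OF mult_carrier_mat[OF mult_carrier_mat[OF \<alpha> c(1)] N] \<beta> c(2)] by simp
  qed
  also have "\<dots> = t \<cdot>\<^sub>m (t \<cdot>\<^sub>m N)"
    unfolding \<alpha>\<alpha> \<beta>\<beta> using mult_smult_assoc_mat[OF one_carrier_mat N, of t]
      mult_smult_distrib[OF smult_carrier_mat[OF N] one_carrier_mat, of t t] N by simp
  finally have "t \<cdot>\<^sub>m (t \<cdot>\<^sub>m N) = \<alpha> * (t \<cdot>\<^sub>m M) * mat_adjoint \<beta>" by (simp add: eq)
  also have "\<dots> = t \<cdot>\<^sub>m (\<alpha> * M * mat_adjoint \<beta>)"
    using mult_smult_distrib[OF \<alpha> M, of t] mult_smult_assoc_mat[OF mult_carrier_mat[OF \<alpha> M] c(2),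
        of t]
    by simp
  finally have *: "t \<cdot>\<^sub>m (t \<cdot>\<^sub>m N) = t \<cdot>\<^sub>m (\<alpha> * M * mat_adjoint \<beta>)" .
  show ?thesis
  proof (rule eq_matI)
    fix i j assume ij: "i < dim_row (\<alpha> * M * mat_adjoint \<beta>)" "j < dim_col (\<alpha> * M * mat_adjoint \<beta>)"
    then have "t * (t \<cdot>\<^sub>m N) $$ (i, j) = t * (\<alpha> * M * mat_adjoint \<beta>) $$ (i, j)"
      using arg_cong[OF *, of "\<lambda>X. X $$ (i, j)"] N \<alpha> \<beta> M by (simp del: index_mult_mat(1))
    then show "(t \<cdot>\<^sub>m N) $$ (i, j) = (\<alpha> * M * mat_adjoint \<beta>) $$ (i, j)" using t by simp
  qed (use N \<alpha> \<beta> in auto)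
qed

lemma unitary_mat_scaled:
  assumes \<alpha>: "\<alpha> \<in> carrier_mat r r" and t: "0 < t"
    and eq: "mat_adjoint \<alpha> * \<alpha> = of_real t \<cdot>\<^sub>m 1\<^sub>m r" "\<alpha> * mat_adjoint \<alpha> = of_real t \<cdot>\<^sub>m 1\<^sub>m r"
  shows "unitary_mat r (of_real (1 / sqrt t) \<cdot>\<^sub>m mat_adjoint \<alpha>)"
proof -
  let ?c = "complex_of_real (1 / sqrt t)"
  note c = mat_adjoint_carrier[OF \<alpha>]
  have sq: "?c * (?c * of_real t) = 1" using t by (simp flip: of_real_mult)
  have 1: "mat_adjoint (?c \<cdot>\<^sub>m mat_adjoint \<alpha>) = ?c \<cdot>\<^sub>m \<alpha>" by (simp add: mat_adjoint_smult)
  have "(?c \<cdot>\<^sub>m mat_adjoint \<alpha>) * (?c \<cdot>\<^sub>m \<alpha>) = (?c * (?c * of_real t)) \<cdot>\<^sub>m 1\<^sub>m r"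
    using mult_smult_assoc_mat[OF c smult_carrier_mat[OF \<alpha>], of ?c ?c] mult_smult_distrib[OF c \<alpha>,
        of ?c]
    by (auto simp: eq)
  moreover have "(?c \<cdot>\<^sub>m \<alpha>) * (?c \<cdot>\<^sub>m mat_adjoint \<alpha>) = (?c * (?c * of_real t)) \<cdot>\<^sub>m 1\<^sub>m r"
    using mult_smult_assoc_mat[OF \<alpha> smult_carrier_mat[OF c], of ?c ?c] mult_smult_distrib[OF \<alpha> c,
        of ?c]
    by (auto simp: eq)
  ultimately show ?thesis
    unfolding unitary_mat_def 1 sq using c by auto
qed

lemma right_invertible_column:
  assumes A: "A \<in> carrier_mat \<rho> 1" and inv: "right_invertible_mat A"
  shows "\<rho> \<le> 1"
proof (rule ccontr)
  assume "\<not> \<rho> \<le> 1"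
  then have \<rho>: "0 < \<rho>" "1 < \<rho>" by auto
  obtain B where B: "B \<in> carrier_mat 1 \<rho>" "A * B = 1\<^sub>m \<rho>"
    using inv A by (auto simp: right_invertible_mat_def inverts_mat_def)
  have "A $$ (i, 0) * B $$ (0, j) = (if i = j then 1 else 0)" if "i < \<rho>" "j < \<rho>" for i j
    using mat_mult_index_sum[OF A B(1) that] that by (simp add: B(2))
  from this[of 0 0] this[of 0 1] this[of 1 1] show False using \<rho> by auto
qed

section \<open>Purity implies extremality, and the norm is attained\<close>

context operator_space
begin

lemma pure_state_rect_matrix_extreme:
  assumes \<phi>: "\<phi> \<in> CBall scale nrm r s"
    and A: "A \<in> carrier_mat r n" "R \<in> carrier_mat n r" "A * R = 1\<^sub>m r"
    and B: "B \<in> carrier_mat s m" "S \<in> carrier_mat m s" "B * S = 1\<^sub>m s"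
    and f: "f = corner_functional n m r s (\<lambda>k i. A $$ (k, i)) \<phi> (\<lambda>l j. B $$ (l, j))"
    and pure: "\<And>g v. \<lbrakk>functional (corner_scale scale) g; \<And>v. v \<in> corner_cone scale nrm n m \<Longrightarrow> 0
        \<le> g v;
       \<And>v. v \<in> corner_cone scale nrm n m \<Longrightarrow> g v \<le> f v\<rbrakk> \<Longrightarrow> g v = g corner_unit * f v"
  shows "rect_matrix_extreme (CBall scale nrm) r s \<phi>"
  unfolding rect_matrix_extreme_def
proof (intro conjI allI impI \<phi>)
  fix l :: nat and \<rho> \<sigma> :: "nat \<Rightarrow> nat" and vs :: "nat \<Rightarrow> 'a \<Rightarrow> complex mat" and \<alpha> \<beta> i
  assume *: "(\<forall>i<l. 1 \<le> \<rho> i \<and> 1 \<le> \<sigma> i \<and> vs i \<in> CBall scale nrm (\<rho> i) (\<sigma> i) \<and>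
      \<alpha> i \<in> carrier_mat (\<rho> i) r \<and> right_invertible_mat (\<alpha> i) \<and>
      \<beta> i \<in> carrier_mat (\<sigma> i) s \<and> right_invertible_mat (\<beta> i)) \<and>
    msum r r l (\<lambda>i. mat_adjoint (\<alpha> i) * \<alpha> i) = 1\<^sub>m r \<and>
    msum s s l (\<lambda>i. mat_adjoint (\<beta> i) * \<beta> i) = 1\<^sub>m s \<and>
    \<phi> = (\<lambda>x. msum r s l (\<lambda>i. mat_adjoint (\<alpha> i) * vs i x * \<beta> i))"
    and i: "i < l"
  have \<rho>: "1 \<le> \<rho> t" "1 \<le> \<sigma> t" and vs: "vs t \<in> CBall scale nrm (\<rho> t) (\<sigma> t)"
    and \<alpha>: "\<alpha> t \<in> carrier_mat (\<rho> t) r" "right_invertible_mat (\<alpha> t)"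
    and \<beta>: "\<beta> t \<in> carrier_mat (\<sigma> t) s" "right_invertible_mat (\<beta> t)" if "t < l" for t
    using * that by auto
  have sum\<alpha>: "msum r r l (\<lambda>i. mat_adjoint (\<alpha> i) * \<alpha> i) = 1\<^sub>m r"
    and sum\<beta>: "msum s s l (\<lambda>i. mat_adjoint (\<beta> i) * \<beta> i) = 1\<^sub>m s"
    and sum\<phi>: "msum r s l (\<lambda>i. mat_adjoint (\<alpha> i) * vs i x * \<beta> i) = \<phi> x" for x
    using * by auto
  have lin: "linear_to_mat scale r s \<phi>" and linvs: "t < l
      \<Longrightarrow> linear_to_mat scale (\<rho> t) (\<sigma> t) (vs t)" for t
    using \<phi> vs[of t] by (auto simp: CBall_def)
  have \<phi>c: "\<phi> x \<in> carrier_mat r s" and vsc: "t < l \<Longrightarrow> vs t x \<in> carrier_mat (\<rho> t) (\<sigma> t)" for x t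
    using lin linvs[of t] by (auto simp: linear_to_mat_def)
  have \<alpha>A: "\<alpha> t * A \<in> carrier_mat (\<rho> t) n" and \<beta>B: "\<beta> t * B \<in> carrier_mat (\<sigma> t) m" if "t < l" for t
    using \<alpha>[OF that] \<beta>[OF that] A B by auto
  have gram\<alpha>: "mat_adjoint (\<alpha> t * A) * (\<alpha> t * A) = mat_adjoint A * (mat_adjoint (\<alpha> t) * \<alpha> t) * A"
    and gram\<beta>: "mat_adjoint (\<beta> t * B) * (\<beta> t * B) = mat_adjoint B * (mat_adjoint (\<beta> t) * \<beta> t) * B"
    and mid: "mat_adjoint (\<alpha> t * A) * vs t x * (\<beta> t * B)
        = mat_adjoint A * (mat_adjoint (\<alpha> t) * vs t x * \<beta> t) * B"
    if t: "t < l" for t x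
    \<comment> \<open>The two Gram identities are the case of the middle factor 1.\<close>
    using sandwich_assoc[OF A(1) \<alpha>(1)[OF t] one_carrier_mat \<alpha>(1)[OF t] A(1)]
      sandwich_assoc[OF B(1) \<beta>(1)[OF t] one_carrier_mat \<beta>(1)[OF t] B(1)]
      sandwich_assoc[OF A(1) \<alpha>(1)[OF t] vsc[OF t] \<beta>(1)[OF t] B(1)]
      right_mult_one_mat[OF mat_adjoint_carrier[OF \<alpha>A[OF t]]] right_mult_one_mat[OF
          mat_adjoint_carrier[OF \<alpha>(1)[OF t]]]
      right_mult_one_mat[OF mat_adjoint_carrier[OF \<beta>B[OF t]]] right_mult_one_mat[OF
          mat_adjoint_carrier[OF \<beta>(1)[OF t]]]
    by metis+
  define g where "g t = corner_functional n m (\<rho> t) (\<sigma> t) (\<lambda>k i. (\<alpha> t * A) $$ (k, i)) (vs t) (\<lambda>l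
      j. (\<beta> t * B) $$ (l, j))" for t
  have gfun: "functional (corner_scale scale) (g t)" and gpos: "v \<in> corner_cone scale nrm n m \<Longrightarrow> 0
      \<le> g t v"
    if "t < l" for t v
    unfolding g_def using linvs[OF that] vs[OF that]
        by (auto intro: functional_corner_functional corner_functional_nonneg)
  \<comment> \<open>The conditions on the sums of \<alpha>^* \<alpha> and \<beta>^* \<beta> give the
    two diagonal parts, the decomposition of \<phi> gives the corner.\<close>
  have fsum: "f v = (\<Sum>t<l. g t v)" for v
  proof -
    obtain a z b where v: "v = (a, z, b)" using prod_cases3 by blast
    have swap: "(\<Sum>t<l. \<Sum>i<N. \<Sum>j<M. h t i j) = (\<Sum>i<N. \<Sum>j<M. \<Sum>t<l. h t i j)"
        for N M and h :: "nat \<Rightarrow> nat \<Rightarrow> nat \<Rightarrow> complex"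
    proof -
      have "(\<Sum>t<l. \<Sum>i<N. \<Sum>j<M. h t i j) = (\<Sum>i<N. \<Sum>t<l. \<Sum>j<M. h t i j)" by (rule sum.swap)
      also have "\<dots> = (\<Sum>i<N. \<Sum>j<M. \<Sum>t<l. h t i j)" by (intro sum.cong refl sum.swap)
      finally show ?thesis .
    qed
    have "(\<Sum>t<l. \<Sum>i<n. \<Sum>j<n. a i j * (mat_adjoint (\<alpha> t * A) * (\<alpha> t * A)) $$ (i, j))
        = (\<Sum>i<n. \<Sum>j<n. a i j * (mat_adjoint A * A) $$ (i, j))"
      unfolding swap sum_distrib_left[symmetric]
    proof (intro sum.cong refl arg_cong2[of _ _ _ _ "(*)"])
      fix p q assume "p \<in> {..<n}" "q \<in> {..<n}"
      then have "(\<Sum>t<l. (mat_adjoint A * (mat_adjoint (\<alpha> t) * \<alpha> t) * A) $$ (p, q))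
          = (mat_adjoint A * 1\<^sub>m r * A) $$ (p, q)"
        unfolding sum\<alpha>[symmetric]
            by (intro sandwich_msum[OF A(1) mult_carrier_mat[OF mat_adjoint_carrier[OF \<alpha>(1)] \<alpha>(1)]
                A(1)]) auto
      then show "(\<Sum>t<l. (mat_adjoint (\<alpha> t * A) * (\<alpha> t * A)) $$ (p, q))
          = (mat_adjoint A * A) $$ (p, q)"
        using right_mult_one_mat[OF mat_adjoint_carrier[OF A(1)]]
            by (simp add: gram\<alpha> del: index_mult_mat)
    qed
    moreover have "(\<Sum>t<l. \<Sum>i<m. \<Sum>j<m. b i j * (mat_adjoint (\<beta> t * B) * (\<beta> t * B)) $$ (i, j))
        = (\<Sum>i<m. \<Sum>j<m. b i j * (mat_adjoint B * B) $$ (i, j))"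
      unfolding swap sum_distrib_left[symmetric]
    proof (intro sum.cong refl arg_cong2[of _ _ _ _ "(*)"])
      fix p q assume "p \<in> {..<m}" "q \<in> {..<m}"
      then have "(\<Sum>t<l. (mat_adjoint B * (mat_adjoint (\<beta> t) * \<beta> t) * B) $$ (p, q))
          = (mat_adjoint B * 1\<^sub>m s * B) $$ (p, q)"
        unfolding sum\<beta>[symmetric]
            by (intro sandwich_msum[OF B(1) mult_carrier_mat[OF mat_adjoint_carrier[OF \<beta>(1)] \<beta>(1)]
                B(1)]) auto
      then show "(\<Sum>t<l. (mat_adjoint (\<beta> t * B) * (\<beta> t * B)) $$ (p, q))
          = (mat_adjoint B * B) $$ (p, q)"
        using right_mult_one_mat[OF mat_adjoint_carrier[OF B(1)]]
            by (simp add: gram\<beta> del: index_mult_mat)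
    qed
    moreover have "(\<Sum>t<l. \<Sum>i<n. \<Sum>j<m. (mat_adjoint (\<alpha> t * A) * vs t (z i j) * (\<beta> t * B)) $$ (i, j))
        = (\<Sum>i<n. \<Sum>j<m. (mat_adjoint A * \<phi> (z i j) * B) $$ (i, j))"
      unfolding swap
    proof (intro sum.cong refl)
      fix p q assume "p \<in> {..<n}" "q \<in> {..<m}"
      then have "(\<Sum>t<l. (mat_adjoint A * (mat_adjoint (\<alpha> t) * vs t (z p q) * \<beta> t) * B) $$ (p, q))
          = (mat_adjoint A * \<phi> (z p q) * B) $$ (p, q)"
        unfolding sum\<phi>[symmetric]
            by (intro sandwich_msum[OF A(1) _ B(1)] mult_carrier_mat[OF mult_carrier_mat[OF
                mat_adjoint_carrier[OF \<alpha>(1)] vsc] \<beta>(1)]) auto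
      then show "(\<Sum>t<l. (mat_adjoint (\<alpha> t * A) * vs t (z p q) * (\<beta> t * B)) $$ (p, q))
          = (mat_adjoint A * \<phi> (z p q) * B) $$ (p, q)"
        by (simp add: mid del: index_mult_mat)
    qed
    moreover have "(\<Sum>t<l. g t v)
        = (\<Sum>t<l. Re (\<Sum>i<n. \<Sum>j<n. a i j * (mat_adjoint (\<alpha> t * A) * (\<alpha> t * A)) $$ (i, j))
        + Re (\<Sum>i<m. \<Sum>j<m. b i j * (mat_adjoint (\<beta> t * B) * (\<beta> t * B)) $$ (i, j))
        + 2 * Re (\<Sum>i<n. \<Sum>j<m. (mat_adjoint (\<alpha> t * A) * vs t (z i j) * (\<beta> t * B)) $$ (i, j)))"
      unfolding g_def v by (intro sum.cong refl corner_functional_sandwich linvs \<alpha>A \<beta>B) auto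
    ultimately show ?thesis
      unfolding f v corner_functional_sandwich[OF lin A(1) B(1)]
      by (simp only: sum.distrib sum_distrib_left[symmetric] Re_sum[symmetric])
  qed
  \<comment> \<open>The remaining summands are nonnegative on the cone.\<close>
  have "g i v \<le> f v" if "v \<in> corner_cone scale nrm n m" for v
    unfolding fsum using i gpos that by (intro member_le_sum) auto
  then have scaled: "g i v = g i corner_unit * f v" for v using pure[OF gfun[OF i] gpos[OF i]]
      by blast
  define t where "t = g i corner_unit"
  have t0: "0 \<le> t" unfolding t_def by (rule gpos[OF i corner_cone_unit])
  have geq: "corner_functional n m (\<rho> i) (\<sigma> i) (\<lambda>k j. (\<alpha> i * A) $$ (k, j)) (vs i) (\<lambda>l j. (\<beta> i * B)
      $$ (l, j)) v
      = t * corner_functional n m r s (\<lambda>k i. A $$ (k, i)) \<phi> (\<lambda>l j. B $$ (l, j)) v" for v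
    using scaled[of v] by (simp only: t_def g_def f)
  note eqs = corner_functional_eq_scaled[OF lin A(1) B(1) linvs[OF i] \<alpha>A[OF i] \<beta>B[OF i] geq]
  have eq: "mat_adjoint A * (mat_adjoint (\<alpha> i) * \<alpha> i) * A = of_real t \<cdot>\<^sub>m (mat_adjoint A * A)"
    "mat_adjoint B * (mat_adjoint (\<beta> i) * \<beta> i) * B = of_real t \<cdot>\<^sub>m (mat_adjoint B * B)"
    "mat_adjoint A * (mat_adjoint (\<alpha> i) * vs i x * \<beta> i) * B
        = of_real t \<cdot>\<^sub>m (mat_adjoint A * \<phi> x * B)" for x
    by (simp_all only: eqs flip: gram\<alpha>[OF i] gram\<beta>[OF i] mid[OF i])
  note c = \<alpha>(1)[OF i] \<beta>(1)[OF i] vsc[OF i]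
  have pull: "t' \<cdot>\<^sub>m (mat_adjoint X * M * Y) = mat_adjoint X * (t' \<cdot>\<^sub>m M) * Y"
    if "X \<in> carrier_mat r' n'" "M \<in> carrier_mat r' s'" "Y \<in> carrier_mat s' m'"
        for t' X M Y r' n' s' m'
    using mult_smult_distrib[OF mat_adjoint_carrier[OF that(1)] that(2)]
      mult_smult_assoc_mat[OF mult_carrier_mat[OF mat_adjoint_carrier[OF that(1)] that(2)]
          that(3)] by simp
  have a1: "mat_adjoint (\<alpha> i) * \<alpha> i = of_real t \<cdot>\<^sub>m 1\<^sub>m r"
  \<comment> \<open>A has a right inverse, so the compression by A on both sides cancels.\<close>
  proof (rule sandwich_cancel[OF A A])
    show "mat_adjoint A * (mat_adjoint (\<alpha> i) * \<alpha> i) * A = mat_adjoint A * (of_real t \<cdot>\<^sub>m 1\<^sub>m r) * A"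
      unfolding eq pull[OF A(1) one_carrier_mat A(1), symmetric]
      using right_mult_one_mat[OF mat_adjoint_carrier[OF A(1)]] by simp
  qed (use c in auto)
  have b1: "mat_adjoint (\<beta> i) * \<beta> i = of_real t \<cdot>\<^sub>m 1\<^sub>m s"
  proof (rule sandwich_cancel[OF B B])
    show "mat_adjoint B * (mat_adjoint (\<beta> i) * \<beta> i) * B = mat_adjoint B * (of_real t \<cdot>\<^sub>m 1\<^sub>m s) * B"
      unfolding eq pull[OF B(1) one_carrier_mat B(1), symmetric]
      using right_mult_one_mat[OF mat_adjoint_carrier[OF B(1)]] by simp
  qed (use c in auto)
  have v1: "mat_adjoint (\<alpha> i) * vs i x * \<beta> i = of_real t \<cdot>\<^sub>m \<phi> x" for x
  proof (rule sandwich_cancel[OF A B])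
    show "mat_adjoint A * (mat_adjoint (\<alpha> i) * vs i x * \<beta> i) * B
        = mat_adjoint A * (of_real t \<cdot>\<^sub>m \<phi> x) * B"
      unfolding eq pull[OF A(1) \<phi>c B(1)] ..
  qed (use c \<phi>c in auto)
  note a2 = scaled_coisometry[OF \<alpha>(1)[OF i] \<rho>(1)[OF i] \<alpha>(2)[OF i] a1]
  note b2 = scaled_coisometry[OF \<beta>(1)[OF i] \<rho>(2)[OF i] \<beta>(2)[OF i] b1]
  have t: "0 < t" using a2(1) t0 by (simp add: less_le)
  show "\<rho> i = r" "\<sigma> i = s" by (rule a2(2), rule b2(2))
  have \<alpha>r: "\<alpha> i \<in> carrier_mat r r" and \<beta>s: "\<beta> i \<in> carrier_mat s s" and vr: "vs i x \<in> carrier_mat r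
      s" for x
    using c a2(2) b2(2) by auto
  let ?k = "complex_of_real (1 / sqrt t)"
  \<comment> \<open>The adjoint of \<alpha> is taken because extremality asks for the form u^* v w,
    while conjugation yields t times \<open>vs i x\<close> as \<alpha> \<phi>(x) \<beta>^* .\<close>
  let ?u = "?k \<cdot>\<^sub>m mat_adjoint (\<alpha> i)" and ?w = "?k \<cdot>\<^sub>m mat_adjoint (\<beta> i)"
  have "vs i x = mat_adjoint ?u * \<phi> x * ?w" for x
  proof -
    have "of_real t \<cdot>\<^sub>m vs i x = \<alpha> i * \<phi> x * mat_adjoint (\<beta> i)"
      by (rule smult_conjugation[OF \<alpha>r \<beta>s \<phi>c vr _ _ _ v1]) (use a2 b2 in auto)
    moreover have "mat_adjoint ?u * \<phi> x * ?w = (?k * ?k) \<cdot>\<^sub>m (\<alpha> i * \<phi> x * mat_adjoint (\<beta> i))"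
      using mult_smult_assoc_mat[OF \<alpha>r \<phi>c, of ?k x]
        mult_smult_assoc_mat[OF mult_carrier_mat[OF \<alpha>r \<phi>c] smult_carrier_mat[OF
            mat_adjoint_carrier[OF \<beta>s]], of ?k x ?k]
        mult_smult_distrib[OF mult_carrier_mat[OF \<alpha>r \<phi>c] mat_adjoint_carrier[OF \<beta>s], of x ?k]
      by (auto simp: mat_adjoint_smult)
    moreover have "?k * ?k * of_real t = 1" using t by (simp flip: of_real_mult)
    ultimately show ?thesis using vr[of x] by (auto simp flip: \<open>of_real t \<cdot>\<^sub>m vs i x = _\<close>)
  qed
  moreover have "unitary_mat r ?u" "unitary_mat s ?w"
    using unitary_mat_scaled[OF \<alpha>r t a1] unitary_mat_scaled[OF \<beta>s t b1] a2(2,3) b2(2,3) by auto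
  ultimately show "\<exists>u w. unitary_mat r u \<and> unitary_mat s w \<and> vs i = (\<lambda>x. mat_adjoint u * \<phi> x * w)"
    by (intro exI[of _ ?u] exI[of _ ?w]) auto
qed

text \<open>The normalization f(1, 0, 1) = 1 says that the squared norms of A and B add up to 1, so
  the pairing bound is the norm of the amplification itself.\<close>

lemma norm_attained_at_extreme:
  assumes n: "1 \<le> n" and m: "1 \<le> m" and x: "x \<in> carrier_mat n m" and nz: "nrm x \<noteq> 0"
  obtains r s \<phi> where "1 \<le> r" "r \<le> n" "1 \<le> s" "s \<le> m"
    "rect_matrix_extreme (CBall scale nrm) r s \<phi>" "nrm x \<le> op_norm (amplify r s \<phi> x)"
proof -
  obtain f where f: "functional (corner_scale scale) f" "\<And>v. v \<in> corner_cone scale nrm n m \<Longrightarrow> 0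
      \<le> f v"
    "f corner_unit = 1" "nrm x \<le> f (0, \<lambda>i j. x $$ (i, j), 0)"
    and pure: "\<And>g v. \<lbrakk>functional (corner_scale scale) g; \<And>v. v \<in> corner_cone scale nrm n m \<Longrightarrow> 0
        \<le> g v;
       \<And>v. v \<in> corner_cone scale nrm n m \<Longrightarrow> g v \<le> f v\<rbrakk> \<Longrightarrow> g v = g corner_unit * f v"
    by (rule pure_corner_state_exists[OF n m x]) blast
  obtain r s A R B S \<phi> where rs: "r \<le> n" "s \<le> m" and \<phi>: "\<phi> \<in> CBall scale nrm r s"
    and AR: "\<And>k l. k < r \<Longrightarrow> l < r \<Longrightarrow> (\<Sum>i<n. A k i * R i l) = id_coeffs k l"
    and BS: "\<And>k l. k < s \<Longrightarrow> l < s \<Longrightarrow> (\<Sum>i<m. B k i * S i l) = id_coeffs k l"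
    and feq: "f = corner_functional n m r s A \<phi> B"
  proof (rule state_representation[OF f(1,2)])
    fix r s A R B S \<phi>
    assume "r \<le> n" "s \<le> m" "\<phi> \<in> CBall scale nrm r s"
      "\<And>k l. k < r \<Longrightarrow> l < r \<Longrightarrow> (\<Sum>i<n. A k i * R i l) = id_coeffs k l"
      "\<And>k l. k < s \<Longrightarrow> l < s \<Longrightarrow> (\<Sum>i<m. B k i * S i l) = id_coeffs k l"
      "f = corner_functional n m r s A \<phi> B"
    then show thesis by (rule that)
  qed
  let ?P = "\<Sum>i<n. \<Sum>j<m. \<Sum>k<r. \<Sum>l<s. cnj (A k i) * \<phi> (x $$ (i, j)) $$ (k, l) * B l j"
  have fx: "nrm x \<le> 2 * Re ?P" using f(4) by (simp add: feq corner_functional_def quad_form_def)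
  have swap: "(\<Sum>i<N. sqnorm K (\<lambda>k. h k i)) = (\<Sum>k<K. sqnorm N (h k))" for N K h
    unfolding sqnorm_def by (rule sum.swap)
  have "1 = (\<Sum>k<r. sqnorm n (A k)) + (\<Sum>k<s. sqnorm m (B k))
      + 2 * Re (\<Sum>i<n. \<Sum>j<m. \<Sum>k<r. \<Sum>l<s. cnj (A k i) * \<phi> 0 $$ (k, l) * B l j)"
    using f(3) by (simp add: feq corner_functional_def corner_unit_def quad_form_id)
  moreover have "(\<Sum>i<n. \<Sum>j<m. \<Sum>k<r. \<Sum>l<s. cnj (A k i) * \<phi> 0 $$ (k, l) * B l j) = 0"
    using \<phi> by (auto intro!: sum.neutral simp: CBall_def linear_to_mat_zero)
  ultimately have one: "(\<Sum>k<r. sqnorm n (A k)) + (\<Sum>k<s. sqnorm m (B k)) = 1" by simp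
  have "2 * Re ?P \<le> op_norm (amplify r s \<phi> x) * ((\<Sum>i<n. sqnorm r (\<lambda>k. A k i)) + (\<Sum>j<m. sqnorm s
      (\<lambda>k. B k j)))"
    by (rule op_norm_amplify_pairing[OF x])
  then have le: "nrm x \<le> op_norm (amplify r s \<phi> x)"
      using fx one swap[where N = n and K = r and h = A] swap[where N = m and K = s and h = B]
          by simp
  \<comment> \<open>If r or s were 0, this sum would be empty; a nonzero norm excludes that.\<close>
  have pos: "?P \<noteq> 0"
  proof
    assume "?P = 0"
    then have "Re ?P = 0" by (simp only: zero_complex.sel)
    then show False using fx nz nrm_nonneg[OF n m x] by linarith
  qed
  have rs1: "1 \<le> r" "1 \<le> s"
  proof -
    have "r = 0 \<Longrightarrow> ?P = 0" "s = 0 \<Longrightarrow> ?P = 0" by simp_all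
    then show "1 \<le> r" "1 \<le> s" using pos by (metis less_one not_le)+
  qed
  define A' where "A' = mat r n (\<lambda>(k, i). A k i)"
  define R' where "R' = mat n r (\<lambda>(k, i). R k i)"
  define B' where "B' = mat s m (\<lambda>(k, i). B k i)"
  define S' where "S' = mat m s (\<lambda>(k, i). S k i)"
  have cA: "A' \<in> carrier_mat r n" "R' \<in> carrier_mat n r" and cB: "B' \<in> carrier_mat s m"
      "S' \<in> carrier_mat m s"
    by (auto simp: A'_def R'_def B'_def S'_def)
  have AR': "A' * R' = 1\<^sub>m r"
  proof (rule eq_matI)
    fix k l assume "k < dim_row (1\<^sub>m r :: complex mat)" "l < dim_col (1\<^sub>m r :: complex mat)"
    then have kl: "k < r" "l < r" by auto
    show "(A' * R') $$ (k, l) = 1\<^sub>m r $$ (k, l)"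
      unfolding mat_mult_index_sum[OF cA kl] using AR[OF kl] kl
          by (simp add: A'_def R'_def id_coeffs_def)
  qed (use cA in auto)
  have BS': "B' * S' = 1\<^sub>m s"
  proof (rule eq_matI)
    fix k l assume "k < dim_row (1\<^sub>m s :: complex mat)" "l < dim_col (1\<^sub>m s :: complex mat)"
    then have kl: "k < s" "l < s" by auto
    show "(B' * S') $$ (k, l) = 1\<^sub>m s $$ (k, l)"
      unfolding mat_mult_index_sum[OF cB kl] using BS[OF kl] kl
          by (simp add: B'_def S'_def id_coeffs_def)
  qed (use cB in auto)
  have "f = corner_functional n m r s (\<lambda>k i. A' $$ (k, i)) \<phi> (\<lambda>l j. B' $$ (l, j))"
    unfolding feq corner_functional_def quad_form_def A'_def B'_def
    by (intro ext) (simp cong: prod.case_cong)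
  then have "rect_matrix_extreme (CBall scale nrm) r s \<phi>"
    by (rule pure_state_rect_matrix_extreme[OF \<phi> cA AR' cB BS' _ pure])
  then show thesis using that rs rs1 le by blast
qed

text \<open>Covers X = 0, where no element of positive norm supplies an extreme point. A right
  invertible column has at most one row, so all pieces of a combination are 1 by 1, and every linear
  map on X is 0.\<close>

lemma zero_space_extreme:
  assumes "\<And>x :: 'a. x = 0"
  shows "rect_matrix_extreme (CBall scale nrm) 1 1 (\<lambda>_. 0\<^sub>m 1 1)"
  unfolding rect_matrix_extreme_def
proof (intro conjI allI impI)
  have "op_norm (amplify 1 1 (\<lambda>_. 0\<^sub>m 1 1) y) \<le> nrm y" if "1 \<le> k" "1 \<le> l" "y \<in> carrier_mat k l"
      for k l and y :: "'a mat"
  proof (rule op_norm_leI[OF amplify_carrier[OF that(3)] nrm_nonneg[OF that]])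
    fix \<xi> \<eta> :: "nat \<Rightarrow> complex"
    have "(\<Sum>p<k * 1. \<Sum>q<l * 1. cnj (\<xi> p) * amplify 1 1 (\<lambda>_. 0\<^sub>m 1 1) y $$ (p, q) * \<eta> q) = 0"
      using that(3) by (intro sum.neutral ballI) (auto simp: amplify_def)
    then show "2 * Re (\<Sum>p<k * 1. \<Sum>q<l * 1. cnj (\<xi> p) * amplify 1 1 (\<lambda>_. 0\<^sub>m 1 1) y $$ (p, q) * \<eta> q)
        \<le> nrm y * (sqnorm (k * 1) \<xi> + sqnorm (l * 1) \<eta>)"
      using nrm_nonneg[OF that] by simp
  qed
  then show "(\<lambda>_. 0\<^sub>m 1 1) \<in> CBall scale nrm 1 1"
    by (auto simp: CBall_def linear_to_mat_def completely_contractive_def)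
next
  fix l :: nat and \<rho> \<sigma> :: "nat \<Rightarrow> nat" and vs :: "nat \<Rightarrow> 'a \<Rightarrow> complex mat" and \<alpha> \<beta> i
  assume *: "(\<forall>i<l. 1 \<le> \<rho> i \<and> 1 \<le> \<sigma> i \<and> vs i \<in> CBall scale nrm (\<rho> i) (\<sigma> i) \<and>
      \<alpha> i \<in> carrier_mat (\<rho> i) 1 \<and> right_invertible_mat (\<alpha> i) \<and>
      \<beta> i \<in> carrier_mat (\<sigma> i) 1 \<and> right_invertible_mat (\<beta> i)) \<and>
    msum 1 1 l (\<lambda>i. mat_adjoint (\<alpha> i) * \<alpha> i) = 1\<^sub>m 1 \<and>
    msum 1 1 l (\<lambda>i. mat_adjoint (\<beta> i) * \<beta> i) = 1\<^sub>m 1 \<and>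
    (\<lambda>_ :: 'a. 0\<^sub>m 1 1) = (\<lambda>x. msum 1 1 l (\<lambda>i. mat_adjoint (\<alpha> i) * vs i x * \<beta> i))"
    and i: "i < l"
  have "1 \<le> \<rho> i" "1 \<le> \<sigma> i" "\<rho> i \<le> 1" "\<sigma> i \<le> 1" and vs: "vs i \<in> CBall scale nrm (\<rho> i) (\<sigma> i)"
    using * i right_invertible_column by blast+
  then show one: "\<rho> i = 1" "\<sigma> i = 1" by simp_all
  have lin: "linear_to_mat scale 1 1 (vs i)" using vs one by (simp add: CBall_def)
  have "vs i x = 0\<^sub>m 1 1" for x
    using lin linear_to_mat_zero[OF lin] assms[of x]
        by (intro eq_matI) (auto simp: linear_to_mat_def)
  then have "vs i = (\<lambda>x. mat_adjoint (1\<^sub>m 1) * 0\<^sub>m 1 1 * 1\<^sub>m 1)" by (auto simp: fun_eq_iff)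
  moreover have "unitary_mat 1 (1\<^sub>m 1)" by (simp add: unitary_mat_def)
  ultimately show "\<exists>u w. unitary_mat 1 u \<and> unitary_mat 1 w \<and> vs i
      = (\<lambda>x. mat_adjoint u * 0\<^sub>m 1 1 * w)"
    by blast
qed

text \<open>For norm 0 the inequality is trivial, but an extreme point of admissible size has to
  exist; any element of positive norm in the same matrix space supplies one.\<close>

lemma norm_le_extreme:
  assumes n: "1 \<le> n" and m: "1 \<le> m" and x: "x \<in> carrier_mat n m"
  obtains r s \<phi> where "1 \<le> r" "r \<le> n" "1 \<le> s" "s \<le> m"
    "rect_matrix_extreme (CBall scale nrm) r s \<phi>" "nrm x \<le> op_norm (amplify r s \<phi> x)"
proof (cases "nrm x = 0")
  case False
  then show ?thesis using norm_attained_at_extreme[OF n m x] that by blast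
next
  case True
  show ?thesis
  proof (cases "\<exists>y\<in>carrier_mat n m. nrm y \<noteq> 0")
    case y: True
    then obtain y where "y \<in> carrier_mat n m" "nrm y \<noteq> 0" by blast
    then obtain r s \<phi> where "1 \<le> r" "r \<le> n" "1 \<le> s" "s \<le> m"
        "rect_matrix_extreme (CBall scale nrm) r s \<phi>"
      using norm_attained_at_extreme[OF n m] by metis
    then show ?thesis using that op_norm_nonneg True by metis
  next
    case False
    \<comment> \<open>A constant matrix with nonzero entries would have positive norm, so X itself
      is 0.\<close>
    have "c = 0" for c :: 'a
    proof -
      have "mat n m (\<lambda>_. c) = 0\<^sub>m n m" using False nrm_eq_0_iff[OF n m] by (metis mat_carrier)
      then have "mat n m (\<lambda>_. c) $$ (0, 0) = 0\<^sub>m n m $$ (0, 0)" by simp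
      then show ?thesis using n m by simp
    qed
    then have "rect_matrix_extreme (CBall scale nrm) 1 1 (\<lambda>_. 0\<^sub>m 1 1)" by (rule zero_space_extreme)
    then show ?thesis using n m op_norm_nonneg True by (intro that[of 1 1]) auto
  qed
qed

end

theorem corollary3p10:
  fixes scale :: "complex \<Rightarrow> 'a::ab_group_add \<Rightarrow> 'a"
    and nrm :: "'a mat \<Rightarrow> real"
    and n m :: nat and x :: "'a mat"
  assumes "operator_space scale nrm"
    and "1 \<le> n" and "1 \<le> m"
    and "x \<in> carrier_mat n m"
  shows "isLub UNIV
           {op_norm (amplify r s \<phi> x) | r s \<phi>.
              1 \<le> r \<and> r \<le> n \<and> 1 \<le> s \<and> s \<le> m \<and>
              rect_matrix_extreme (CBall scale nrm) r s \<phi>}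
           (nrm x)"
proof -
  interpret operator_space scale nrm by fact
  let ?S = "{op_norm (amplify r s \<phi> x) | r s \<phi>.
    1 \<le> r \<and> r \<le> n \<and> 1 \<le> s \<and> s \<le> m \<and> rect_matrix_extreme (CBall scale nrm) r s \<phi>}"
  obtain r s \<phi> where "1 \<le> r" "r \<le> n" "1 \<le> s" "s \<le> m" "rect_matrix_extreme (CBall scale nrm) r s \<phi>"
    and le: "nrm x \<le> op_norm (amplify r s \<phi> x)"
    by (rule norm_le_extreme[OF assms(2-4)])
  then have mem: "op_norm (amplify r s \<phi> x) \<in> ?S" by blast
  have upper: "u \<le> nrm x" if "u \<in> ?S" for u
    using that assms(2-4) by (auto simp: rect_matrix_extreme_def CBall_def
        completely_contractive_def)
  show ?thesis
  proof (rule isLubI2)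
    show "isUb UNIV ?S (nrm x)" by (rule isUbI[OF setleI]) (use upper in auto)
    show "nrm x <=* Collect (isUb UNIV ?S)"
    proof (rule setgeI, rule ballI)
      fix u assume "u \<in> Collect (isUb UNIV ?S)"
      then have "op_norm (amplify r s \<phi> x) \<le> u" using mem by (auto simp: isUb_def setle_def)
      then show "nrm x \<le> u" using le by simp
    qed
  qed
qed

end
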